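(* Let $\Omega$ be an interpolation data set whose Pick matrix $P$ is invertible. The Boundary Interpolation Problem with inequalities and the Master Boundary Interpolation Problem for $\Omega$ are equivalent (i.e., have the same set of solutions) if and only if all of the diagonal entries of the inverse $P^{-1}$ of the Pick matrix are positive.
   Context: Classes. $\mathbb{C}^+$ is the open upper half plane. For $w$ meromorphic on $\mathbb{C}^+$, $\rho(w)\subset\mathbb{C}^+$ is its domain of analyticity and $K_w(z,\zeta)=\frac{w(z)-\overline{w(\zeta)}}{z-\bar\zeta}$. For an integer $\kappa\ge 0$, $\mathbf{N}_\kappa$ is the set of $w$ meromorphic on $\mathbb{C}^+$ such that all matrices $[K_w(z_j,z_i)]_{i,j=1}^m$ ($m\ge1$, $z_i\in\rho(w)$) have at most $\kappa$ negative eigenvalues, and at least one has exactly $\kappa$. $\mathrm{sq}_-A$ is the number of negative eigenvalues (with multiplicity) of a Hermitian matrix $A$. Boundary limits. For $x\in\mathbb{R}$, $w(x)$, $w'(x)$ and $w_{-1}(x)$ denote the nontangential limits as $z\to x$ of $w(z)$, $w'(z)$ and $(z-x)w(z)$, when they exist; $w_{-1}(x)=\infty$ is allowed, with $1/\infty=0$. Data. $\Omega=\{\{x_i\}_{i=1}^n,\{w_j\}_{j=1}^\ell,\{\gamma_j\}_{j=1}^\ell,\{\xi_k\}_{k=\ell+1}^n\}$, $0\le\ell\le n$, where $x_i$ are distinct real numbers, $w_j,\gamma_j\in\mathbb{R}$, $\xi_k\in\mathbb{R}\setminus\{0\}$. The Pick matrix $P=[p_{ij}]_{i,j=1}^n$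 is the real symmetric matrix with: $p_{ij}=\frac{w_j-w_i}{x_j-x_i}$ for $i\ne j$ and $p_{ii}=\gamma_i$, for $i,j\le\ell$; $p_{ij}=p_{ji}=\frac{\xi_j}{x_j-x_i}$ for $i\le\ell<j$; $p_{ii}=-\xi_i$ and $p_{ij}=0$ $(i\neq j)$ for $i,j>\ell$. Interpolation conditions with inequalities at $x_i$: for $i\le\ell$: $w(x_i)=w_i$ and $-\infty<w'(x_i)\le\gamma_i$; for $i>\ell$: $-\infty<-\frac1{w_{-1}(x_i)}\le-\frac1{\xi_i}$. Boundary Interpolation Problem with inequalities: find all $w\in\mathbf{N}_\kappa$, $\kappa=\mathrm{sq}_-P$, satisfying these conditions at every $x_1,\dots,x_n$. Master Boundary Interpolation Problem: find all functions $w$ such that $w\in\mathbf{N}_{\kappa'}$ for some $\kappa'\le\kappa=\mathrm{sq}_-P$ and $w$ satisfies these conditions at all but $\kappa-\kappa'$ of the points $x_1,\dots,x_n$. *)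

theory Defs
  imports
    "HOL-Complex_Analysis.Meromorphic"
    "Jordan_Normal_Form.Char_Poly"
    "Jordan_Normal_Form.Gauss_Jordan_Elimination"
begin

text \<open>
  Multiplicities are taken as orders of roots of the characteristic polynomial. The notion is only
  applied to Hermitian matrices, where all eigenvalues are real and algebraic and geometric
  multiplicities agree.
\<close>

definition sq_neg :: "complex mat \<Rightarrow> nat" where
  "sq_neg A = (\<Sum>c | c < 0 \<and> eigenvalue A (complex_of_real c).
     order (complex_of_real c) (char_poly A))"

definition upper_half_plane :: "complex set" where
  "upper_half_plane = {z. Im z > 0}"

definition analyticity_domain :: "(complex \<Rightarrow> complex) \<Rightarrow> complex set" where
  "analyticity_domain w = {z \<in> upper_half_plane. w analytic_on {z}}"

definition nevanlinna_kernel :: "(complex \<Rightarrow> complex) \<Rightarrow> complex \<Rightarrow> complex \<Rightarrow> complex" where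
  "nevanlinna_kernel w z \<zeta> = (w z - cnj (w \<zeta>)) / (z - cnj \<zeta>)"

definition kernel_matrix :: "(complex \<Rightarrow> complex) \<Rightarrow> nat \<Rightarrow> (nat \<Rightarrow> complex) \<Rightarrow> complex mat" where
  "kernel_matrix w m z = mat m m (\<lambda>(i, j). nevanlinna_kernel w (z j) (z i))"

text \<open>
  The normalisation \<^const>\<open>nicely_meromorphic_on\<close> (value \<open>0\<close> at poles, no removable singularities)
  lets a total function represent a meromorphic function on the upper half plane uniquely there;
  the values elsewhere are irrelevant.
\<close>

definition gen_nevanlinna :: "nat \<Rightarrow> (complex \<Rightarrow> complex) set" where
  "gen_nevanlinna \<kappa> = {w. w nicely_meromorphic_on upper_half_plane \<and>
     (\<forall>m\<ge>1. \<forall>z. (\<forall>i<m. z i \<in> analyticity_domain w) \<longrightarrow> sq_neg (kernel_matrix w m z) \<le> \<kappa>) \<and>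
     (\<exists>m\<ge>1. \<exists>z. (\<forall>i<m. z i \<in> analyticity_domain w) \<and> sq_neg (kernel_matrix w m z) = \<kappa>)}"

text \<open>
  Convergence along this filter means convergence within every Stolz angle at \<open>x\<close>: a property
  holds eventually for a supremum of filters iff it does so for each of them.
\<close>

definition nontangential :: "(complex \<Rightarrow> complex) \<Rightarrow> real \<Rightarrow> complex filter" where
  "nontangential w x = (SUP \<alpha>\<in>{0<..}. at (complex_of_real x) within
     {z \<in> analyticity_domain w. \<bar>Re z - x\<bar> \<le> \<alpha> * Im z})"

definition regular_condition :: "(complex \<Rightarrow> complex) \<Rightarrow> real \<Rightarrow> real \<Rightarrow> real \<Rightarrow> bool" where
  "regular_condition w x a g \<longleftrightarrow>
     (w \<longlongrightarrow> complex_of_real a) (nontangential w x) \<and>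
     (\<exists>d. (deriv w \<longlongrightarrow> complex_of_real d) (nontangential w x) \<and> d \<le> g)"

text \<open>
  The condition \<open>-\<infinity> < -1/w\<^sub>-\<^sub>1(x) \<le> -1/\<xi>\<close>, where the nontangential limit \<open>w\<^sub>-\<^sub>1(x)\<close> of
  \<open>(z - x) w(z)\<close> is either a nonzero real number or infinite, in which case \<open>1/w\<^sub>-\<^sub>1(x) = 0\<close>.
\<close>

definition singular_condition :: "(complex \<Rightarrow> complex) \<Rightarrow> real \<Rightarrow> real \<Rightarrow> bool" where
  "singular_condition w x \<xi> \<longleftrightarrow>
     (\<exists>c. ((\<lambda>z. (z - complex_of_real x) * w z) \<longlongrightarrow> complex_of_real c) (nontangential w x) \<and>
          c \<noteq> 0 \<and> - 1 / c \<le> - 1 / \<xi>) \<or>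
     (filterlim (\<lambda>z. (z - complex_of_real x) * w z) at_infinity (nontangential w x) \<and>
          0 \<le> - 1 / \<xi>)"

text \<open>
  Indices are shifted to start at \<open>0\<close>: the nodes are \<open>x i\<close> for \<open>i < n\<close>, those with \<open>i < l\<close> are
  regular (with data \<open>a i\<close> and \<open>g i\<close>), those with \<open>l \<le> i\<close> are singular (with data \<open>\<xi> i\<close>).
  Values of the sequences at other indices are never used.
\<close>

definition interpolation_data :: "nat \<Rightarrow> nat \<Rightarrow> (nat \<Rightarrow> real) \<Rightarrow> (nat \<Rightarrow> real) \<Rightarrow> bool" where
  "interpolation_data n l x \<xi> \<longleftrightarrow> l \<le> n \<and> inj_on x {..<n} \<and> (\<forall>k\<in>{l..<n}. \<xi> k \<noteq> 0)"

definition pick_matrix ::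
  "nat \<Rightarrow> nat \<Rightarrow> (nat \<Rightarrow> real) \<Rightarrow> (nat \<Rightarrow> real) \<Rightarrow> (nat \<Rightarrow> real) \<Rightarrow> (nat \<Rightarrow> real) \<Rightarrow> real mat" where
  "pick_matrix n l x a g \<xi> = mat n n (\<lambda>(i, j).
     if i < l \<and> j < l then (if i = j then g i else (a j - a i) / (x j - x i))
     else if i < l then \<xi> j / (x j - x i)
     else if j < l then \<xi> i / (x i - x j)
     else if i = j then - \<xi> i else 0)"

definition pick_negative_squares ::
  "nat \<Rightarrow> nat \<Rightarrow> (nat \<Rightarrow> real) \<Rightarrow> (nat \<Rightarrow> real) \<Rightarrow> (nat \<Rightarrow> real) \<Rightarrow> (nat \<Rightarrow> real) \<Rightarrow> nat" where
  "pick_negative_squares n l x a g \<xi> = sq_neg (map_mat complex_of_real (pick_matrix n l x a g \<xi>))"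

definition interpolates_at ::
  "nat \<Rightarrow> (nat \<Rightarrow> real) \<Rightarrow> (nat \<Rightarrow> real) \<Rightarrow> (nat \<Rightarrow> real) \<Rightarrow> (nat \<Rightarrow> real) \<Rightarrow>
   (complex \<Rightarrow> complex) \<Rightarrow> nat \<Rightarrow> bool" where
  "interpolates_at l x a g \<xi> w i \<longleftrightarrow>
     (if i < l then regular_condition w (x i) (a i) (g i) else singular_condition w (x i) (\<xi> i))"

definition boundary_solutions ::
  "nat \<Rightarrow> nat \<Rightarrow> (nat \<Rightarrow> real) \<Rightarrow> (nat \<Rightarrow> real) \<Rightarrow> (nat \<Rightarrow> real) \<Rightarrow> (nat \<Rightarrow> real) \<Rightarrow>
   (complex \<Rightarrow> complex) set" where
  "boundary_solutions n l x a g \<xi> =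
     {w \<in> gen_nevanlinna (pick_negative_squares n l x a g \<xi>). \<forall>i<n. interpolates_at l x a g \<xi> w i}"

text \<open>
  \<open>All but \<kappa> - \<kappa>'\<close> is read as: there are \<open>\<kappa> - \<kappa>'\<close> nodes off which the conditions hold, while at
  these nodes they may or may not hold.
\<close>

definition master_solutions ::
  "nat \<Rightarrow> nat \<Rightarrow> (nat \<Rightarrow> real) \<Rightarrow> (nat \<Rightarrow> real) \<Rightarrow> (nat \<Rightarrow> real) \<Rightarrow> (nat \<Rightarrow> real) \<Rightarrow>
   (complex \<Rightarrow> complex) set" where
  "master_solutions n l x a g \<xi> =
     {w. \<exists>\<kappa>'\<le>pick_negative_squares n l x a g \<xi>. w \<in> gen_nevanlinna \<kappa>' \<and>
        (\<exists>E\<subseteq>{..<n}. card E = pick_negative_squares n l x a g \<xi> - \<kappa>' \<and>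
           (\<forall>i\<in>{..<n} - E. interpolates_at l x a g \<xi> w i))}"

end

theory Submission
  imports Defs "Jordan_Normal_Form.Schur_Decomposition"
begin

text \<open>
  The two solution sets differ iff some function of class \<open>\<kappa>' < \<kappa>\<close> satisfies the conditions off a
  set \<open>E\<close> of \<open>\<kappa> - \<kappa>'\<close> nodes. Such a function forces the Pick matrix with the rows and columns in
  \<open>E\<close> removed to have at most \<open>\<kappa>'\<close> negative eigenvalues, because it dominates a limit of scaled
  kernel matrices. Since removing a node \<open>e\<close> preserves the number of negative eigenvalues when the
  \<open>e\<close>-th diagonal entry of the inverse is positive, and each further node lowers it by at most one,
  this is impossible if all these entries are positive.

  If one of these entries is not positive, removing the corresponding node loses a negative
  eigenvalue. Remove a maximal set of nodes of which each loses one, and then lower the diagonal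
  entries at the remaining nodes as far as possible without creating a negative eigenvalue. The
  resulting matrix \<open>Q\<close> has a real null vector \<open>u\<close> without zero entries. With \<open>(e, c) = (1, a)\<close> at the
  regular and \<open>(e, c) = (0, \<xi>)\<close> at the singular nodes, the entries satisfy
  \<open>(x i - x j) * Q i j = c i * e j - e i * c j\<close>, so that
  \<open>w z = (\<Sum>i. u i * c i / (x i - z)) / (\<Sum>i. u i * e i / (x i - z))\<close> satisfies the conditions, and its
  kernel is congruent to a compression of \<open>Q\<close>. If no regular node remains, the denominator vanishes and
  \<open>w z = (\<Sum>i. \<xi> i / (z - x i))\<close> takes its place.
\<close>

section \<open>Diagonalization of Hermitian matrices\<close>

text \<open>The class index of a function is unique, so a single member of the master set with
  \<kappa>' < \<kappa> refutes equality of the sets. For the constructed \<open>w\<close> the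
  factorized kernel bounds the class only from above; the matching lower bound is the limit
  argument, applied to \<open>w\<close> itself.

  Maximality of the removed set is what stops the lowering of the diagonal. Lowering entry i without
  bound leaves at least one negative square more than deleting node i would; after maximal removal a
  further deletion costs none, so the count has to jump at a finite value. Just before the jump the
  i-th unit vector lies outside the range, which yields a null vector with nonzero i-th entry. A
  zero entry would make the node drop out of the quotient, hence the demand that none vanishes.

  Counting is done with quadratic forms: negative subspaces bound the index from below, linear
  conditions that enforce nonnegativity bound it from above. The index is only lower semicontinuous.
  This is used three times: for the boundary limits, for attaining the extremal diagonal, and for
  reaching points where the factorization of the kernel is undefined.\<close>

lemma homogeneous_system_solution:
  fixes C :: "nat \<Rightarrow> nat \<Rightarrow> complex"
  assumes "p < k"
  obtains y where "\<exists>a<k. y a \<noteq> 0" "\<And>b. b < p \<Longrightarrow> (\<Sum>a<k. C b a * y a) = 0"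
proof -
  \<comment> \<open>The system is padded with zero rows to a square matrix. Row \<open>p\<close> is
    zero because \<open>p < k\<close>, so the transpose kills the p-th unit vector and the
    determinant vanishes.\<close>
  define A where "A = Matrix.mat k k (\<lambda>(b, a). if b < p then C b a else 0)"
  have A: "A \<in> carrier_mat k k" by (simp add: A_def)
  have "transpose_mat A *\<^sub>v unit_vec k p = 0\<^sub>v k"
    using assms by (intro eq_vecI) (auto simp: A_def)
  moreover have "unit_vec k p \<noteq> (0\<^sub>v k :: complex Matrix.vec)"
    using assms by simp
  ultimately have "Determinant.det (transpose_mat A) = 0"
    using A by (subst det_0_iff_vec_prod_zero_field[of _ k]) (auto intro!: exI[of _ "unit_vec k p"])
  then have "Determinant.det A = 0"
    using A by (simp add: Determinant.det_transpose)
  then obtain v where v: "v \<in> carrier_vec k" "v \<noteq> 0\<^sub>v k" "A *\<^sub>v v = 0\<^sub>v k"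
    using A det_0_iff_vec_prod_zero_field by blast
  show ?thesis
  proof (rule that[of "vec_index v"])
    show "\<exists>a<k. vec_index v a \<noteq> 0"
      using v(1,2) by (metis carrier_vecD eq_vecI index_zero_vec(1) zero_carrier_vec)
    fix b assume b: "b < p"
    then have "vec_index (A *\<^sub>v v) b = (\<Sum>a<k. C b a * vec_index v a)"
      using v(1) assms by (simp add: A_def scalar_prod_def atLeast0LessThan)
    then show "(\<Sum>a<k. C b a * vec_index v a) = 0"
      using v(3) b assms by simp
  qed
qed

text \<open>Schur triangularization puts \<open>es\<close> on the diagonal of \<open>B\<close>, and
  the trace is invariant under cyclic permutation of the factors.\<close>

lemma trace_eq_sum_eigenvalues:
  fixes A :: "complex mat"
  assumes A: "A \<in> carrier_mat n n" and es: "char_poly A = (\<Prod>e\<leftarrow>es. [:- e, 1:])"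
  shows "(\<Sum>i<n. A $$ (i, i)) = sum_list es"
proof -
  obtain B P Q where BPQ: "schur_decomposition A es = (B, P, Q)"
    using prod_cases3 by blast
  note S = schur_decomposition[OF A es BPQ]
  then have sim: "similar_mat_wit A B P Q" and d: "diag_mat B = es" by auto
  note W = similar_mat_witD2[OF A sim]
  have "A = P * (B * Q)"
    using W(3) assoc_mult_mat[OF W(6,5,7)] by simp
  then have "(\<Sum>i<n. A $$ (i, i)) = (\<Sum>i<n. (P * (B * Q)) $$ (i, i))"
    by simp
  also have "\<dots> = (\<Sum>i<n. \<Sum>j<n. P $$ (i, j) * (B * Q) $$ (j, i))"
    using W(5-7) by (intro sum.cong refl) (auto simp: scalar_prod_def atLeast0LessThan)
  also have "\<dots> = (\<Sum>j<n. \<Sum>i<n. (B * Q) $$ (j, i) * P $$ (i, j))"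
    by (subst sum.swap) (simp add: mult.commute)
  also have "\<dots> = (\<Sum>j<n. (B * Q * P) $$ (j, j))"
    using W(5-7) by (intro sum.cong refl)
      (auto simp: scalar_prod_def atLeast0LessThan simp del: assoc_mult_mat)
  also have "B * Q * P = B"
    using assoc_mult_mat[OF W(5,7,6)] W(2) right_mult_one_mat[OF W(5)] by simp
  also have "(\<Sum>j<n. B $$ (j, j)) = sum_list es"
    using W(5) unfolding d[symmetric] diag_mat_def by (simp add: sum_list_sum_nth atLeast0LessThan)
  finally show ?thesis .
qed

text \<open>Matrices and vectors are index functions of which only the entries below
  \<open>n\<close> count. Compressions, scalings and diagonal changes then need no dimension
  bookkeeping; matrices of type \<open>mat\<close> serve where determinants or characteristic
  polynomials are involved.\<close>

definition hermitian :: "nat \<Rightarrow> (nat \<Rightarrow> nat \<Rightarrow> complex) \<Rightarrow> bool" where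
  "hermitian n A \<longleftrightarrow> (\<forall>i<n. \<forall>j<n. A j i = cnj (A i j))"

definition inner_prod :: "nat \<Rightarrow> (nat \<Rightarrow> complex) \<Rightarrow> (nat \<Rightarrow> complex) \<Rightarrow> complex" where
  "inner_prod n u v = (\<Sum>i<n. cnj (u i) * v i)"

definition mat_app :: "nat \<Rightarrow> (nat \<Rightarrow> nat \<Rightarrow> complex) \<Rightarrow> (nat \<Rightarrow> complex) \<Rightarrow> nat \<Rightarrow> complex" where
  "mat_app n A v i = (\<Sum>j<n. A i j * v j)"

definition qform :: "nat \<Rightarrow> (nat \<Rightarrow> nat \<Rightarrow> complex) \<Rightarrow> (nat \<Rightarrow> complex) \<Rightarrow> real" where
  "qform n A v = Re (inner_prod n v (mat_app n A v))"

definition orthonormal :: "nat \<Rightarrow> nat \<Rightarrow> (nat \<Rightarrow> nat \<Rightarrow> complex) \<Rightarrow> bool" where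
  "orthonormal n k f \<longleftrightarrow> (\<forall>a<k. \<forall>b<k. inner_prod n (f a) (f b) = (if a = b then 1 else 0))"

lemma hermitian_inner_prod:
  assumes "hermitian n A"
  shows "inner_prod n u (mat_app n A v) = inner_prod n (mat_app n A u) v"
proof -
  have A: "cnj (A j i) = A i j" if "i < n" "j < n" for i j
    using assms that unfolding hermitian_def by metis
  have "inner_prod n u (mat_app n A v) = (\<Sum>i<n. \<Sum>j<n. cnj (u i) * (A i j * v j))"
    by (simp add: inner_prod_def mat_app_def sum_distrib_left)
  also have "\<dots> = (\<Sum>j<n. \<Sum>i<n. cnj (A j i * u i) * v j)"
    by (subst sum.swap) (intro sum.cong refl, simp add: A mult_ac)
  also have "\<dots> = inner_prod n (mat_app n A u) v"
    by (simp add: inner_prod_def mat_app_def sum_distrib_right)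
  finally show ?thesis .
qed

lemma inner_prod_commute: "inner_prod n u v = cnj (inner_prod n v u)"
  by (simp add: inner_prod_def mult.commute)

lemma inner_prod_self: "inner_prod n v v = of_real (\<Sum>i<n. (cmod (v i))\<^sup>2)"
  by (simp add: inner_prod_def complex_norm_square mult.commute flip: of_real_power)

lemma sum_cmod_power2_pos:
  fixes n :: nat
  assumes "i < n" "v i \<noteq> 0"
  shows "(\<Sum>i<n. (cmod (v i))\<^sup>2) > 0"
  using assms by (intro sum_pos2[of "{..<n}" i]) auto

lemma inner_prod_add_right: "inner_prod n u (\<lambda>i. v i + w i) = inner_prod n u v + inner_prod n u w"
  by (simp add: inner_prod_def algebra_simps sum.distrib)

lemma inner_prod_scale_right: "inner_prod n u (\<lambda>i. c * v i) = c * inner_prod n u v"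
  by (simp add: inner_prod_def algebra_simps sum_distrib_left)

lemma inner_prod_scale_left: "inner_prod n (\<lambda>i. c * v i) u = cnj c * inner_prod n v u"
  by (simp add: inner_prod_def algebra_simps sum_distrib_left)

lemma inner_prod_sum_right:
  "inner_prod n u (\<lambda>i. \<Sum>a\<in>S. c a * v a i) = (\<Sum>a\<in>S. c a * inner_prod n u (v a))"
  by (simp add: inner_prod_def sum_distrib_left sum_distrib_right, subst sum.swap)
     (simp add: algebra_simps)

lemma inner_prod_sum_left:
  "inner_prod n (\<lambda>i. \<Sum>a\<in>S. c a * v a i) u = (\<Sum>a\<in>S. cnj (c a) * inner_prod n (v a) u)"
proof -
  have "inner_prod n (\<lambda>i. \<Sum>a\<in>S. c a * v a i) u = cnj (\<Sum>a\<in>S. c a * inner_prod n u (v a))"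
    by (subst inner_prod_commute) (simp only: inner_prod_sum_right)
  also have "\<dots> = (\<Sum>a\<in>S. cnj (c a) * cnj (inner_prod n u (v a)))"
    by simp
  also have "\<dots> = (\<Sum>a\<in>S. cnj (c a) * inner_prod n (v a) u)"
    by (simp only: inner_prod_commute[of n "v _" u])
  finally show ?thesis .
qed

lemma inner_prod_cong:
  assumes "\<And>i. i < n \<Longrightarrow> u i = u' i" "\<And>i. i < n \<Longrightarrow> v i = v' i"
  shows "inner_prod n u v = inner_prod n u' v'"
  using assms by (simp add: inner_prod_def)

lemma mat_app_sum: "mat_app n A (\<lambda>i. \<Sum>a\<in>S. c a * v a i) = (\<lambda>i. \<Sum>a\<in>S. c a * mat_app n A (v a) i)"
  by (rule ext, simp add: mat_app_def sum_distrib_left, subst sum.swap) (simp add: algebra_simps)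

lemma hermitian_eigenvector_orthogonal:
  assumes A: "hermitian n A" and k: "k < n" and f: "orthonormal n k f"
    and ev: "\<And>a i. a < k \<Longrightarrow> i < n \<Longrightarrow> mat_app n A (f a) i = of_real (d a) * f a i"
  shows "\<exists>g \<mu>. inner_prod n g g = 1 \<and> (\<forall>a<k. inner_prod n (f a) g = 0) \<and>
           (\<forall>i<n. mat_app n A g i = of_real (\<mu> :: real) * g i)"
proof -
  txt \<open>Shift the eigenvalues already found to a common value \<open>c\<close> such that not all eigenvalues of
    the result \<open>B\<close> can be \<open>c\<close>, by comparison of traces: the eigenvectors of the others are
    orthogonal to the \<open>f a\<close>.\<close>
  define s where "s = Re (\<Sum>i<n. A i i) - (\<Sum>a<k. d a)"
  define c where "c = s / (real n - real k) + 1"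
  have c: "s + real k * c \<noteq> real n * c"
  proof -
    have "(real n - real k) * c = s + (real n - real k)"
      using k by (simp add: c_def distrib_left)
    then show ?thesis using k by (auto simp: algebra_simps)
  qed
  define B where "B = (\<lambda>i j. A i j + (\<Sum>a<k. of_real (c - d a) * (f a i * cnj (f a j))))"
  define M where "M = Matrix.mat n n (\<lambda>(i, j). B i j)"
  have M: "M \<in> carrier_mat n n" by (simp add: M_def)
  obtain es where es: "char_poly M = (\<Prod>e\<leftarrow>es. [:- e, 1:])" "length es = n"
    using char_poly_factorized[OF M] by auto
  have Bapp: "mat_app n B v i = mat_app n A v i +
      (\<Sum>a<k. of_real (c - d a) * inner_prod n (f a) v * f a i)" for v i
  proof -
    have "mat_app n B v i = mat_app n A v i +
        (\<Sum>j<n. \<Sum>a<k. of_real (c - d a) * (f a i * cnj (f a j)) * v j)"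
      by (simp add: mat_app_def B_def algebra_simps sum.distrib sum_distrib_left)
    also have "(\<Sum>j<n. \<Sum>a<k. of_real (c - d a) * (f a i * cnj (f a j)) * v j) =
        (\<Sum>a<k. of_real (c - d a) * inner_prod n (f a) v * f a i)"
      by (subst sum.swap)
         (simp add: inner_prod_def sum_distrib_left sum_distrib_right mult_ac)
    finally show ?thesis .
  qed
  have "\<exists>\<mu>\<in>set es. \<mu> \<noteq> of_real c"
  proof (rule ccontr)
    assume "\<not> ?thesis"
    then have "es = replicate n (of_real c)"
      using es(2) by (intro replicate_eqI) auto
    then have "(\<Sum>i<n. B i i) = of_nat n * of_real c"
      using trace_eq_sum_eigenvalues[OF M es(1)] by (simp add: M_def sum_list_replicate)
    moreover have "(\<Sum>i<n. B i i) = (\<Sum>i<n. A i i) + (\<Sum>a<k. of_real (c - d a))"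
    proof -
      have "(\<Sum>i<n. B i i) = (\<Sum>i<n. A i i) +
          (\<Sum>i<n. \<Sum>a<k. of_real (c - d a) * (f a i * cnj (f a i)))"
        by (simp add: B_def sum.distrib)
      also have "(\<Sum>i<n. \<Sum>a<k. of_real (c - d a) * (f a i * cnj (f a i))) =
          (\<Sum>a<k. of_real (c - d a) * inner_prod n (f a) (f a))"
        by (subst sum.swap) (simp add: inner_prod_def sum_distrib_left mult.commute)
      also have "\<dots> = (\<Sum>a<k. of_real (c - d a))"
        using f by (simp add: orthonormal_def)
      finally show ?thesis .
    qed
    ultimately have "Re ((\<Sum>i<n. A i i) + (\<Sum>a<k. of_real (c - d a))) = Re (of_nat n * of_real c)"
      by simp
    then have "Re (\<Sum>i<n. A i i) + (\<Sum>a<k. c - d a) = real n * c"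
      by simp
    then show False
      using c by (simp add: s_def sum_subtractf)
  qed
  then obtain \<mu> where \<mu>: "\<mu> \<in> set es" "\<mu> \<noteq> of_real c" by auto
  have "poly (char_poly M) \<mu> = 0"
    using \<mu>(1) unfolding es(1) by (induction es) auto
  then obtain v where v: "v \<in> carrier_vec n" "v \<noteq> 0\<^sub>v n" "M *\<^sub>v v = \<mu> \<cdot>\<^sub>v v"
    using eigenvalue_root_char_poly[OF M] M by (auto simp: eigenvalue_def eigenvector_def)
  define h where "h = vec_index v"
  obtain i0 where i0: "i0 < n" "h i0 \<noteq> 0"
    using v(1,2) unfolding h_def by (metis carrier_vecD eq_vecI index_zero_vec(1) zero_carrier_vec)
  have Bh: "mat_app n B h i = \<mu> * h i" if "i < n" for i
  proof -
    have "vec_index (M *\<^sub>v v) i = mat_app n B h i"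
      using v(1) that by (simp add: M_def scalar_prod_def atLeast0LessThan mat_app_def h_def)
    then show ?thesis using v that by (simp add: h_def)
  qed
  \<comment> \<open>The shift gives every \<open>f a\<close> the eigenvalue \<open>c\<close> under
    \<open>B\<close>; pairing \<open>B h\<close> with \<open>f a\<close> compares it with \<mu>,
    which differs from \<open>c\<close>. The shift then vanishes on \<open>h\<close>, so
    \<open>h\<close> is an eigenvector of \<open>A\<close> as well.\<close>
  have ortho: "inner_prod n (f a) h = 0" if a: "a < k" for a
  proof -
    have "inner_prod n (f a) (mat_app n A h) = inner_prod n (mat_app n A (f a)) h"
      by (rule hermitian_inner_prod[OF A])
    also have "\<dots> = inner_prod n (\<lambda>i. of_real (d a) * f a i) h"
      using ev[OF a] by (intro inner_prod_cong) auto
    also have "\<dots> = of_real (d a) * inner_prod n (f a) h"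
      by (simp add: inner_prod_scale_left)
    finally have 1: "inner_prod n (f a) (mat_app n A h) = of_real (d a) * inner_prod n (f a) h" .
    have "\<mu> * inner_prod n (f a) h = inner_prod n (f a) (mat_app n B h)"
      unfolding inner_prod_scale_right[symmetric] using Bh by (intro inner_prod_cong) auto
    also have "\<dots> = inner_prod n (f a) (mat_app n A h) +
        (\<Sum>b<k. of_real (c - d b) * inner_prod n (f b) h * inner_prod n (f a) (f b))"
      unfolding Bapp by (simp only: inner_prod_add_right inner_prod_sum_right)
    also have "(\<Sum>b<k. of_real (c - d b) * inner_prod n (f b) h * inner_prod n (f a) (f b)) =
        (\<Sum>b<k. if a = b then of_real (c - d b) * inner_prod n (f b) h else 0)"
      using f a by (intro sum.cong refl) (auto simp: orthonormal_def)
    also have "\<dots> = of_real (c - d a) * inner_prod n (f a) h"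
      using a by simp
    finally have "(\<mu> - of_real c) * inner_prod n (f a) h = 0"
      unfolding 1 by (simp add: algebra_simps)
    then show ?thesis using \<mu>(2) by simp
  qed
  have Ah: "mat_app n A h i = \<mu> * h i" if "i < n" for i
    using Bh[OF that] ortho by (simp add: Bapp)
  define r where "r = (\<Sum>i<n. (cmod (h i))\<^sup>2)"
  have r: "r > 0" "inner_prod n h h = of_real r"
    unfolding r_def using i0 by (simp_all add: sum_cmod_power2_pos inner_prod_self)
  have "\<mu> * inner_prod n h h = inner_prod n h (mat_app n A h)"
    unfolding inner_prod_scale_right[symmetric] using Ah by (intro inner_prod_cong) auto
  also have "\<dots> = inner_prod n (mat_app n A h) h"
    by (rule hermitian_inner_prod[OF A])
  also have "\<dots> = cnj \<mu> * inner_prod n h h"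
    unfolding inner_prod_scale_left[symmetric] using Ah by (intro inner_prod_cong) auto
  finally have "\<mu> = of_real (Re \<mu>)"
    using r by (simp add: complex_eq_iff)
  define g where "g = (\<lambda>i. of_real (1 / sqrt r) * h i)"
  have "inner_prod n g g = of_real (1 / sqrt r) * (of_real (1 / sqrt r) * of_real r)"
    unfolding g_def inner_prod_scale_left inner_prod_scale_right r(2) by simp
  also have "\<dots> = of_real (1 / sqrt r * (1 / sqrt r) * r)"
    by (simp only: of_real_mult mult.assoc)
  also have "1 / sqrt r * (1 / sqrt r) * r = 1"
    using r(1) by (simp add: field_simps)
  finally have "inner_prod n g g = 1" by simp
  moreover have "inner_prod n (f a) g = 0" if "a < k" for a
    unfolding g_def inner_prod_scale_right by (simp add: ortho[OF that])
  moreover have "mat_app n A g i = of_real (Re \<mu>) * g i" if "i < n" for i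
  proof -
    have "mat_app n A g i = of_real (1 / sqrt r) * mat_app n A h i"
      by (simp add: mat_app_def g_def sum_distrib_left mult_ac)
    then show ?thesis
      using Ah[OF that] \<open>\<mu> = _\<close> by (simp add: g_def)
  qed
  ultimately show ?thesis by blast
qed

lemma hermitian_orthonormal_eigenbasis:
  assumes A: "hermitian n A"
  obtains f :: "nat \<Rightarrow> nat \<Rightarrow> complex" and d :: "nat \<Rightarrow> real"
    where "orthonormal n n f" "\<And>a i. a < n \<Longrightarrow> i < n \<Longrightarrow> mat_app n A (f a) i = of_real (d a) * f a i"
proof -
  have "\<exists>f d. orthonormal n k f \<and>
      (\<forall>a<k. \<forall>i<n. mat_app n A (f a) i = of_real (d a :: real) * f a i)" if "k \<le> n" for k
    using that
  proof (induction k)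
    case 0
    then show ?case by (auto simp: orthonormal_def)
  next
    case (Suc k)
    then obtain f and d :: "nat \<Rightarrow> real" where fd: "orthonormal n k f"
        "\<And>a i. a < k \<Longrightarrow> i < n \<Longrightarrow> mat_app n A (f a) i = of_real (d a) * f a i"
      by auto
    obtain g \<mu> where g: "inner_prod n g g = 1" "\<And>a. a < k \<Longrightarrow> inner_prod n (f a) g = 0"
        "\<And>i. i < n \<Longrightarrow> mat_app n A g i = of_real (\<mu> :: real) * g i"
      using hermitian_eigenvector_orthogonal[OF A _ fd] Suc.prems by auto
    have g': "inner_prod n g (f a) = 0" if "a < k" for a
      using g(2)[OF that] inner_prod_commute[of n g "f a"] by simp
    show ?case
      using fd g g'
      by (intro exI[of _ "f(k := g)"] exI[of _ "d(k := \<mu>)"])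
         (auto simp: orthonormal_def less_Suc_eq)
  qed
  from this[of n] show ?thesis using that by auto
qed

text \<open>Orthonormality says \<open>G * F = 1\<close>; for square matrices this implies
  \<open>F * G = 1\<close>, which is the completeness relation needed here.\<close>

lemma orthonormal_basis_expansion:
  assumes f: "orthonormal n n f" and i: "i < n"
  shows "v i = (\<Sum>a<n. inner_prod n (f a) v * f a i)"
proof -
  define F G where "F = Matrix.mat n n (\<lambda>(i, a). f a i)" and "G = Matrix.mat n n (\<lambda>(a, i). cnj (f a i))"
  have FG: "F \<in> carrier_mat n n" "G \<in> carrier_mat n n" by (auto simp: F_def G_def)
  have "G * F = 1\<^sub>m n"
    using f by (intro eq_matI)
      (auto simp: F_def G_def orthonormal_def inner_prod_def scalar_prod_def atLeast0LessThan)
  then have FG1: "F * G = 1\<^sub>m n"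
    using mat_mult_left_right_inverse[OF FG(2,1)] by simp
  have "(\<Sum>a<n. f a i * cnj (f a j)) = (if i = j then 1 else 0)" if "j < n" for j
  proof -
    have "(\<Sum>a<n. f a i * cnj (f a j)) = (F * G) $$ (i, j)"
      using i that by (simp add: F_def G_def scalar_prod_def atLeast0LessThan)
    then show ?thesis using i that by (simp add: FG1)
  qed
  then have "(\<Sum>j<n. (\<Sum>a<n. f a i * cnj (f a j)) * v j) = (\<Sum>j<n. if i = j then v j else 0)"
    by (intro sum.cong refl) auto
  also have "\<dots> = v i" using i by simp
  finally have "v i = (\<Sum>j<n. \<Sum>a<n. f a i * cnj (f a j) * v j)"
    by (simp add: sum_distrib_right)
  also have "\<dots> = (\<Sum>a<n. \<Sum>j<n. f a i * cnj (f a j) * v j)"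
    by (rule sum.swap)
  also have "\<dots> = (\<Sum>a<n. inner_prod n (f a) v * f a i)"
    by (simp add: inner_prod_def sum_distrib_right sum_distrib_left mult_ac)
  finally show ?thesis .
qed

section \<open>The number of negative eigenvalues\<close>

definition neg_index :: "nat \<Rightarrow> (nat \<Rightarrow> nat \<Rightarrow> complex) \<Rightarrow> nat" where
  "neg_index n A = sq_neg (Matrix.mat n n (\<lambda>(i, j). A i j))"

lemma order_prod_list_linear:
  fixes c :: "'a :: field"
  shows "Polynomial.order c (\<Prod>e\<leftarrow>es. [:- e, 1:]) = length (filter (\<lambda>e. e = c) es)"
proof (induction es)
  case (Cons e es)
  have "(\<Prod>e\<leftarrow>es. [:- e, 1:]) \<noteq> 0"
    by (auto simp: prod_list_zero_iff)
  then have "[:- e, 1:] * (\<Prod>e\<leftarrow>es. [:- e, 1:]) \<noteq> 0"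
    by (simp only: mult_eq_0_iff) simp
  moreover have "Polynomial.order c [:- e, 1:] = (if e = c then 1 else 0)"
    using order_power_n_n[of c 1] by (auto intro: order_0I)
  ultimately show ?case
    using Cons.IH by (subst list.map, subst prod_list.Cons, subst order_mult) auto
qed (auto simp: order_0I)

text \<open>The eigenbasis conjugates the matrix to a diagonal one, so the root orders in
  \<open>sq_neg\<close> count indices of the basis. The definition of \<open>sq_neg\<close> is
  unfolded only here.\<close>

lemma neg_index_eq_card:
  assumes f: "orthonormal n n f"
    and ev: "\<And>a i. a < n \<Longrightarrow> i < n \<Longrightarrow> mat_app n A (f a) i = of_real (d a) * f a i"
  shows "neg_index n A = card {a. a < n \<and> d a < 0}"
proof -
  define F G D M where "F = Matrix.mat n n (\<lambda>(i, a). f a i)" and "G = Matrix.mat n n (\<lambda>(a, i). cnj (f a i))"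
    and "D = Matrix.mat n n (\<lambda>(a, b). if a = b then complex_of_real (d a) else 0)"
    and "M = Matrix.mat n n (\<lambda>(i, j). A i j)"
  have car: "F \<in> carrier_mat n n" "G \<in> carrier_mat n n" "D \<in> carrier_mat n n" "M \<in> carrier_mat n n"
    by (auto simp: F_def G_def D_def M_def)
  have GF: "G * F = 1\<^sub>m n"
    using f by (intro eq_matI)
      (auto simp: F_def G_def orthonormal_def inner_prod_def scalar_prod_def atLeast0LessThan)
  then have FG: "F * G = 1\<^sub>m n"
    using mat_mult_left_right_inverse[OF car(2,1)] by simp
  have "M * F = F * D"
  proof (intro eq_matI)
    fix i a assume "i < dim_row (F * D)" "a < dim_col (F * D)"
    then have ia: "i < n" "a < n" using car by auto
    have "(M * F) $$ (i, a) = mat_app n A (f a) i"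
      using ia by (simp add: M_def F_def scalar_prod_def atLeast0LessThan mat_app_def)
    also have "\<dots> = (\<Sum>b<n. if b = a then of_real (d a) * f a i else 0)"
      using ia by (simp add: ev)
    also have "\<dots> = (\<Sum>b<n. f b i * (if b = a then complex_of_real (d b) else 0))"
      by (intro sum.cong refl) auto
    also have "\<dots> = (F * D) $$ (i, a)"
      using ia by (simp add: D_def F_def scalar_prod_def atLeast0LessThan)
    finally show "(M * F) $$ (i, a) = (F * D) $$ (i, a)" .
  qed (use car in auto)
  then have "M = F * D * G"
    using assoc_mult_mat[OF car(4,1,2)] FG car(4) right_mult_one_mat[OF car(4)] by simp
  then have "similar_mat M D"
    unfolding similar_mat_def using car FG GF
    by (intro exI[of _ F] exI[of _ G] similar_mat_witI[of _ _ n]) auto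
  then have "char_poly M = char_poly D"
    by (rule char_poly_similar)
  also have "\<dots> = (\<Prod>e\<leftarrow>diag_mat D. [:- e, 1:])"
    using car(3) by (intro char_poly_upper_triangular) (auto simp: D_def)
  also have "diag_mat D = map (\<lambda>a. complex_of_real (d a)) [0..<n]"
    by (auto simp: diag_mat_def D_def)
  finally have cp: "char_poly M = (\<Prod>e\<leftarrow>map (\<lambda>a. complex_of_real (d a)) [0..<n]. [:- e, 1:])" .
  have ord: "Polynomial.order (complex_of_real c) (char_poly M) = card {a. a < n \<and> d a = c}" for c
    unfolding cp order_prod_list_linear
    by (simp add: filter_map o_def length_filter_conv_card) (intro arg_cong[where f = card], auto)
  have eig: "eigenvalue M (complex_of_real c) \<longleftrightarrow> c \<in> d ` {..<n}" for c
  proof -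
    have "eigenvalue M (complex_of_real c) \<longleftrightarrow> Polynomial.order (complex_of_real c) (char_poly M) \<noteq> 0"
      using degree_monic_char_poly[OF car(4)]
      by (subst eigenvalue_root_char_poly[OF car(4)], subst order_root) auto
    then show ?thesis unfolding ord by auto
  qed
  define X where "X = {a. a < n \<and> d a < 0}"
  have "neg_index n A = (\<Sum>c | c < 0 \<and> c \<in> d ` {..<n}. card {a. a < n \<and> d a = c})"
    unfolding neg_index_def sq_neg_def M_def[symmetric] eig ord ..
  also have "\<dots> = (\<Sum>c \<in> d ` X. \<Sum>a | a \<in> X \<and> d a = c. 1)"
    by (intro sum.cong) (auto simp: X_def intro!: arg_cong[where f = card])
  also have "\<dots> = (\<Sum>a\<in>X. 1)"
    by (intro sum.image_gen[symmetric]) (auto simp: X_def)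
  finally show ?thesis by (simp add: X_def)
qed

lemma qform_eigenbasis:
  assumes f: "orthonormal n n f"
    and ev: "\<And>a i. a < n \<Longrightarrow> i < n \<Longrightarrow> mat_app n A (f a) i = of_real (d a) * f a i"
  shows "qform n A v = (\<Sum>a<n. d a * (cmod (inner_prod n (f a) v))\<^sup>2)"
proof -
  have "mat_app n A v i = (\<Sum>a<n. inner_prod n (f a) v * of_real (d a) * f a i)" if "i < n" for i
  proof -
    have "mat_app n A v i = mat_app n A (\<lambda>i. \<Sum>a<n. inner_prod n (f a) v * f a i) i"
      unfolding mat_app_def
      by (intro sum.cong refl arg_cong2[where f = "(*)"] orthonormal_basis_expansion[OF f]) auto
    also have "\<dots> = (\<Sum>a<n. inner_prod n (f a) v * mat_app n A (f a) i)"
      by (simp add: mat_app_sum)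
    also have "\<dots> = (\<Sum>a<n. inner_prod n (f a) v * of_real (d a) * f a i)"
      using that by (intro sum.cong refl) (simp add: ev)
    finally show ?thesis .
  qed
  then have "inner_prod n v (mat_app n A v) =
      inner_prod n v (\<lambda>i. \<Sum>a<n. inner_prod n (f a) v * of_real (d a) * f a i)"
    by (intro inner_prod_cong) auto
  also have "\<dots> = (\<Sum>a<n. of_real (d a) * (inner_prod n (f a) v * inner_prod n v (f a)))"
    unfolding inner_prod_sum_right by (simp add: mult_ac)
  also have "\<dots> = (\<Sum>a<n. of_real (d a * (cmod (inner_prod n (f a) v))\<^sup>2))"
    by (intro sum.cong refl)
       (simp add: complex_norm_square inner_prod_commute[of n v] flip: of_real_power)
  finally show ?thesis
    by (simp add: qform_def)
qed

lemma orthonormal_inner_prod_sum: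
  fixes h :: "nat \<Rightarrow> nat"
  assumes f: "orthonormal n n f" and h: "bij_betw h {..<k} X" "X \<subseteq> {..<n}" and b: "b < n"
  shows "inner_prod n (f b) (\<lambda>i. \<Sum>a<k. y a * f (h a) i) =
    (if b \<in> X then y (the_inv_into {..<k} h b) else 0)"
proof -
  have "inner_prod n (f b) (\<lambda>i. \<Sum>a<k. y a * f (h a) i) = (\<Sum>a<k. if h a = b then y a else 0)"
    unfolding inner_prod_sum_right using f h b
    by (intro sum.cong refl) (auto simp: orthonormal_def bij_betw_def)
  also have "\<dots> = (\<Sum>a \<in> {a. a < k \<and> h a = b}. y a)"
    by (subst sum.inter_filter[symmetric]) auto
  also have "{a. a < k \<and> h a = b} = (if b \<in> X then {the_inv_into {..<k} h b} else {})"
  proof (cases "b \<in> X")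
    case True
    then obtain a where a: "a < k" "h a = b" using h by (auto simp: bij_betw_def)
    then show ?thesis
      using True h by (auto simp: bij_betw_def the_inv_into_f_f inj_on_def)
  next
    case False
    then show ?thesis using h by (auto simp: bij_betw_def)
  qed
  finally show ?thesis by auto
qed

text \<open>The \<open>V a\<close> are the eigenvectors with negative eigenvalue. A margin \<delta>,
  rather than mere negativity, is what the perturbation and extension arguments consume.\<close>

lemma neg_index_uniformly_negative:
  assumes A: "hermitian n A"
  shows "\<exists>(V :: nat \<Rightarrow> nat \<Rightarrow> complex) \<delta>. \<delta> > 0 \<and> (\<forall>y.
    qform n A (\<lambda>i. \<Sum>a<neg_index n A. y a * V a i) \<le> - \<delta> * (\<Sum>a<neg_index n A. (cmod (y a))\<^sup>2))"
proof -
  obtain f and d :: "nat \<Rightarrow> real" where f: "orthonormal n n f"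
    and ev: "\<And>a i. a < n \<Longrightarrow> i < n \<Longrightarrow> mat_app n A (f a) i = of_real (d a) * f a i"
    using hermitian_orthonormal_eigenbasis[OF A] by blast
  have qf: "qform n A v = (\<Sum>a<n. d a * (cmod (inner_prod n (f a) v))\<^sup>2)" for v
    using f ev by (rule qform_eigenbasis)
  define X where "X = {a. a < n \<and> d a < 0}"
  define k where "k = neg_index n A"
  have fin: "finite X" and X: "X \<subseteq> {..<n}" by (auto simp: X_def)
  have "k = card X" using neg_index_eq_card[OF f ev] by (simp add: k_def X_def)
  then obtain h where h: "bij_betw h {..<k} X"
    using ex_bij_betw_nat_finite[OF fin] by (auto simp: atLeast0LessThan)
  \<comment> \<open>The element 1 keeps the minimum meaningful when there is no negative
    eigenvalue.\<close>
  define \<delta> where "\<delta> = Min (insert 1 ((\<lambda>a. - d a) ` X))"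
  have "\<delta> > 0"
    using fin by (auto simp: \<delta>_def X_def)
  moreover have "d a \<le> - \<delta>" if "a \<in> X" for a
  proof -
    have "\<delta> \<le> - d a"
      unfolding \<delta>_def using fin that by (intro Min_le) auto
    then show ?thesis by simp
  qed
  ultimately have \<delta>: "\<delta> > 0" "\<And>a. a \<in> X \<Longrightarrow> d a \<le> - \<delta>" by auto
  have "qform n A (\<lambda>i. \<Sum>a<k. y a * f (h a) i) \<le> - \<delta> * (\<Sum>a<k. (cmod (y a))\<^sup>2)" for y
  proof -
    define g where "g = the_inv_into {..<k} h"
    have "qform n A (\<lambda>i. \<Sum>a<k. y a * f (h a) i) =
        (\<Sum>b<n. if b \<in> X then d b * (cmod (y (g b)))\<^sup>2 else 0)"
      unfolding qf
      using orthonormal_inner_prod_sum[OF f h X] by (intro sum.cong refl) (simp add: g_def)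
    also have "\<dots> = (\<Sum>b\<in>X. d b * (cmod (y (g b)))\<^sup>2)"
      using X by (subst sum.inter_restrict[symmetric]) (auto simp: Int_absorb1)
    also have "\<dots> \<le> (\<Sum>b\<in>X. - \<delta> * (cmod (y (g b)))\<^sup>2)"
      using \<delta> by (intro sum_mono mult_right_mono) auto
    also have "\<dots> = (\<Sum>a<k. - \<delta> * (cmod (y a))\<^sup>2)"
      using h by (subst sum.reindex_bij_betw[OF h, symmetric])
        (intro sum.cong refl, auto simp: g_def bij_betw_def the_inv_into_f_f)
    finally show ?thesis by (simp add: sum_distrib_left)
  qed
  then show ?thesis
    using \<delta>(1) by (intro exI[of _ "\<lambda>a. f (h a)"] exI[of _ \<delta>]) (simp add: k_def)
qed

text \<open>The conditions express orthogonality to the eigenvectors with negative eigenvalue; what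
  remains of the form is a sum of nonnegative terms.\<close>

lemma neg_index_nonneg_on_kernel:
  assumes A: "hermitian n A"
  shows "\<exists>\<phi> :: nat \<Rightarrow> nat \<Rightarrow> complex. \<forall>v.
    (\<forall>b<neg_index n A. (\<Sum>i<n. \<phi> b i * v i) = 0) \<longrightarrow> 0 \<le> qform n A v"
proof -
  obtain f and d :: "nat \<Rightarrow> real" where f: "orthonormal n n f"
    and ev: "\<And>a i. a < n \<Longrightarrow> i < n \<Longrightarrow> mat_app n A (f a) i = of_real (d a) * f a i"
    using hermitian_orthonormal_eigenbasis[OF A] by blast
  have qf: "qform n A v = (\<Sum>a<n. d a * (cmod (inner_prod n (f a) v))\<^sup>2)" for v
    using f ev by (rule qform_eigenbasis)
  define X where "X = {a. a < n \<and> d a < 0}"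
  define k where "k = neg_index n A"
  have fin: "finite X" by (auto simp: X_def)
  have "k = card X" using neg_index_eq_card[OF f ev] by (simp add: k_def X_def)
  then obtain h where h: "bij_betw h {..<k} X"
    using ex_bij_betw_nat_finite[OF fin] by (auto simp: atLeast0LessThan)
  have "0 \<le> qform n A v" if v: "\<And>b. b < k \<Longrightarrow> (\<Sum>i<n. cnj (f (h b) i) * v i) = 0" for v
    unfolding qf
  proof (intro sum_nonneg)
    fix a assume a: "a \<in> {..<n}"
    have "inner_prod n (f a) v = 0" if "a \<in> X"
      using v that h unfolding bij_betw_def inner_prod_def by blast
    then show "0 \<le> d a * (cmod (inner_prod n (f a) v))\<^sup>2"
      using a by (cases "a \<in> X") (auto simp: X_def)
  qed
  then show ?thesis
    by (intro exI[of _ "\<lambda>b i. cnj (f (h b) i)"]) (simp add: k_def)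
qed

text \<open>The conditions on a combination of the \<open>V a\<close> are \<open>p\<close> linear
  equations in \<open>k\<close> unknowns. For \<open>p < k\<close> a nonzero solution would make the
  form both negative and nonnegative.\<close>

lemma neg_dim_le_codim:
  fixes V \<phi> :: "nat \<Rightarrow> nat \<Rightarrow> complex"
  assumes neg: "\<And>y. \<exists>a<k. y a \<noteq> 0 \<Longrightarrow> qform n A (\<lambda>i. \<Sum>a<k. y a * V a i) < 0"
    and nn: "\<And>v. (\<And>b. b < p \<Longrightarrow> (\<Sum>i<n. \<phi> b i * v i) = 0) \<Longrightarrow> 0 \<le> qform n A v"
  shows "k \<le> p"
proof (rule ccontr)
  assume "\<not> k \<le> p"
  then have "p < k" by simp
  then obtain y where y: "\<exists>a<k. y a \<noteq> 0" "\<And>b. b < p \<Longrightarrow> (\<Sum>a<k. (\<Sum>i<n. \<phi> b i * V a i) * y a) = 0"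
    using homogeneous_system_solution[of p k "\<lambda>b a. \<Sum>i<n. \<phi> b i * V a i"] by auto
  have "(\<Sum>i<n. \<phi> b i * (\<Sum>a<k. y a * V a i)) = 0" if "b < p" for b
  proof -
    have "(\<Sum>i<n. \<phi> b i * (\<Sum>a<k. y a * V a i)) = (\<Sum>i<n. \<Sum>a<k. \<phi> b i * V a i * y a)"
      by (simp add: sum_distrib_left mult_ac)
    also have "\<dots> = (\<Sum>a<k. (\<Sum>i<n. \<phi> b i * V a i) * y a)"
      by (subst sum.swap) (simp add: sum_distrib_right)
    finally show ?thesis using y(2)[OF that] by simp
  qed
  then have "0 \<le> qform n A (\<lambda>i. \<Sum>a<k. y a * V a i)" by (rule nn)
  then show False using neg[OF y(1)] by simp
qed

text \<open>Together with \<open>neg_index_leI\<close> this is the min-max description of the index,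
  which replaces eigenvalues from here on; only \<open>kernel_or_range\<close> returns to an
  eigenbasis.\<close>

lemma neg_index_geI:
  fixes V :: "nat \<Rightarrow> nat \<Rightarrow> complex"
  assumes "hermitian n A" "\<And>y. \<exists>a<k. y a \<noteq> 0 \<Longrightarrow> qform n A (\<lambda>i. \<Sum>a<k. y a * V a i) < 0"
  shows "k \<le> neg_index n A"
proof -
  obtain \<phi> :: "nat \<Rightarrow> nat \<Rightarrow> complex" where \<phi>:
    "\<And>v. (\<And>b. b < neg_index n A \<Longrightarrow> (\<Sum>i<n. \<phi> b i * v i) = 0) \<Longrightarrow> 0 \<le> qform n A v"
    using neg_index_nonneg_on_kernel[OF assms(1)] by blast
  show ?thesis
    by (rule neg_dim_le_codim[where V = V and \<phi> = \<phi>]) (fact assms(2), fact \<phi>)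
qed

lemma neg_index_leI:
  fixes \<phi> :: "nat \<Rightarrow> nat \<Rightarrow> complex"
  assumes A: "hermitian n A"
    and nn: "\<And>v. (\<And>b. b < p \<Longrightarrow> (\<Sum>i<n. \<phi> b i * v i) = 0) \<Longrightarrow> 0 \<le> qform n A v"
  shows "neg_index n A \<le> p"
proof -
  obtain V \<delta> where V: "(\<delta> :: real) > 0"
    "\<And>y. qform n A (\<lambda>i. \<Sum>a<neg_index n A. y a * V a i) \<le> - \<delta> * (\<Sum>a<neg_index n A. (cmod (y a))\<^sup>2)"
    using neg_index_uniformly_negative[OF A] by blast
  show ?thesis
  proof (rule neg_dim_le_codim[where V = V and \<phi> = \<phi>, OF _ nn])
    fix y :: "nat \<Rightarrow> complex" assume "\<exists>a<neg_index n A. y a \<noteq> 0"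
    then have "(\<Sum>a<neg_index n A. (cmod (y a))\<^sup>2) > 0"
      by (auto intro: sum_cmod_power2_pos)
    then have "- \<delta> * (\<Sum>a<neg_index n A. (cmod (y a))\<^sup>2) < 0"
      using V(1) by simp
    then show "qform n A (\<lambda>i. \<Sum>a<neg_index n A. y a * V a i) < 0"
      using V(2)[of y] by linarith
  qed
qed

text \<open>The conditions that make \<open>B\<close> nonnegative are pulled back along
  \<open>T\<close>. As \<open>T\<close> may be rectangular and singular, this covers congruences,
  compressions, scalings with zeros and factorized kernels alike.\<close>

lemma neg_index_mono:
  fixes T :: "nat \<Rightarrow> nat \<Rightarrow> complex"
  assumes A: "hermitian m A" and B: "hermitian n B"
    and le: "\<And>v. qform n B (\<lambda>j. \<Sum>i<m. T j i * v i) \<le> qform m A v"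
  shows "neg_index m A \<le> neg_index n B"
proof -
  obtain \<phi> :: "nat \<Rightarrow> nat \<Rightarrow> complex" where \<phi>:
    "\<And>v. (\<And>b. b < neg_index n B \<Longrightarrow> (\<Sum>i<n. \<phi> b i * v i) = 0) \<Longrightarrow> 0 \<le> qform n B v"
    using neg_index_nonneg_on_kernel[OF B] by blast
  show ?thesis
  proof (rule neg_index_leI[OF A])
    fix v assume v: "\<And>b. b < neg_index n B \<Longrightarrow> (\<Sum>i<m. (\<Sum>j<n. \<phi> b j * T j i) * v i) = 0"
    have "0 \<le> qform n B (\<lambda>j. \<Sum>i<m. T j i * v i)"
    proof (rule \<phi>)
      fix b assume b: "b < neg_index n B"
      have "(\<Sum>j<n. \<phi> b j * (\<Sum>i<m. T j i * v i)) = (\<Sum>j<n. \<Sum>i<m. \<phi> b j * T j i * v i)"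
        by (simp add: sum_distrib_left mult_ac)
      also have "\<dots> = (\<Sum>i<m. (\<Sum>j<n. \<phi> b j * T j i) * v i)"
        by (subst sum.swap) (simp add: sum_distrib_right)
      finally show "(\<Sum>j<n. \<phi> b j * (\<Sum>i<m. T j i * v i)) = 0" using v[OF b] by simp
    qed
    then show "0 \<le> qform m A v" using le[of v] by simp
  qed
qed

lemma neg_index_antimono_qform:
  assumes A: "hermitian n A" and B: "hermitian n B" and le: "\<And>v. qform n B v \<le> qform n A v"
  shows "neg_index n A \<le> neg_index n B"
proof (rule neg_index_mono[OF A B, of "\<lambda>i j. if i = j then 1 else 0"])
  fix v :: "nat \<Rightarrow> complex"
  have "(\<Sum>i<n. (if j = i then 1 else 0) * v i) = v j" if "j < n" for j
    using that by (simp add: if_distrib[of "\<lambda>x. x * _"] cong: if_cong)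
  then have "qform n B (\<lambda>j. \<Sum>i<n. (if j = i then 1 else 0) * v i) = qform n B v"
    unfolding qform_def mat_app_def inner_prod_def by simp
  then show "qform n B (\<lambda>j. \<Sum>i<n. (if j = i then 1 else 0) * v i) \<le> qform n A v"
    using le[of v] by simp
qed

section \<open>Perturbing and extending negative subspaces\<close>

definition unit_fun :: "nat \<Rightarrow> nat \<Rightarrow> complex" where
  "unit_fun i j = (if j = i then 1 else 0)"

lemma inner_prod_unit_fun_right: "i < n \<Longrightarrow> inner_prod n v (unit_fun i) = cnj (v i)"
proof -
  assume i: "i < n"
  have "inner_prod n v (unit_fun i) = (\<Sum>j<n. if j = i then cnj (v j) else 0)"
    unfolding inner_prod_def unit_fun_def by (intro sum.cong) auto
  then show ?thesis using i by simp
qed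

lemma mat_app_add: "mat_app n A (\<lambda>i. u i + c * v i) i = mat_app n A u i + c * mat_app n A v i"
  by (simp add: mat_app_def algebra_simps sum.distrib sum_distrib_left)

lemma hermitian_inner_prod_real:
  assumes "hermitian n A"
  shows "Im (inner_prod n v (mat_app n A v)) = 0"
  using hermitian_inner_prod[OF assms, of v v] inner_prod_commute[of n v "mat_app n A v"]
  by (metis Reals_cnj_iff complex_is_Real_iff)

lemma qform_add:
  assumes A: "hermitian n A"
  shows "qform n A (\<lambda>i. u i + c * v i) =
    qform n A u + 2 * Re (c * inner_prod n u (mat_app n A v)) + (cmod c)\<^sup>2 * qform n A v"
proof -
  let ?p = "inner_prod n"
  have add_left: "?p (\<lambda>i. x i + y i) z = ?p x z + ?p y z" for x y z
    by (simp add: inner_prod_def algebra_simps sum.distrib)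
  have "?p (\<lambda>i. u i + c * v i) (mat_app n A (\<lambda>i. u i + c * v i)) =
      ?p u (mat_app n A u) + c * ?p u (mat_app n A v) + cnj c * ?p v (mat_app n A u)
        + (cnj c * c) * ?p v (mat_app n A v)"
    unfolding mat_app_add[abs_def] add_left inner_prod_add_right inner_prod_scale_left
      inner_prod_scale_right by (simp add: algebra_simps)
  moreover have "cnj c * ?p v (mat_app n A u) = cnj (c * ?p u (mat_app n A v))"
    unfolding hermitian_inner_prod[OF A, of v u] by (simp add: inner_prod_commute[of n u])
  moreover have "cnj c * c = of_real ((cmod c)\<^sup>2)"
    using complex_norm_square[of c] by (simp add: mult.commute)
  ultimately show ?thesis
    by (simp add: qform_def)
qed

text \<open>A crude substitute for the Cauchy-Schwarz inequality: each coefficient is at most the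
  Euclidean norm of \<open>y\<close>.\<close>

lemma cmod_sum_le_norm:
  fixes y c :: "nat \<Rightarrow> complex"
  shows "cmod (\<Sum>a<k. y a * c a) \<le> sqrt (\<Sum>a<k. (cmod (y a))\<^sup>2) * (\<Sum>a<k. cmod (c a))"
proof -
  have "cmod (y a) \<le> sqrt (\<Sum>a<k. (cmod (y a))\<^sup>2)" if "a < k" for a
    using that by (intro real_le_rsqrt member_le_sum) auto
  then have "(\<Sum>a<k. cmod (y a * c a)) \<le> (\<Sum>a<k. sqrt (\<Sum>a<k. (cmod (y a))\<^sup>2) * cmod (c a))"
    by (intro sum_mono) (auto simp: norm_mult intro!: mult_right_mono)
  then show ?thesis
    unfolding sum_distrib_left[symmetric] by (rule order_trans[OF norm_sum])
qed

text \<open>A subspace negative for \<open>A\<close> with margin \<delta> stays negative for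
  \<open>B t\<close> once the two forms differ on it by less than \<delta> times the squared norm of
  the coefficients. Negative eigenvalues may tend to 0, so the index can drop in the limit but not
  rise.\<close>

lemma neg_index_lower_semicontinuous:
  assumes A: "hermitian n A" and B: "eventually (\<lambda>t. hermitian n (B t)) F"
    and lim: "\<And>i j. i < n \<Longrightarrow> j < n \<Longrightarrow> ((\<lambda>t. B t i j) \<longlongrightarrow> A i j) F"
  shows "eventually (\<lambda>t. neg_index n A \<le> neg_index n (B t)) F"
proof -
  define k where "k = neg_index n A"
  obtain V and \<delta> :: real where \<delta>: "\<delta> > 0"
    and V: "\<And>y. qform n A (\<lambda>i. \<Sum>a<k. y a * V a i) \<le> - \<delta> * (\<Sum>a<k. (cmod (y a))\<^sup>2)"
    using neg_index_uniformly_negative[OF A] unfolding k_def by blast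
  define c where "c i = (\<Sum>a<k. cmod (V a i))" for i
  have c0: "c i \<ge> 0" for i unfolding c_def by (simp add: sum_nonneg)
  \<comment> \<open>Bound for the change of the form on the span of the \<open>V a\<close>, per unit
    of squared coefficient norm.\<close>
  define \<eta> where "\<eta> t = (\<Sum>i<n. \<Sum>j<n. cmod (B t i j - A i j) * (c i * c j))" for t
  have "(\<eta> \<longlongrightarrow> (\<Sum>i<n. \<Sum>j<n. cmod (A i j - A i j) * (c i * c j))) F"
    unfolding \<eta>_def by (intro tendsto_intros lim) auto
  then have "(\<eta> \<longlongrightarrow> 0) F" by simp
  then have "eventually (\<lambda>t. \<eta> t < \<delta>) F"
    using \<delta> by (rule order_tendstoD)
  then show ?thesis using B
  proof eventually_elim
    case (elim t)
    show ?case unfolding k_def[symmetric]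
    proof (rule neg_index_geI[where V = V])
      fix y :: "nat \<Rightarrow> complex" assume y: "\<exists>a<k. y a \<noteq> 0"
      define Y where "Y = (\<Sum>a<k. (cmod (y a))\<^sup>2)"
      have Y: "Y > 0" using y unfolding Y_def by (auto intro: sum_cmod_power2_pos)
      define w where "w i = (\<Sum>a<k. y a * V a i)" for i
      have w: "cmod (w i) \<le> sqrt Y * c i" for i
        unfolding w_def Y_def c_def by (rule cmod_sum_le_norm)
      have "qform n (B t) w - qform n A w =
          Re (\<Sum>i<n. \<Sum>j<n. cnj (w i) * ((B t i j - A i j) * w j))"
        by (simp add: qform_def inner_prod_def mat_app_def sum_distrib_left algebra_simps
            sum_subtractf)
      also have "\<dots> \<le> cmod (\<Sum>i<n. \<Sum>j<n. cnj (w i) * ((B t i j - A i j) * w j))"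
        by (rule complex_Re_le_cmod)
      also have "\<dots> \<le> (\<Sum>i<n. \<Sum>j<n. cmod (cnj (w i) * ((B t i j - A i j) * w j)))"
        by (intro order_trans[OF norm_sum] sum_mono norm_sum)
      also have "\<dots> \<le> (\<Sum>i<n. \<Sum>j<n. cmod (B t i j - A i j) * ((sqrt Y * c i) * (sqrt Y * c j)))"
      proof (intro sum_mono)
        fix i j
        have "cmod (w i) * cmod (w j) \<le> (sqrt Y * c i) * (sqrt Y * c j)"
          using Y c0 by (intro mult_mono w) auto
        then have "cmod (B t i j - A i j) * (cmod (w i) * cmod (w j)) \<le>
            cmod (B t i j - A i j) * ((sqrt Y * c i) * (sqrt Y * c j))"
          by (intro mult_left_mono) auto
        then show "cmod (cnj (w i) * ((B t i j - A i j) * w j)) \<le>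
            cmod (B t i j - A i j) * ((sqrt Y * c i) * (sqrt Y * c j))"
          by (simp add: norm_mult mult_ac)
      qed
      also have "\<dots> = (\<Sum>i<n. \<Sum>j<n. (sqrt Y * sqrt Y) * (cmod (B t i j - A i j) * (c i * c j)))"
        by (simp only: mult_ac)
      also have "\<dots> = Y * \<eta> t"
        using Y by (simp only: \<eta>_def sum_distrib_left real_sqrt_mult_self abs_of_pos)
      finally have "qform n (B t) w \<le> qform n A w + Y * \<eta> t" by simp
      also have "\<dots> \<le> - \<delta> * Y + Y * \<eta> t"
        using V[of y] unfolding w_def Y_def by simp
      also have "\<dots> = Y * (\<eta> t - \<delta>)" by (simp add: algebra_simps)
      also have "\<dots> < 0" using Y elim(1) by (simp add: mult_pos_neg)
      finally show "qform n (B t) (\<lambda>i. \<Sum>a<k. y a * V a i) < 0" unfolding w_def .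
    qed (rule elim)
  qed
qed

text \<open>With \<open>r\<close> the norm of the first \<open>k\<close> coefficients and
  \<open>s\<close> the modulus of the last, the form is at most -\<delta> r^2 + 2 b r s - T s^2. The
  condition on \<open>h\<close> says b^2 < \<delta> T, which makes this binary form negative
  definite.\<close>

lemma neg_index_extend:
  fixes V :: "nat \<Rightarrow> nat \<Rightarrow> complex"
  assumes A: "hermitian n A" and \<delta>: "\<delta> > 0"
    and V: "\<And>y. qform n A (\<lambda>i. \<Sum>a<k. y a * V a i) \<le> - \<delta> * (\<Sum>a<k. (cmod (y a))\<^sup>2)"
    and h: "(\<Sum>a<k. cmod (inner_prod n (V a) (mat_app n A h)))\<^sup>2 < \<delta> * (- qform n A h)"
  shows "Suc k \<le> neg_index n A"
proof (rule neg_index_geI[OF A, where V = "V(k := h)"])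
  fix y :: "nat \<Rightarrow> complex" assume y: "\<exists>a<Suc k. y a \<noteq> 0"
  define r where "r = sqrt (\<Sum>a<k. (cmod (y a))\<^sup>2)"
  define s where "s = cmod (y k)"
  define b where "b = (\<Sum>a<k. cmod (inner_prod n (V a) (mat_app n A h)))"
  define T where "T = - qform n A h"
  have r2: "r\<^sup>2 = (\<Sum>a<k. (cmod (y a))\<^sup>2)" and r0: "r \<ge> 0"
    unfolding r_def by (simp_all add: sum_nonneg)
  have s0: "s \<ge> 0" by (simp add: s_def)
  have "(\<lambda>i. \<Sum>a<Suc k. y a * (V(k := h)) a i) = (\<lambda>i. (\<Sum>a<k. y a * V a i) + y k * h i)"
    by auto
  then have "qform n A (\<lambda>i. \<Sum>a<Suc k. y a * (V(k := h)) a i) =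
      qform n A (\<lambda>i. \<Sum>a<k. y a * V a i) +
      2 * Re (y k * inner_prod n (\<lambda>i. \<Sum>a<k. y a * V a i) (mat_app n A h)) - s\<^sup>2 * T"
    by (simp only: qform_add[OF A] s_def T_def)
  also have "\<dots> \<le> - \<delta> * r\<^sup>2 + 2 * (s * (r * b)) - s\<^sup>2 * T"
  proof -
    have "Re (y k * inner_prod n (\<lambda>i. \<Sum>a<k. y a * V a i) (mat_app n A h)) \<le>
        s * cmod (inner_prod n (\<lambda>i. \<Sum>a<k. y a * V a i) (mat_app n A h))"
      unfolding s_def norm_mult[symmetric] by (rule complex_Re_le_cmod)
    also have "\<dots> \<le> s * (r * b)"
    proof (intro mult_left_mono s0)
      show "cmod (inner_prod n (\<lambda>i. \<Sum>a<k. y a * V a i) (mat_app n A h)) \<le> r * b"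
        unfolding inner_prod_sum_left r_def b_def
        using cmod_sum_le_norm[where k = k and y = "\<lambda>a. cnj (y a)"] by simp
    qed
    finally show ?thesis using V[of y] unfolding r2 by simp
  qed
  also have "\<dots> < 0"
  proof -
    have b2: "b\<^sup>2 < \<delta> * T" using h unfolding b_def T_def .
    \<comment> \<open>The square is completed in \<open>r\<close>. If \<open>y k = 0\<close> the
      remaining term vanishes too, and negativity has to come from \<open>r\<close> alone.\<close>
    have eq: "\<delta> * (- \<delta> * r\<^sup>2 + 2 * (s * (r * b)) - s\<^sup>2 * T) = - (\<delta> * r - b * s)\<^sup>2 - s\<^sup>2 * (\<delta> * T - b\<^sup>2)"
      by (simp add: power2_eq_square algebra_simps)
    have "\<delta> * (- \<delta> * r\<^sup>2 + 2 * (s * (r * b)) - s\<^sup>2 * T) < 0"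
    proof (cases "y k = 0")
      case True
      then have "s = 0" by (simp add: s_def)
      have "\<exists>a<k. y a \<noteq> 0" using y True by (auto simp: less_Suc_eq)
      then have "r\<^sup>2 > 0" unfolding r2 by (auto intro: sum_cmod_power2_pos)
      then show ?thesis using \<delta> \<open>s = 0\<close> by simp
    next
      case False
      then have "s\<^sup>2 * (\<delta> * T - b\<^sup>2) > 0" using b2 by (simp add: s_def)
      then show ?thesis unfolding eq using zero_le_power2[of "\<delta> * r - b * s"] by linarith
    qed
    then show ?thesis using \<delta> by (simp add: mult_less_0_iff)
  qed
  finally show "qform n A (\<lambda>i. \<Sum>a<Suc k. y a * (V(k := h)) a i) < 0" .
qed

text \<open>Rows and columns outside \<open>S\<close> are zeroed instead of deleted. This only adds
  zero eigenvalues, so the index is that of the principal submatrix, while the size stays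
  \<open>n\<close> and nothing is re-indexed.\<close>

definition restr :: "nat set \<Rightarrow> (nat \<Rightarrow> nat \<Rightarrow> complex) \<Rightarrow> nat \<Rightarrow> nat \<Rightarrow> complex" where
  "restr S A i j = (if i \<in> S \<and> j \<in> S then A i j else 0)"

lemma hermitian_restr: "hermitian n A \<Longrightarrow> hermitian n (restr S A)"
  unfolding hermitian_def restr_def by (metis complex_cnj_zero)

lemma restr_UNIV [simp]: "restr UNIV A = A"
  by (simp add: restr_def fun_eq_iff)

lemma restr_restr: "restr S (restr T A) = restr (S \<inter> T) A"
  by (auto simp: restr_def fun_eq_iff)

lemma qform_restr: "qform n (restr S A) v = qform n A (\<lambda>i. if i \<in> S then v i else 0)"
proof -
  have "inner_prod n v (mat_app n (restr S A) v) =
      inner_prod n (\<lambda>i. if i \<in> S then v i else 0) (mat_app n A (\<lambda>i. if i \<in> S then v i else 0))"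
    unfolding inner_prod_def mat_app_def sum_distrib_left restr_def
    by (intro sum.cong refl) auto
  then show ?thesis by (simp add: qform_def)
qed

text \<open>Entries outside \<open>S\<close> do not affect the restricted form, so they can be set
  to 0. The margin then holds for \<open>A\<close> itself, which allows extension by vectors not
  supported in \<open>S\<close>.\<close>

lemma neg_index_restr_uniformly_negative:
  assumes A: "hermitian n A"
  shows "\<exists>(V :: nat \<Rightarrow> nat \<Rightarrow> complex) \<delta>. \<delta> > 0 \<and> (\<forall>a. \<forall>i. i \<notin> S \<longrightarrow> V a i = 0) \<and> (\<forall>y.
    qform n A (\<lambda>i. \<Sum>a<neg_index n (restr S A). y a * V a i) \<le>
      - \<delta> * (\<Sum>a<neg_index n (restr S A). (cmod (y a))\<^sup>2))"
proof -
  define k where "k = neg_index n (restr S A)"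
  obtain V and \<delta> :: real where \<delta>: "\<delta> > 0"
    and V: "\<And>y. qform n (restr S A) (\<lambda>i. \<Sum>a<k. y a * V a i) \<le> - \<delta> * (\<Sum>a<k. (cmod (y a))\<^sup>2)"
    using neg_index_uniformly_negative[OF hermitian_restr[OF A]] unfolding k_def by blast
  have "(\<lambda>i. \<Sum>a<k. y a * (if i \<in> S then V a i else 0)) =
      (\<lambda>i. if i \<in> S then (\<Sum>a<k. y a * V a i) else 0)" for y
    by auto
  then have "qform n A (\<lambda>i. \<Sum>a<k. y a * (if i \<in> S then V a i else 0)) \<le>
      - \<delta> * (\<Sum>a<k. (cmod (y a))\<^sup>2)" for y
    using V[of y] unfolding qform_restr by simp
  then show ?thesis
    unfolding k_def[symmetric] using \<delta>
    by (intro exI[of _ "\<lambda>a i. if i \<in> S then V a i else 0"] exI[of _ \<delta>]) auto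
qed

text \<open>One further linear condition, that entry \<open>e\<close> vanishes, makes the two
  restricted forms agree.\<close>

lemma neg_index_restr_remove1:
  assumes A: "hermitian n A" and e: "e < n"
  shows "neg_index n (restr S A) \<le> Suc (neg_index n (restr (S - {e}) A))"
proof -
  define p where "p = neg_index n (restr (S - {e}) A)"
  obtain \<phi> :: "nat \<Rightarrow> nat \<Rightarrow> complex" where \<phi>:
    "\<And>v. (\<And>b. b < p \<Longrightarrow> (\<Sum>i<n. \<phi> b i * v i) = 0) \<Longrightarrow> 0 \<le> qform n (restr (S - {e}) A) v"
    using neg_index_nonneg_on_kernel[OF hermitian_restr[OF A]] unfolding p_def by blast
  show ?thesis unfolding p_def[symmetric]
  proof (rule neg_index_leI[OF hermitian_restr[OF A]])
    fix v assume v: "\<And>b. b < Suc p \<Longrightarrow> (\<Sum>i<n. (\<phi>(p := unit_fun e)) b i * v i) = 0"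
    have "(\<Sum>i<n. unit_fun e i * v i) = (\<Sum>i<n. if i = e then v i else 0)"
      by (intro sum.cong) (auto simp: unit_fun_def)
    then have ve: "v e = 0" using v[of p] e by simp
    have "0 \<le> qform n (restr (S - {e}) A) v"
    proof (rule \<phi>)
      fix b assume "b < p"
      then show "(\<Sum>i<n. \<phi> b i * v i) = 0" using v[of b] by simp
    qed
    also have "\<dots> = qform n (restr S A) v"
      unfolding qform_restr using ve by (intro arg_cong[where f = "qform n A"] ext) auto
    finally show "0 \<le> qform n (restr S A) v" .
  qed
qed

lemma neg_index_restr_remove:
  assumes A: "hermitian n A" and "finite E" "E \<subseteq> {..<n}"
  shows "neg_index n (restr S A) \<le> neg_index n (restr (S - E) A) + card E"
  using assms(2,3)
proof (induction E)
  case (insert e E)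
  have "neg_index n (restr (S - E) A) \<le> Suc (neg_index n (restr (S - E - {e}) A))"
    using insert.prems by (intro neg_index_restr_remove1[OF A]) auto
  moreover have "S - E - {e} = S - insert e E" by auto
  ultimately show ?case using insert by simp
qed auto

text \<open>For invertible \<open>A\<close> the vector \<open>v\<close> is column \<open>e\<close>
  of the inverse and \<open>v e\<close> its diagonal entry. Phrased without an inverse, the lemma
  also serves singular matrices whose range contains the unit vector.\<close>

lemma mat_app_eq_unit_fun_qform:
  assumes A: "hermitian n A" and e: "e < n" and v: "\<And>i. i < n \<Longrightarrow> mat_app n A v i = unit_fun e i"
  shows "inner_prod n x (mat_app n A v) = cnj (x e)" "qform n A v = Re (v e)" "Im (v e) = 0"
proof -
  show 1: "inner_prod n x (mat_app n A v) = cnj (x e)" for x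
    using inner_prod_unit_fun_right[OF e] v by (subst inner_prod_cong[of n x x _ "unit_fun e"]) auto
  show "qform n A v = Re (v e)" by (simp add: qform_def 1)
  show "Im (v e) = 0" using hermitian_inner_prod_real[OF A, of v] by (simp add: 1)
qed

text \<open>The map \<open>T\<close> projects along \<open>v\<close> onto the vectors with entry
  \<open>e\<close> equal to 0. It lowers the form by |x e|^2 / v e, which is nonnegative because
  \<open>v e\<close> is positive.\<close>

lemma neg_index_le_restr_remove:
  assumes A: "hermitian n A" and e: "e < n" and v: "\<And>i. i < n \<Longrightarrow> mat_app n A v i = unit_fun e i"
    and pos: "Re (v e) > 0"
  shows "neg_index n A \<le> neg_index n (restr (- {e}) A)"
proof (rule neg_index_mono[where T = "\<lambda>j i. unit_fun i j - (if i = e then v j / v e else 0)",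
      OF A hermitian_restr[OF A]])
  fix x :: "nat \<Rightarrow> complex"
  have V: "inner_prod n x (mat_app n A v) = cnj (x e)" "qform n A v = Re (v e)" "Im (v e) = 0" for x
    by (rule mat_app_eq_unit_fun_qform(1)[OF A e], fact v, rule mat_app_eq_unit_fun_qform(2)[OF A e], fact v,
        rule mat_app_eq_unit_fun_qform(3)[OF A e], fact v)
  have ve: "v e = of_real (Re (v e))" using V(3) by (simp add: complex_eq_iff)
  have ve0: "v e \<noteq> 0" using pos by auto
  have *: "(\<Sum>i<n. (unit_fun i j - (if i = e then v j / v e else 0)) * x i) =
      x j + (- (x e / v e)) * v j" if "j < n" for j
  proof -
    have "(\<Sum>i<n. (unit_fun i j - (if i = e then v j / v e else 0)) * x i) =
        (\<Sum>i<n. if i = j then x i else 0) - (\<Sum>i<n. if i = e then v j / v e * x i else 0)"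
      unfolding sum_subtractf[symmetric] by (intro sum.cong) (auto simp: unit_fun_def algebra_simps)
    then show ?thesis using that e by simp
  qed
  define y where "y j = x j + (- (x e / v e)) * v j" for j
  have "qform n (restr (- {e}) A) (\<lambda>j. \<Sum>i<n. (unit_fun i j - (if i = e then v j / v e else 0)) * x i)
      = qform n (restr (- {e}) A) y"
    using * by (simp add: qform_def inner_prod_def mat_app_def y_def)
  also have "\<dots> = qform n A y"
    unfolding qform_restr using ve0 by (intro arg_cong[where f = "qform n A"]) (auto simp: y_def)
  also have "\<dots> = qform n A x + 2 * Re (- (x e / v e) * cnj (x e)) + (cmod (x e / v e))\<^sup>2 * Re (v e)"
    unfolding y_def[abs_def] qform_add[OF A] V by simp
  also have "\<dots> = qform n A x - (cmod (x e))\<^sup>2 / Re (v e)"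
  proof -
    have "x e / v e * cnj (x e) = of_real ((cmod (x e))\<^sup>2 / Re (v e))"
      by (subst ve) (simp add: complex_norm_square flip: of_real_power)
    then have "Re (- (x e / v e) * cnj (x e)) = - ((cmod (x e))\<^sup>2 / Re (v e))"
      by (metis Re_complex_of_real minus_mult_left uminus_complex.simps(1))
    moreover have "(cmod (x e / v e))\<^sup>2 * Re (v e) = (cmod (x e))\<^sup>2 / Re (v e)"
      using pos by (subst ve) (simp add: norm_divide power_divide power2_eq_square)
    ultimately show ?thesis by simp
  qed
  also have "\<dots> \<le> qform n A x" using pos by simp
  finally show "qform n (restr (- {e}) A)
      (\<lambda>j. \<Sum>i<n. (unit_fun i j - (if i = e then v j / v e else 0)) * x i) \<le> qform n A x" .
qed

text \<open>The vector \<open>v\<close> is orthogonal, with respect to the form of \<open>A\<close>,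
  to everything that vanishes at \<open>e\<close>. Adding -t v to the unit vector therefore leaves
  its products with the \<open>V a\<close> unchanged, while its form q - 2t + t^2 v e tends to minus
  infinity. The unit vector is needed since \<open>v\<close> alone is isotropic when
  \<open>v e = 0\<close>.\<close>

lemma neg_index_restr_remove_less:
  assumes A: "hermitian n A" and e: "e < n" and v: "\<And>i. i < n \<Longrightarrow> mat_app n A v i = unit_fun e i"
    and nonpos: "Re (v e) \<le> 0"
  shows "Suc (neg_index n (restr (- {e}) A)) \<le> neg_index n A"
proof -
  have v': "inner_prod n x (mat_app n A v) = cnj (x e)" "qform n A v = Re (v e)" for x
    by (rule mat_app_eq_unit_fun_qform(1)[OF A e], fact v, rule mat_app_eq_unit_fun_qform(2)[OF A e], fact v)
  define k where "k = neg_index n (restr (- {e}) A)"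
  obtain V and \<delta> :: real where \<delta>: "\<delta> > 0" and V0: "\<And>a i. i \<notin> - {e} \<Longrightarrow> V a i = 0"
    and V: "\<And>y. qform n A (\<lambda>i. \<Sum>a<k. y a * V a i) \<le> - \<delta> * (\<Sum>a<k. (cmod (y a))\<^sup>2)"
    using neg_index_restr_uniformly_negative[OF A, of "- {e}"] unfolding k_def by blast
  define b where "b = (\<Sum>a<k. cmod (inner_prod n (V a) (mat_app n A (unit_fun e))))"
  define q where "q = qform n A (unit_fun e)"
  \<comment> \<open>Chosen so that 2t - |q| exceeds b^2 / \<delta>, the threshold in
    \<open>neg_index_extend\<close>.\<close>
  define t where "t = (\<bar>q\<bar> + b\<^sup>2 / \<delta> + 1)"
  have t: "t > 0" unfolding t_def using \<delta> by (simp add: add_nonneg_pos)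
  define h where "h = (\<lambda>i. unit_fun e i + of_real (- t) * v i)"
  show ?thesis unfolding k_def[symmetric]
  proof (rule neg_index_extend[OF A \<delta> V, of h])
    have "inner_prod n (V a) (mat_app n A h) = inner_prod n (V a) (mat_app n A (unit_fun e))" for a
      unfolding h_def mat_app_add[abs_def] inner_prod_add_right inner_prod_scale_right
      using V0[of e a] by (simp add: v'(1))
    then have b: "(\<Sum>a<k. cmod (inner_prod n (V a) (mat_app n A h))) = b"
      by (simp add: b_def)
    have "qform n A h \<le> \<bar>q\<bar> - 2 * t"
    proof -
      have "qform n A h = q - 2 * t + t\<^sup>2 * Re (v e)"
        unfolding h_def qform_add[OF A] v' q_def[symmetric] by (simp add: unit_fun_def)
      moreover have "t\<^sup>2 * Re (v e) \<le> 0" using nonpos by (simp add: mult_nonneg_nonpos)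
      ultimately show ?thesis by simp
    qed
    then have "- qform n A h \<ge> 2 * t - \<bar>q\<bar>" by simp
    moreover have "2 * t - \<bar>q\<bar> > b\<^sup>2 / \<delta>"
    proof -
      have "b\<^sup>2 / \<delta> \<ge> 0" using \<delta> by simp
      moreover have "2 * t - \<bar>q\<bar> = 2 * (b\<^sup>2 / \<delta>) + \<bar>q\<bar> + 2"
        by (simp add: t_def algebra_simps)
      ultimately show ?thesis using abs_ge_zero[of q] by linarith
    qed
    ultimately have "- qform n A h > b\<^sup>2 / \<delta>" by linarith
    then have "\<delta> * (- qform n A h) > b\<^sup>2"
      using \<delta> by (simp add: pos_divide_less_eq mult.commute)
    then show "(\<Sum>a<k. cmod (inner_prod n (V a) (mat_app n A h)))\<^sup>2 < \<delta> * (- qform n A h)"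
      by (simp add: b)
  qed
qed

section \<open>Lowering the diagonal\<close>

definition diag_sub :: "(nat \<Rightarrow> nat \<Rightarrow> complex) \<Rightarrow> (nat \<Rightarrow> real) \<Rightarrow> nat \<Rightarrow> nat \<Rightarrow> complex" where
  "diag_sub A D i j = A i j - (if i = j then of_real (D i) else 0)"

lemma hermitian_diag_sub:
  assumes "hermitian n A"
  shows "hermitian n (diag_sub A D)"
  unfolding hermitian_def
proof (intro allI impI)
  fix i j assume "i < n" "j < n"
  then have A: "A j i = cnj (A i j)" using assms unfolding hermitian_def by blast
  show "diag_sub A D j i = cnj (diag_sub A D i j)"
    unfolding diag_sub_def by (subst A) simp
qed

lemma mat_app_diag_sub:
  assumes "i < n"
  shows "mat_app n (diag_sub A D) v i = mat_app n A v i - of_real (D i) * v i"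
proof -
  have "mat_app n (diag_sub A D) v i = (\<Sum>j<n. A i j * v j - (if j = i then of_real (D i) * v i else 0))"
    unfolding mat_app_def diag_sub_def by (intro sum.cong) (auto simp: algebra_simps)
  then show ?thesis using assms by (simp add: sum_subtractf mat_app_def)
qed

lemma qform_diag_sub: "qform n (diag_sub A D) v = qform n A v - (\<Sum>i<n. D i * (cmod (v i))\<^sup>2)"
proof -
  have "inner_prod n v (mat_app n (diag_sub A D) v) =
      (\<Sum>i<n. cnj (v i) * mat_app n A v i - of_real (D i * (cmod (v i))\<^sup>2))"
    unfolding inner_prod_def
  proof (intro sum.cong refl)
    fix i assume "i \<in> {..<n}"
    then show "cnj (v i) * mat_app n (diag_sub A D) v i =
        cnj (v i) * mat_app n A v i - of_real (D i * (cmod (v i))\<^sup>2)"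
      using complex_norm_square[of "v i"]
      by (simp add: mat_app_diag_sub algebra_simps flip: of_real_power)
  qed
  then show ?thesis
    by (simp add: qform_def inner_prod_def sum_subtractf)
qed

lemma neg_index_diag_sub_mono:
  assumes A: "hermitian n A" and "\<And>i. i < n \<Longrightarrow> D i \<le> D' i"
  shows "neg_index n (diag_sub A D) \<le> neg_index n (diag_sub A D')"
proof (rule neg_index_antimono_qform[OF hermitian_diag_sub[OF A] hermitian_diag_sub[OF A]])
  fix v
  have "(\<Sum>i<n. D i * (cmod (v i))\<^sup>2) \<le> (\<Sum>i<n. D' i * (cmod (v i))\<^sup>2)"
    using assms(2) by (intro sum_mono mult_right_mono) auto
  then show "qform n (diag_sub A D') v \<le> qform n (diag_sub A D) v"
    by (simp add: qform_diag_sub)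
qed

text \<open>The subtraction is invisible to vectors vanishing at \<open>i\<close> and to their
  products with the unit vector, whose own form decreases by \<open>t\<close>. For large
  \<open>t\<close> the unit vector thus extends the negative subspace of the deleted matrix.\<close>

lemma neg_index_diag_sub_large:
  assumes A: "hermitian n A" and i: "i < n"
  shows "\<exists>t\<ge>0. Suc (neg_index n (restr (- {i}) A)) \<le> neg_index n (diag_sub A ((\<lambda>_. 0)(i := t)))"
proof -
  define k where "k = neg_index n (restr (- {i}) A)"
  obtain V and \<delta> :: real where \<delta>: "\<delta> > 0" and V0: "\<And>a j. j \<notin> - {i} \<Longrightarrow> V a j = 0"
    and V: "\<And>y. qform n A (\<lambda>j. \<Sum>a<k. y a * V a j) \<le> - \<delta> * (\<Sum>a<k. (cmod (y a))\<^sup>2)"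
    using neg_index_restr_uniformly_negative[OF A, of "- {i}"] unfolding k_def by blast
  define b where "b = (\<Sum>a<k. cmod (inner_prod n (V a) (mat_app n A (unit_fun i))))"
  define q where "q = qform n A (unit_fun i)"
  define t where "t = (\<bar>q\<bar> + b\<^sup>2 / \<delta> + 1)"
  have bd: "b\<^sup>2 / \<delta> \<ge> 0" using \<delta> by simp
  have t: "t \<ge> 0" unfolding t_def using bd by linarith
  define B where "B = diag_sub A ((\<lambda>_. 0)(i := t))"
  have qB: "qform n B v = qform n A v - t * (cmod (v i))\<^sup>2" for v
  proof -
    have "(\<Sum>j<n. ((\<lambda>_. 0)(i := t)) j * (cmod (v j))\<^sup>2) = (\<Sum>j<n. if j = i then t * (cmod (v j))\<^sup>2 else 0)"
      by (intro sum.cong) auto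
    then show ?thesis using i by (simp add: B_def qform_diag_sub)
  qed
  have "Suc k \<le> neg_index n B"
  proof (rule neg_index_extend[OF _ \<delta>])
    show "hermitian n B" unfolding B_def by (rule hermitian_diag_sub[OF A])
    show "qform n B (\<lambda>j. \<Sum>a<k. y a * V a j) \<le> - \<delta> * (\<Sum>a<k. (cmod (y a))\<^sup>2)" for y
      using V[of y] V0[of i] by (simp add: qB)
    have "inner_prod n (V a) (mat_app n B (unit_fun i)) = inner_prod n (V a) (mat_app n A (unit_fun i))" for a
    proof -
      have "cnj (V a j) * mat_app n B (unit_fun i) j = cnj (V a j) * mat_app n A (unit_fun i) j"
        if "j < n" for j
        using that V0[of i a] by (cases "j = i") (auto simp: B_def mat_app_diag_sub)
      then show ?thesis unfolding inner_prod_def by (intro sum.cong) auto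
    qed
    then have b: "(\<Sum>a<k. cmod (inner_prod n (V a) (mat_app n B (unit_fun i)))) = b"
      by (simp add: b_def)
    have "b\<^sup>2 / \<delta> < - qform n B (unit_fun i)"
      unfolding qB q_def[symmetric] t_def using abs_ge_self[of q] by (simp add: unit_fun_def)
    then show "(\<Sum>a<k. cmod (inner_prod n (V a) (mat_app n B (unit_fun i))))\<^sup>2 <
        \<delta> * (- qform n B (unit_fun i))"
      unfolding b using \<delta> by (simp add: pos_divide_less_eq mult.commute)
  qed
  then show ?thesis using t unfolding B_def k_def by blast
qed

text \<open>The bound on the index after deletion keeps the admissible \<open>t\<close> bounded, by
  \<open>neg_index_diag_sub_large\<close>. Lower semicontinuity carries the inequality from nearby
  admissible values to their supremum.\<close>

lemma neg_index_diag_sub_maximal: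
  assumes A: "hermitian n A" and i: "i < n"
    and k: "neg_index n A = k" "k \<le> neg_index n (restr (- {i}) A)"
  shows "\<exists>t\<ge>0. neg_index n (diag_sub A ((\<lambda>_. 0)(i := t))) = k \<and>
    (\<forall>s>t. k < neg_index n (diag_sub A ((\<lambda>_. 0)(i := s))))"
proof -
  define N where "N t = neg_index n (diag_sub A ((\<lambda>_. 0)(i := t)))" for t
  have N_mono: "N s \<le> N t" if "s \<le> t" for s t
    unfolding N_def using that by (intro neg_index_diag_sub_mono[OF A]) auto
  have "diag_sub A ((\<lambda>_. 0)(i := 0)) = A"
    by (simp add: diag_sub_def fun_eq_iff)
  then have N0: "N 0 = k" using k by (simp add: N_def)
  obtain u where u: "u \<ge> 0" "Suc k \<le> N u"
    using neg_index_diag_sub_large[OF A i] k(2) unfolding N_def by (meson Suc_le_mono le_trans)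
  define X where "X = {t. t \<ge> 0 \<and> N t \<le> k}"
  have X0: "0 \<in> X" using N0 by (simp add: X_def)
  have Xu: "t \<le> u" if "t \<in> X" for t
    using that u N_mono[of u t] by (force simp: X_def)
  have bdd: "bdd_above X" using Xu by (auto simp: bdd_above_def)
  define \<tau> where "\<tau> = Sup X"
  have \<tau>0: "\<tau> \<ge> 0" unfolding \<tau>_def by (rule cSup_upper[OF X0 bdd])
  have "\<tau> \<in> closure X"
    unfolding \<tau>_def using X0 bdd by (intro closure_contains_Sup) auto
  moreover have "eventually (\<lambda>t. N \<tau> \<le> N t) (nhds \<tau>)"
    unfolding N_def
  proof (rule neg_index_lower_semicontinuous)
    fix a b
    show "((\<lambda>t. diag_sub A ((\<lambda>_. 0)(i := t)) a b) \<longlongrightarrow> diag_sub A ((\<lambda>_. 0)(i := \<tau>)) a b) (nhds \<tau>)"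
      unfolding diag_sub_def by (cases "a = i") (auto intro!: tendsto_intros filterlim_ident)
    show "\<forall>\<^sub>F t in nhds \<tau>. hermitian n (diag_sub A ((\<lambda>_. 0)(i := t)))"
      by (rule always_eventually) (simp add: hermitian_diag_sub[OF A])
  qed (rule hermitian_diag_sub[OF A])
  then obtain T where "open T" "\<tau> \<in> T" "\<And>t. t \<in> T \<Longrightarrow> N \<tau> \<le> N t"
    by (auto simp: eventually_nhds)
  ultimately obtain t where "t \<in> X" "N \<tau> \<le> N t"
    by (metis closure_iff_nhds_not_empty disjoint_iff order_refl)
  then have "N \<tau> \<le> k" by (auto simp: X_def)
  moreover have "k \<le> N \<tau>" using N_mono[OF \<tau>0] N0 by simp
  moreover have "k < N s" if "s > \<tau>" for s
  proof (rule ccontr)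
    assume "\<not> k < N s"
    then have "s \<in> X" using that \<tau>0 by (auto simp: X_def)
    then have "s \<le> \<tau>" unfolding \<tau>_def by (rule cSup_upper[OF _ bdd])
    then show False using that by simp
  qed
  ultimately show ?thesis
    using \<tau>0 unfolding N_def by (intro exI[of _ \<tau>]) auto
qed

section \<open>Null vectors at an extremal diagonal\<close>

lemma kernel_or_range:
  assumes A: "hermitian n A" and i: "i < n" and nk: "\<And>u. (\<And>j. j < n \<Longrightarrow> mat_app n A u j = 0) \<Longrightarrow> u i = 0"
  shows "\<exists>v. \<forall>j<n. mat_app n A v j = unit_fun i j"
proof -
  obtain f and d :: "nat \<Rightarrow> real" where f: "orthonormal n n f"
    and ev: "\<And>a i. a < n \<Longrightarrow> i < n \<Longrightarrow> mat_app n A (f a) i = of_real (d a) * f a i"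
    using hermitian_orthonormal_eigenbasis[OF A] by blast
  \<comment> \<open>The pseudo-inverse applied to the unit vector. Division by a zero eigenvalue
    gives 0, which is right: the coefficient there is the conjugate of \<open>f a i\<close>, and it
    vanishes because \<open>f a\<close> is a null vector.\<close>
  define v where "v = (\<lambda>j. \<Sum>a<n. inner_prod n (f a) (unit_fun i) / of_real (d a) * f a j)"
  have "mat_app n A v j = unit_fun i j" if j: "j < n" for j
  proof -
    have "mat_app n A v j = (\<Sum>a<n. inner_prod n (f a) (unit_fun i) / of_real (d a) * mat_app n A (f a) j)"
      unfolding v_def by (simp only: mat_app_sum)
    also have "\<dots> = (\<Sum>a<n. inner_prod n (f a) (unit_fun i) * f a j)"
    proof (intro sum.cong refl)
      fix a assume a: "a \<in> {..<n}"
      have "inner_prod n (f a) (unit_fun i) = 0" if "d a = 0"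
        using nk[of "f a"] ev[of a] a that i by (simp add: inner_prod_unit_fun_right)
      then show "inner_prod n (f a) (unit_fun i) / of_real (d a) * mat_app n A (f a) j =
          inner_prod n (f a) (unit_fun i) * f a j"
        using a j by (cases "d a = 0") (auto simp: ev)
    qed
    also have "\<dots> = unit_fun i j"
      using orthonormal_basis_expansion[OF f j] by simp
    finally show ?thesis .
  qed
  then show ?thesis by blast
qed

text \<open>If the unit vector is \<open>A v\<close>, then replacing x by x - s (x i) v turns the
  form of \<open>A\<close> into that of \<open>A\<close> with 2s - s^2 q subtracted at entry
  \<open>i\<close>. For small s > 0 this amount is positive, so lowering was still possible.\<close>

lemma neg_index_rank_one_sub:
  assumes A: "hermitian n A" and i: "i < n" and v: "\<And>j. j < n \<Longrightarrow> mat_app n A v j = unit_fun i j"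
  shows "\<exists>t>0. neg_index n (diag_sub A ((\<lambda>_. 0)(i := t))) \<le> neg_index n A"
proof -
  have V: "inner_prod n x (mat_app n A v) = cnj (x i)" "qform n A v = Re (v i)" for x
    by (rule mat_app_eq_unit_fun_qform(1)[OF A i], fact v, rule mat_app_eq_unit_fun_qform(2)[OF A i], fact v)
  define q where "q = Re (v i)"
  \<comment> \<open>This choice gives s q \<le> s |q| = 1 - s < 2, hence t > 0 whatever the sign of
    \<open>q\<close>.\<close>
  define s where "s = 1 / (1 + \<bar>q\<bar>)"
  define t where "t = 2 * s - s\<^sup>2 * q"
  have s: "s > 0" by (simp add: s_def)
  have "s * (1 + \<bar>q\<bar>) = 1" by (simp add: s_def)
  then have "s + s * \<bar>q\<bar> = 1" by (simp add: distrib_left)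
  moreover have "s * q \<le> s * \<bar>q\<bar>" using s by (intro mult_left_mono) auto
  ultimately have "s * q < 2" using s by linarith
  then have t: "t > 0"
    using s by (simp add: t_def power2_eq_square)
  define B where "B = diag_sub A ((\<lambda>_. 0)(i := t))"
  have "neg_index n B \<le> neg_index n A"
  proof (rule neg_index_mono[where T = "\<lambda>l j. unit_fun j l - (if j = i then of_real s * v l else 0)"])
    show "hermitian n B" "hermitian n A" unfolding B_def by (intro hermitian_diag_sub A)+
    fix x :: "nat \<Rightarrow> complex"
    have *: "(\<Sum>j<n. (unit_fun j l - (if j = i then of_real s * v l else 0)) * x j) =
        x l + (- of_real s * x i) * v l" if "l < n" for l
    proof -
      have "(\<Sum>j<n. (unit_fun j l - (if j = i then of_real s * v l else 0)) * x j) =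
          (\<Sum>j<n. if j = l then x j else 0) - (\<Sum>j<n. if j = i then of_real s * v l * x j else 0)"
        unfolding sum_subtractf[symmetric] by (intro sum.cong) (auto simp: unit_fun_def algebra_simps)
      then show ?thesis using that i by simp
    qed
    have "qform n A (\<lambda>l. \<Sum>j<n. (unit_fun j l - (if j = i then of_real s * v l else 0)) * x j) =
        qform n A (\<lambda>l. x l + (- of_real s * x i) * v l)"
      using * by (simp add: qform_def inner_prod_def mat_app_def)
    also have "\<dots> = qform n A x + 2 * Re (- of_real s * x i * cnj (x i)) +
        (cmod (- of_real s * x i))\<^sup>2 * q"
      unfolding qform_add[OF A] V q_def ..
    also have "- of_real s * x i * cnj (x i) = of_real (- s * (cmod (x i))\<^sup>2)"
      using complex_norm_square[of "x i"] by (simp add: mult.assoc flip: of_real_power)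
    also have "qform n A x + 2 * Re (of_real (- s * (cmod (x i))\<^sup>2)) + (cmod (- of_real s * x i))\<^sup>2 * q
        = qform n A x - t * (cmod (x i))\<^sup>2"
      by (simp add: norm_mult t_def power_mult_distrib algebra_simps)
    also have "\<dots> = qform n B x"
    proof -
      have "(\<Sum>j<n. ((\<lambda>_. 0)(i := t)) j * (cmod (x j))\<^sup>2) = (\<Sum>j<n. if j = i then t * (cmod (x j))\<^sup>2 else 0)"
        by (intro sum.cong) auto
      then show ?thesis using i by (simp add: B_def qform_diag_sub)
    qed
    finally show "qform n A (\<lambda>l. \<Sum>j<n. (unit_fun j l - (if j = i then of_real s * v l else 0)) * x j)
        \<le> qform n B x" by simp
  qed
  then show ?thesis using t unfolding B_def by blast
qed

lemma exists_kernel_vector: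
  assumes A: "hermitian n A" and i: "i < n"
    and max: "\<And>t. t > 0 \<Longrightarrow> neg_index n A < neg_index n (diag_sub A ((\<lambda>_. 0)(i := t)))"
  shows "\<exists>u. (\<forall>j<n. mat_app n A u j = 0) \<and> u i \<noteq> 0"
proof (rule ccontr)
  assume "\<not> ?thesis"
  then obtain v where "\<forall>j<n. mat_app n A v j = unit_fun i j"
    using kernel_or_range[OF A i] by blast
  then obtain t where "t > 0" "neg_index n (diag_sub A ((\<lambda>_. 0)(i := t))) \<le> neg_index n A"
    using neg_index_rank_one_sub[OF A i] by blast
  then show False using max[of t] by simp
qed

text \<open>The diagonal entries are lowered one after the other as far as the number of negative
  eigenvalues allows.\<close>

lemma exists_diag_sub_full_kernel:
  assumes A: "hermitian n A" and S: "S \<subseteq> {..<n}" and k: "neg_index n A = k"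
    and rem: "\<And>i. i \<in> S \<Longrightarrow> k \<le> neg_index n (restr (- {i}) A)"
  shows "\<exists>D. (\<forall>i. D i \<ge> 0) \<and> (\<forall>i. i \<notin> S \<longrightarrow> D i = 0) \<and> neg_index n (diag_sub A D) = k \<and>
    (\<forall>i\<in>S. \<exists>u. (\<forall>j<n. mat_app n (diag_sub A D) u j = 0) \<and> u i \<noteq> 0)"
proof -
  have "finite S" using S finite_subset by blast
  have "\<exists>D. (\<forall>i. D i \<ge> 0) \<and> (\<forall>i. i \<notin> F \<longrightarrow> D i = 0) \<and> neg_index n (diag_sub A D) = k \<and>
      (\<forall>i\<in>F. \<forall>t>0. k < neg_index n (diag_sub A (D(i := D i + t))))" if "F \<subseteq> S" for F
    using finite_subset[OF that \<open>finite S\<close>] that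
  proof (induction F)
    case empty
    have "diag_sub A (\<lambda>_. 0) = A" by (simp add: diag_sub_def fun_eq_iff)
    then show ?case using k by (intro exI[of _ "\<lambda>_. 0"]) auto
  next
    case (insert i F)
    then obtain D where D: "\<And>i. D i \<ge> 0" "\<And>i. i \<notin> F \<Longrightarrow> D i = 0" "neg_index n (diag_sub A D) = k"
      "\<And>i t. i \<in> F \<Longrightarrow> t > 0 \<Longrightarrow> k < neg_index n (diag_sub A (D(i := D i + t)))"
      by blast
    have i: "i < n" "i \<in> S" using insert.prems S by auto
    have comp: "diag_sub (diag_sub A D) ((\<lambda>_. 0)(i := t)) = diag_sub A (D(i := D i + t))" for t
      by (auto simp: diag_sub_def fun_eq_iff)
    \<comment> \<open>Earlier lowerings cannot decrease the index after deletion, so the hypothesis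
      on \<open>A\<close> survives them.\<close>
    have "k \<le> neg_index n (restr (- {i}) (diag_sub A D))"
    proof (rule order_trans[OF rem[OF i(2)]])
      show "neg_index n (restr (- {i}) A) \<le> neg_index n (restr (- {i}) (diag_sub A D))"
      proof (intro neg_index_antimono_qform hermitian_restr hermitian_diag_sub A)
        fix v
        have "0 \<le> (\<Sum>j<n. D j * (cmod (if j \<in> - {i} then v j else 0))\<^sup>2)"
          using D(1) by (intro sum_nonneg mult_nonneg_nonneg) auto
        then show "qform n (restr (- {i}) (diag_sub A D)) v \<le> qform n (restr (- {i}) A) v"
          unfolding qform_restr qform_diag_sub by linarith
      qed
    qed
    then obtain t where t: "t \<ge> 0" "neg_index n (diag_sub A (D(i := D i + t))) = k"
        "\<And>s. s > t \<Longrightarrow> k < neg_index n (diag_sub A (D(i := D i + s)))"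
      using neg_index_diag_sub_maximal[OF hermitian_diag_sub[OF A] i(1) D(3)] unfolding comp by blast
    define D' where "D' = D(i := D i + t)"
    have "k < neg_index n (diag_sub A (D'(j := D' j + s)))" if j: "j \<in> insert i F" and s: "s > 0" for j s
    proof (cases "j = i")
      case True
      have "D'(j := D' j + s) = D(i := D i + (t + s))" by (simp add: D'_def True add.assoc)
      then show ?thesis using t(3)[of "t + s"] s by simp
    next
      case False
      \<comment> \<open>Extremality at an earlier entry persists: lowering entry \<open>i\<close> as
        well can only add negative eigenvalues.\<close>
      have "k < neg_index n (diag_sub A (D(j := D j + s)))" using D(4) j s False by blast
      also have "\<dots> \<le> neg_index n (diag_sub A (D'(j := D' j + s)))"
        using t(1) by (intro neg_index_diag_sub_mono[OF A]) (auto simp: D'_def)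
      finally show ?thesis .
    qed
    then have "\<forall>j\<in>insert i F. \<forall>s>0. k < neg_index n (diag_sub A (D'(j := D' j + s)))"
      by blast
    moreover have "\<forall>j. 0 \<le> D' j" "\<forall>j. j \<notin> insert i F \<longrightarrow> D' j = 0"
      using D(1,2) t(1) by (auto simp: D'_def)
    moreover have "neg_index n (diag_sub A D') = k"
      using t(2) by (simp add: D'_def)
    ultimately show ?case by blast
  qed
  from this[OF order_refl]
  obtain D where D: "\<And>i. D i \<ge> 0" "\<And>i. i \<notin> S \<Longrightarrow> D i = 0" "neg_index n (diag_sub A D) = k"
      "\<And>i t. i \<in> S \<Longrightarrow> t > 0 \<Longrightarrow> k < neg_index n (diag_sub A (D(i := D i + t)))"
    by blast
  have K: "\<exists>u. (\<forall>j<n. mat_app n (diag_sub A D) u j = 0) \<and> u i \<noteq> 0" if i: "i \<in> S" for i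
  proof (rule exists_kernel_vector[OF hermitian_diag_sub[OF A]])
    show "i < n" using S i by auto
    fix t :: real assume t: "t > 0"
    have "diag_sub (diag_sub A D) ((\<lambda>_. 0)(i := t)) = diag_sub A (D(i := D i + t))"
      by (auto simp: diag_sub_def fun_eq_iff)
    then show "neg_index n (diag_sub A D) < neg_index n (diag_sub (diag_sub A D) ((\<lambda>_. 0)(i := t)))"
      using D(3) D(4)[OF i t] by simp
  qed
  show ?thesis
    using D(1-3) K by (intro exI[of _ D] conjI allI impI ballI)
qed

text \<open>A real vector space that lies in none of finitely many coordinate hyperplanes contains a
  vector avoiding all of them.\<close>

lemma exists_real_kernel_vector:
  fixes A :: "nat \<Rightarrow> nat \<Rightarrow> real"
  assumes "finite S"
    and "\<And>i. i \<in> S \<Longrightarrow> \<exists>u. (\<forall>j<n. mat_app n (\<lambda>i j. of_real (A i j)) u j = 0) \<and> u i \<noteq> 0"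
  shows "\<exists>u. (\<forall>j<n. (\<Sum>l<n. A j l * u l) = 0) \<and> (\<forall>i\<in>S. u i \<noteq> 0)"
  using assms
proof (induction S)
  case empty
  show ?case by (intro exI[of _ "\<lambda>_. 0"]) simp
next
  case (insert i S)
  have "\<exists>u. (\<forall>j<n. (\<Sum>l<n. A j l * u l) = 0) \<and> (\<forall>i\<in>S. u i \<noteq> 0)"
    by (rule insert.IH) (rule insert.prems, simp)
  then obtain u where u: "\<And>j. j < n \<Longrightarrow> (\<Sum>l<n. A j l * u l) = 0" "\<And>i. i \<in> S \<Longrightarrow> u i \<noteq> 0"
    by blast
  obtain c where c: "\<And>j. j < n \<Longrightarrow> mat_app n (\<lambda>i j. of_real (A i j)) c j = 0" "c i \<noteq> 0"
    using insert.prems by blast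
  have ReIm: "(\<Sum>l<n. A j l * Re (c l)) = 0 \<and> (\<Sum>l<n. A j l * Im (c l)) = 0" if "j < n" for j
    using arg_cong[OF c(1)[OF that], of Re] arg_cong[OF c(1)[OF that], of Im]
    by (simp add: mat_app_def)
  \<comment> \<open>Real and imaginary parts of a null vector of a real matrix are null vectors; the
    part that is nonzero at \<open>i\<close> is taken.\<close>
  define v where "v l = (if Re (c i) \<noteq> 0 then Re (c l) else Im (c l))" for l
  have v: "(\<Sum>l<n. A j l * v l) = 0" if "j < n" for j
    using ReIm[OF that] by (cases "Re (c i) = 0") (simp_all add: v_def)
  have vi: "v i \<noteq> 0" using c(2) by (auto simp: v_def complex_eq_iff)
  have "finite (insert 0 ((\<lambda>j. - u j / v j) ` insert i S))" using insert.hyps by simp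
  from ex_new_if_finite[OF infinite_UNIV_char_0 this]
  obtain s where s: "s \<notin> (\<lambda>j. - u j / v j) ` insert i S" "s \<noteq> 0"
    by blast
  have "(\<Sum>l<n. A j l * (u l + s * v l)) = 0" if "j < n" for j
  proof -
    have "(\<Sum>l<n. A j l * (u l + s * v l)) = (\<Sum>l<n. A j l * u l) + s * (\<Sum>l<n. A j l * v l)"
      by (simp add: algebra_simps sum.distrib sum_distrib_left)
    then show ?thesis using u v that by simp
  qed
  moreover have "u j + s * v j \<noteq> 0" if j: "j \<in> insert i S" for j
  proof (cases "v j = 0")
    case True
    then show ?thesis using u(2) vi j by auto
  next
    case False
    have "s \<noteq> - u j / v j" using s(1) j by blast
    then show ?thesis using False by (auto simp: field_simps)
  qed
  ultimately show ?case by (intro exI[of _ "\<lambda>l. u l + s * v l"] conjI allI impI ballI)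
qed

section \<open>Boundary limits at the nodes\<close>

text \<open>To converge along a supremum of filters it is enough to converge along one member, here
  the Stolz angle with \<alpha> = 1.\<close>

lemma filterlim_vertical:
  assumes "(\<epsilon> \<longlongrightarrow> 0) F" "eventually (\<lambda>t. \<epsilon> t > 0 \<and> Complex x (\<epsilon> t) \<in> analyticity_domain w) F"
  shows "filterlim (\<lambda>t. Complex x (\<epsilon> t)) (nontangential w x) F"
proof -
  let ?C = "{z \<in> analyticity_domain w. \<bar>Re z - x\<bar> \<le> 1 * Im z}"
  have "((\<lambda>t. Complex x (\<epsilon> t)) \<longlongrightarrow> Complex x 0) F"
    by (intro tendsto_Complex tendsto_const assms)
  then have lim: "((\<lambda>t. Complex x (\<epsilon> t)) \<longlongrightarrow> of_real x) F"
    by (simp add: complex_of_real_def)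
  have "filterlim (\<lambda>t. Complex x (\<epsilon> t)) (at (of_real x) within ?C) F"
    unfolding filterlim_at
  proof (rule conjI[OF _ lim])
    show "\<forall>\<^sub>F t in F. Complex x (\<epsilon> t) \<in> ?C \<and> Complex x (\<epsilon> t) \<noteq> complex_of_real x"
      using assms(2) by eventually_elim (auto simp: complex_eq_iff)
  qed
  moreover have "at (of_real x) within ?C \<le> nontangential w x"
    unfolding nontangential_def
    by (rule SUP_upper[of 1 "{0<..}" "\<lambda>\<alpha>. at (of_real x) within {z \<in> analyticity_domain w. \<bar>Re z - x\<bar> \<le> \<alpha> * Im z}"]) simp
  ultimately show ?thesis
    by (rule filterlim_mono[OF _ _ order_refl])
qed

lemma exists_vertical_analytic:
  assumes w: "w meromorphic_on upper_half_plane" and r: "r > 0"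
  shows "\<exists>e. 0 < e \<and> e < r \<and> Complex x e \<in> analyticity_domain w"
proof -
  define z where "z = Complex x (r / 2)"
  have "z \<in> upper_half_plane" using r by (simp add: z_def upper_half_plane_def)
  then have "isolated_singularity_at w z"
    using w by (auto simp: meromorphic_on_altdef)
  then obtain \<rho> where \<rho>: "\<rho> > 0" "w analytic_on ball z \<rho> - {z}"
    by (auto simp: isolated_singularity_at_def)
  \<comment> \<open>Poles are isolated, so a point slightly above height r/2 works: closer to it
    than \<rho>, different from it, and still below height \<open>r\<close>.\<close>
  define e where "e = r / 2 + min \<rho> r / 4"
  have e: "0 < e" "e < r" using r \<rho> by (auto simp: e_def min_def)
  have "dist z (Complex x e) = min \<rho> r / 4"
    using r \<rho> by (simp add: z_def e_def dist_norm cmod_def)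
  moreover have "min \<rho> r / 4 < \<rho>" "min \<rho> r / 4 > 0" using r \<rho> by (auto simp: min_def)
  ultimately have "Complex x e \<in> ball z \<rho> - {z}"
    by auto
  then have "w analytic_on {Complex x e}"
    using \<rho>(2) analytic_on_subset by blast
  then show ?thesis
    using e by (auto simp: analyticity_domain_def upper_half_plane_def)
qed

lemma exists_vertical_sequence:
  assumes w: "w meromorphic_on upper_half_plane"
  obtains \<epsilon> :: "nat \<Rightarrow> real" where "\<And>k. \<epsilon> k > 0" "\<And>k. Complex x (\<epsilon> k) \<in> analyticity_domain w" "\<epsilon> \<longlonglongrightarrow> 0"
proof -
  have "\<forall>k. \<exists>e. 0 < e \<and> e < 1 / real (Suc k) \<and> Complex x e \<in> analyticity_domain w"
    using exists_vertical_analytic[OF w] by simp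
  then obtain \<epsilon> where \<epsilon>: "\<And>k. 0 < \<epsilon> k \<and> \<epsilon> k < 1 / real (Suc k) \<and> Complex x (\<epsilon> k) \<in> analyticity_domain w"
    by metis
  have "\<epsilon> \<longlonglongrightarrow> 0"
  proof (rule tendsto_sandwich[OF _ _ tendsto_const lim_inverse_n'[THEN filterlim_sequentially_Suc[THEN iffD2]]])
    show "\<forall>\<^sub>F k in sequentially. 0 \<le> \<epsilon> k" using \<epsilon> by (intro always_eventually) (auto simp: less_imp_le)
    show "\<forall>\<^sub>F k in sequentially. \<epsilon> k \<le> 1 / real (Suc k)" using \<epsilon> by (intro always_eventually) (auto simp: less_imp_le)
  qed
  then show ?thesis using that \<epsilon> by blast
qed

text \<open>Boundedness in a Stolz angle excludes poles in its interior near the vertex.\<close>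

lemma eventually_vertical_analytic:
  assumes w: "w nicely_meromorphic_on upper_half_plane" and lim: "(w \<longlongrightarrow> c) (nontangential w x)"
  shows "eventually (\<lambda>e. Complex x e \<in> analyticity_domain w) (at_right 0)"
proof -
  let ?C = "{z \<in> analyticity_domain w. \<bar>Re z - x\<bar> \<le> 1 * Im z}"
  have "at (of_real x) within ?C \<le> nontangential w x"
    unfolding nontangential_def
    by (rule SUP_upper[of 1 "{0<..}" "\<lambda>\<alpha>. at (of_real x) within {z \<in> analyticity_domain w. \<bar>Re z - x\<bar> \<le> \<alpha> * Im z}"]) simp
  then have "(w \<longlongrightarrow> c) (at (of_real x) within ?C)"
    using lim by (rule filterlim_mono[OF _ order_refl, rotated])
  then have "eventually (\<lambda>z. dist (w z) c < 1) (at (of_real x) within ?C)"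
    by (rule tendstoD) simp
  then obtain d where d: "d > 0"
      "\<And>z. z \<in> ?C \<Longrightarrow> z \<noteq> of_real x \<Longrightarrow> dist z (of_real x) < d \<Longrightarrow> dist (w z) c < 1"
    unfolding eventually_at by blast
  have "Complex x e \<in> analyticity_domain w" if e: "0 < e" "e < d" for e
  proof -
    define z where "z = Complex x e"
    have z: "z \<in> upper_half_plane" using e by (simp add: z_def upper_half_plane_def)
    have "\<not> is_pole w z"
    proof
      assume "is_pole w z"
      then have pole: "filterlim w at_infinity (at z)" by (simp add: is_pole_def)
      have "eventually (\<lambda>z. cmod c + 1 < norm (w z)) (at z)"
        using pole unfolding filterlim_at_infinity_imp_norm_at_top
        by (metis filterlim_at_infinity_imp_norm_at_top filterlim_at_top_dense)
      moreover have "eventually (\<lambda>z. w analytic_on {z}) (at z)"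
      proof -
        have "isolated_singularity_at w z"
          using w z by (auto simp: nicely_meromorphic_on_def meromorphic_on_altdef)
        then obtain r where r: "r > 0" "w analytic_on ball z r - {z}"
          by (auto simp: isolated_singularity_at_def)
        have "eventually (\<lambda>w. w \<in> ball z r - {z}) (at z)"
          using r by (intro eventually_at_in_open) auto
        then show ?thesis
          by eventually_elim (use r(2) analytic_on_subset in blast)
      qed
      moreover have "eventually (\<lambda>z. z \<in> {z. Im z > 0} \<inter> {z. \<bar>Re z - x\<bar> < Im z} \<inter> ball (of_real x) d) (at z)"
      proof -
        have "dist (of_real x) z < d" using e by (simp add: z_def dist_norm cmod_def)
        moreover have "open ({z. Im z > 0} \<inter> {z. \<bar>Re z - x\<bar> < Im z} \<inter> ball (of_real x) d)"
          by (intro open_Int open_ball open_Collect_less continuous_intros)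
        ultimately show ?thesis
          using e by (intro eventually_at_in_open') (auto simp: z_def)
      qed
      ultimately have "eventually (\<lambda>z. False) (at z)"
      proof eventually_elim
        case (elim y)
        then have "y \<in> ?C" "y \<noteq> of_real x" "dist y (of_real x) < d"
          by (auto simp: analyticity_domain_def upper_half_plane_def dist_commute)
        then have "dist (w y) c < 1" by (rule d(2))
        moreover have "norm (w y) \<le> cmod c + dist (w y) c"
          using norm_triangle_ineq[of c "w y - c"] by (simp add: dist_norm)
        ultimately show ?case using elim(1) by simp
      qed
      then show False by simp
    qed
    then have "w analytic_on {z}"
      using w z by (rule nicely_meromorphic_on_imp_analytic_at[rotated 2])
    then show ?thesis using z by (simp add: analyticity_domain_def z_def)
  qed
  then show ?thesis
    unfolding eventually_at_right_field using d(1) by blast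
qed

section \<open>Kernel limits at the nodes\<close>

lemma nevanlinna_kernel_vertical:
  "e > 0 \<Longrightarrow> nevanlinna_kernel w (Complex x e) (Complex x e) = of_real (Im (w (Complex x e)) / e)"
  unfolding nevanlinna_kernel_def complex_diff_cnj by simp

text \<open>On the vertical line the diagonal of the kernel is Im w / e, and Im w has derivative Re
  w' in \<open>e\<close>. Since the limit of \<open>w\<close> is real, l'Hopital's rule applies; it
  needs analyticity at all small heights, not just along a sequence.\<close>

lemma regular_kernel_limit:
  assumes w: "w nicely_meromorphic_on upper_half_plane"
    and a: "(w \<longlongrightarrow> of_real a) (nontangential w x)" and d: "(deriv w \<longlongrightarrow> of_real d) (nontangential w x)"
  shows "((\<lambda>e. nevanlinna_kernel w (Complex x e) (Complex x e)) \<longlongrightarrow> of_real d) (at_right 0)"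
proof -
  have an: "eventually (\<lambda>e. Complex x e \<in> analyticity_domain w) (at_right 0)"
    by (rule eventually_vertical_analytic[OF w a])
  have pos: "eventually (\<lambda>e::real. e > 0) (at_right 0)"
    by (simp add: eventually_at_right_less)
  have vert: "filterlim (\<lambda>e. Complex x e) (nontangential w x) (at_right 0)"
    by (rule filterlim_vertical) (auto intro: eventually_conj[OF pos an] tendsto_ident_at)
  have "((\<lambda>e. Im (w (Complex x e)) / e) \<longlongrightarrow> d) (at_right 0)"
  proof (rule lhopital_right_0[where f' = "\<lambda>e. Re (deriv w (Complex x e))" and g' = "\<lambda>_. 1"])
    show "((\<lambda>e. Im (w (Complex x e))) \<longlongrightarrow> 0) (at_right 0)"
      using tendsto_Im[OF filterlim_compose[OF a vert]] by simp
    show "((\<lambda>e. Re (deriv w (Complex x e)) / 1) \<longlongrightarrow> d) (at_right 0)"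
      using tendsto_Re[OF filterlim_compose[OF d vert]] by simp
    show "\<forall>\<^sub>F e in at_right 0. ((\<lambda>e. Im (w (Complex x e))) has_real_derivative Re (deriv w (Complex x e))) (at e)"
      using an
    proof eventually_elim
      case (elim e)
      have "w field_differentiable at (Complex x e)"
        using elim by (auto simp: analyticity_domain_def intro: analytic_on_imp_differentiable_at)
      then have "(w has_field_derivative deriv w (Complex x e)) (at (Complex x e))"
        by (rule DERIV_deriv_iff_field_differentiable[THEN iffD2])
      moreover have "((\<lambda>e. Complex x e) has_vector_derivative \<i>) (at e)"
      proof -
        have "((\<lambda>e. of_real x + of_real e * \<i>) has_vector_derivative \<i>) (at e)"
          by (auto intro!: derivative_eq_intros)
        moreover have "(\<lambda>e. of_real x + of_real e * \<i>) = Complex x"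
          by (auto simp: complex_eq_iff)
        ultimately show ?thesis by simp
      qed
      ultimately have "((\<lambda>e. w (Complex x e)) has_vector_derivative (\<i> * deriv w (Complex x e))) (at e)"
        using field_vector_diff_chain_at[of "\<lambda>e. Complex x e" \<i> e w] by (simp add: o_def)
      then have "((\<lambda>e. Im (w (Complex x e))) has_vector_derivative Im (\<i> * deriv w (Complex x e))) (at e)"
        by (rule bounded_linear.has_vector_derivative[OF bounded_linear_Im])
      then show ?case by (simp add: has_real_derivative_iff_has_vector_derivative)
    qed
  qed (auto intro: tendsto_ident_at eventually_mono[OF pos])
  then have "((\<lambda>e. complex_of_real (Im (w (Complex x e)) / e)) \<longlongrightarrow> of_real d) (at_right 0)"
    by (rule tendsto_of_real)
  then show ?thesis
    by (rule Lim_transform_eventually) (use pos in eventually_elim, simp add: nevanlinna_kernel_vertical)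
qed

text \<open>At a node the data become the pair \<open>(e, c)\<close>, namely \<open>(1, a)\<close> at a regular and \<open>(0, \<xi>)\<close> at a
  singular one: a point of the projective line, interpolated by \<open>w\<close> after scaling with \<open>s\<close>.\<close>

lemma regular_node_sequence:
  assumes w: "w nicely_meromorphic_on upper_half_plane" and r: "regular_condition w x a g"
  shows "\<exists>z s p. (\<forall>k. z k \<in> analyticity_domain w) \<and> z \<longlonglongrightarrow> of_real x \<and> s \<longlonglongrightarrow> 1 \<and>
    (\<lambda>k. s k * w (z k)) \<longlonglongrightarrow> of_real a \<and>
    (\<lambda>k. s k * cnj (s k) * nevanlinna_kernel w (z k) (z k)) \<longlonglongrightarrow> of_real p \<and> p \<le> g"
proof -
  obtain d where a: "(w \<longlongrightarrow> of_real a) (nontangential w x)"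
    and d: "(deriv w \<longlongrightarrow> of_real d) (nontangential w x)" "d \<le> g"
    using r by (auto simp: regular_condition_def)
  obtain \<epsilon> :: "nat \<Rightarrow> real" where \<epsilon>: "\<And>k. \<epsilon> k > 0" "\<And>k. Complex x (\<epsilon> k) \<in> analyticity_domain w" "\<epsilon> \<longlonglongrightarrow> 0"
    using exists_vertical_sequence w unfolding nicely_meromorphic_on_def by blast
  define z where "z k = Complex x (\<epsilon> k)" for k
  have "filterlim z (nontangential w x) sequentially"
    unfolding z_def by (rule filterlim_vertical) (use \<epsilon> in auto)
  then have 1: "(\<lambda>k. w (z k)) \<longlonglongrightarrow> of_real a"
    by (rule filterlim_compose[OF a])
  have "filterlim \<epsilon> (at_right 0) sequentially"
    using \<epsilon>(1,3) by (simp add: filterlim_at less_imp_neq[THEN not_sym])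
  then have 2: "(\<lambda>k. nevanlinna_kernel w (z k) (z k)) \<longlonglongrightarrow> of_real d"
    unfolding z_def by (rule filterlim_compose[OF regular_kernel_limit[OF w a d(1)]])
  have "(\<lambda>k. Complex x (\<epsilon> k)) \<longlonglongrightarrow> Complex x 0"
    by (intro tendsto_Complex tendsto_const \<epsilon>)
  then have 3: "z \<longlonglongrightarrow> of_real x"
    by (simp add: z_def[abs_def] complex_of_real_def)
  show ?thesis
    by (rule exI[of _ z], rule exI[of _ "\<lambda>_. 1"], rule exI[of _ d]) (use 1 2 3 \<epsilon> d(2) in \<open>auto simp: z_def[symmetric]\<close>)
qed

text \<open>Scaling by \<xi> / w turns the growing values into \<xi>. With g = (z - x) w the scaled
  diagonal of the kernel is -\<xi>^2 Re (1/g), so the bound on its limit is the singular condition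
  multiplied by \<xi>^2.\<close>

lemma singular_node_sequence:
  assumes w: "w nicely_meromorphic_on upper_half_plane" and r: "singular_condition w x \<xi>" and \<xi>: "\<xi> \<noteq> 0"
  shows "\<exists>z s p. (\<forall>k. z k \<in> analyticity_domain w) \<and> z \<longlonglongrightarrow> of_real x \<and> s \<longlonglongrightarrow> 0 \<and>
    (\<lambda>k. s k * w (z k)) \<longlonglongrightarrow> of_real \<xi> \<and>
    (\<lambda>k. s k * cnj (s k) * nevanlinna_kernel w (z k) (z k)) \<longlonglongrightarrow> of_real p \<and> p \<le> - \<xi>"
proof -
  obtain \<epsilon> :: "nat \<Rightarrow> real" where \<epsilon>: "\<And>k. \<epsilon> k > 0" "\<And>k. Complex x (\<epsilon> k) \<in> analyticity_domain w" "\<epsilon> \<longlonglongrightarrow> 0"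
    using exists_vertical_sequence w unfolding nicely_meromorphic_on_def by blast
  define z where "z k = Complex x (\<epsilon> k)" for k
  have zx: "z k - of_real x = \<i> * of_real (\<epsilon> k)" for k
    by (simp add: z_def complex_eq_iff)
  have z: "filterlim z (nontangential w x) sequentially"
    unfolding z_def by (rule filterlim_vertical) (use \<epsilon> in auto)
  define g where "g k = (z k - of_real x) * w (z k)" for k
  have "\<exists>q. (\<lambda>k. inverse (g k)) \<longlonglongrightarrow> of_real q \<and> 1 / \<xi> \<le> q \<and> eventually (\<lambda>k. g k \<noteq> 0) sequentially"
    using r unfolding singular_condition_def
  proof (elim disjE exE conjE)
    fix c assume c: "((\<lambda>z. (z - of_real x) * w z) \<longlongrightarrow> of_real c) (nontangential w x)" "c \<noteq> 0" "- 1 / c \<le> - 1 / \<xi>"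
    have g: "g \<longlonglongrightarrow> of_real c"
      unfolding g_def[abs_def] by (rule filterlim_compose[OF c(1) z])
    then have "(\<lambda>k. inverse (g k)) \<longlonglongrightarrow> inverse (of_real c)"
      using c(2) by (intro tendsto_inverse) auto
    moreover have "eventually (\<lambda>k. g k \<noteq> 0) sequentially"
      using tendsto_imp_eventually_ne[OF g] c(2) by simp
    ultimately show ?thesis using c(3)
      by (intro exI[of _ "1 / c"]) (auto simp: inverse_eq_divide)
  next
    assume c: "filterlim (\<lambda>z. (z - of_real x) * w z) at_infinity (nontangential w x)" "0 \<le> - 1 / \<xi>"
    have g: "filterlim g at_infinity sequentially"
      unfolding g_def[abs_def] by (rule filterlim_compose[OF c(1) z])
    then have "(\<lambda>k. inverse (g k)) \<longlonglongrightarrow> 0"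
      by (rule filterlim_compose[OF tendsto_inverse_0])
    moreover have "eventually (\<lambda>k. g k \<noteq> 0) sequentially"
      using g by (rule filterlim_at_infinity_imp_eventually_ne)
    ultimately show ?thesis using c(2)
      by (intro exI[of _ 0]) auto
  qed
  then obtain q where q: "(\<lambda>k. inverse (g k)) \<longlonglongrightarrow> of_real q" "1 / \<xi> \<le> q" "eventually (\<lambda>k. g k \<noteq> 0) sequentially"
    by blast
  \<comment> \<open>This is \<xi> / w (z k) when \<open>g k\<close> is nonzero, written through 1/g,
    which converges also when g tends to infinity.\<close>
  define s where "s k = of_real \<xi> * (\<i> * of_real (\<epsilon> k)) * inverse (g k)" for k
  have "s \<longlonglongrightarrow> of_real \<xi> * (\<i> * of_real 0) * of_real q"
    unfolding s_def by (intro tendsto_intros \<epsilon> q)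
  then have s: "s \<longlonglongrightarrow> 0" by simp
  have sw: "(\<lambda>k. s k * w (z k)) \<longlonglongrightarrow> of_real \<xi>"
  proof (rule Lim_transform_eventually[OF tendsto_const])
    show "\<forall>\<^sub>F k in sequentially. of_real \<xi> = s k * w (z k)"
      using q(3)
    proof eventually_elim
      case (elim k)
      have "s k * w (z k) = of_real \<xi> * (g k * inverse (g k))"
        unfolding s_def g_def zx by (simp add: mult_ac)
      then show ?case using elim by simp
    qed
  qed
  have "(\<lambda>k. of_real (- (\<xi>\<^sup>2) * Re (inverse (g k)))) \<longlonglongrightarrow> complex_of_real (- (\<xi>\<^sup>2) * Re (of_real q))"
    by (intro tendsto_intros q)
  moreover have "s k * cnj (s k) * nevanlinna_kernel w (z k) (z k) = of_real (- (\<xi>\<^sup>2) * Re (inverse (g k)))"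
    for k
  proof -
    have im: "Im (w (z k)) / \<epsilon> k = - Re (g k) / (\<epsilon> k)\<^sup>2"
      using \<epsilon>(1)[of k] unfolding g_def zx by (simp add: power2_eq_square)
    have "s k * cnj (s k) = of_real (\<xi>\<^sup>2 * (\<epsilon> k)\<^sup>2 * (cmod (inverse (g k)))\<^sup>2)"
      unfolding s_def complex_norm_square[symmetric] by (simp add: norm_mult power_mult_distrib)
    then have "s k * cnj (s k) * nevanlinna_kernel w (z k) (z k) =
        of_real (\<xi>\<^sup>2 * (\<epsilon> k)\<^sup>2 * (cmod (inverse (g k)))\<^sup>2 * (- Re (g k) / (\<epsilon> k)\<^sup>2))"
      using nevanlinna_kernel_vertical[OF \<epsilon>(1), of w x k] unfolding z_def[symmetric] im by simp
    also have "\<xi>\<^sup>2 * (\<epsilon> k)\<^sup>2 * (cmod (inverse (g k)))\<^sup>2 * (- Re (g k) / (\<epsilon> k)\<^sup>2) =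
        - (\<xi>\<^sup>2) * (Re (g k) * (cmod (inverse (g k)))\<^sup>2)"
      using \<epsilon>(1)[of k] by (simp add: field_simps)
    also have "Re (g k) * (cmod (inverse (g k)))\<^sup>2 = Re (inverse (g k))"
      by (simp add: norm_inverse power_inverse cmod_power2 divide_inverse)
    finally show ?thesis .
  qed
  ultimately have K: "(\<lambda>k. s k * cnj (s k) * nevanlinna_kernel w (z k) (z k)) \<longlonglongrightarrow> of_real (- (\<xi>\<^sup>2) * q)"
    by simp
  have "\<xi>\<^sup>2 * (1 / \<xi>) \<le> \<xi>\<^sup>2 * q"
    by (intro mult_left_mono q(2)) simp
  then have le: "- (\<xi>\<^sup>2) * q \<le> - \<xi>"
    using \<xi> by (simp add: power2_eq_square)
  have "(\<lambda>k. Complex x (\<epsilon> k)) \<longlonglongrightarrow> Complex x 0"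
    by (intro tendsto_Complex tendsto_const \<epsilon>)
  then have zl: "z \<longlonglongrightarrow> of_real x"
    by (simp add: z_def[abs_def] complex_of_real_def)
  have "z k \<in> analyticity_domain w" for k using \<epsilon>(2) by (simp add: z_def)
  then show ?thesis using zl s sw K le by blast
qed

section \<open>The Pick matrix\<close>

definition pick_entry ::
  "nat \<Rightarrow> (nat \<Rightarrow> real) \<Rightarrow> (nat \<Rightarrow> real) \<Rightarrow> (nat \<Rightarrow> real) \<Rightarrow> (nat \<Rightarrow> real) \<Rightarrow> nat \<Rightarrow> nat \<Rightarrow> real" where
  "pick_entry l x a g \<xi> i j =
     (if i < l \<and> j < l then (if i = j then g i else (a j - a i) / (x j - x i))
      else if i < l then \<xi> j / (x j - x i)
      else if j < l then \<xi> i / (x i - x j)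
      else if i = j then - \<xi> i else 0)"

lemma pick_matrix_eq: "pick_matrix n l x a g \<xi> = Matrix.mat n n (\<lambda>(i, j). pick_entry l x a g \<xi> i j)"
  by (simp add: pick_matrix_def pick_entry_def)

lemma pick_entry_commute: "pick_entry l x a g \<xi> i j = pick_entry l x a g \<xi> j i"
proof -
  have "(a j - a i) / (x j - x i) = (a i - a j) / (x i - x j)"
    by (metis minus_diff_eq minus_divide_divide)
  then show ?thesis by (simp add: pick_entry_def)
qed

lemma hermitian_of_real:
  assumes "\<And>i j. A i j = A j i"
  shows "hermitian n (\<lambda>i j. complex_of_real (A i j))"
  unfolding hermitian_def using assms by (metis complex_cnj_complex_of_real)

abbreviation pick_kernel ::
  "nat \<Rightarrow> (nat \<Rightarrow> real) \<Rightarrow> (nat \<Rightarrow> real) \<Rightarrow> (nat \<Rightarrow> real) \<Rightarrow> (nat \<Rightarrow> real) \<Rightarrow> nat \<Rightarrow> nat \<Rightarrow> complex" where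
  "pick_kernel l x a g \<xi> \<equiv> \<lambda>i j. of_real (pick_entry l x a g \<xi> i j)"

lemma hermitian_pick_kernel: "hermitian n (pick_kernel l x a g \<xi>)"
  by (rule hermitian_of_real) (rule pick_entry_commute)

lemma pick_negative_squares_eq: "pick_negative_squares n l x a g \<xi> = neg_index n (pick_kernel l x a g \<xi>)"
proof -
  have "map_mat complex_of_real (pick_matrix n l x a g \<xi>) = Matrix.mat n n (\<lambda>(i, j). pick_kernel l x a g \<xi> i j)"
    unfolding pick_matrix_eq by (intro eq_matI) auto
  then show ?thesis by (simp add: pick_negative_squares_def neg_index_def)
qed

definition node_den :: "nat \<Rightarrow> nat \<Rightarrow> real" where
  "node_den l i = (if i < l then 1 else 0)"

definition node_num :: "nat \<Rightarrow> (nat \<Rightarrow> real) \<Rightarrow> (nat \<Rightarrow> real) \<Rightarrow> nat \<Rightarrow> real" where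
  "node_num l a \<xi> i = (if i < l then a i else \<xi> i)"

text \<open>In homogeneous coordinates the regular, mixed and singular entries are one divided
  difference, which frees the limit argument and the displacement identity from case splits.\<close>

lemma pick_entry_off_diagonal:
  assumes "i \<noteq> j"
  shows "pick_entry l x a g \<xi> i j =
    (node_num l a \<xi> j * node_den l i - node_den l j * node_num l a \<xi> i) / (x j - x i)"
proof -
  have "\<xi> i / (x i - x j) = - \<xi> i / (x j - x i)"
    by (metis minus_diff_eq minus_divide_divide minus_minus)
  then show ?thesis
    using assms by (simp add: pick_entry_def node_den_def node_num_def)
qed

lemma interpolates_at_node_sequence:
  assumes w: "w nicely_meromorphic_on upper_half_plane" and i: "interpolates_at l x a g \<xi> w i"
    and \<xi>: "l \<le> i \<Longrightarrow> \<xi> i \<noteq> 0"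
  shows "\<exists>z s p. (\<forall>k. z k \<in> analyticity_domain w) \<and> z \<longlonglongrightarrow> of_real (x i) \<and>
    s \<longlonglongrightarrow> of_real (node_den l i) \<and> (\<lambda>k. s k * w (z k)) \<longlonglongrightarrow> of_real (node_num l a \<xi> i) \<and>
    (\<lambda>k. s k * cnj (s k) * nevanlinna_kernel w (z k) (z k)) \<longlonglongrightarrow> of_real p \<and>
    p \<le> pick_entry l x a g \<xi> i i"
proof (cases "i < l")
  case True
  then show ?thesis
    using regular_node_sequence[OF w, of "x i" "a i" "g i"] i
    by (simp add: interpolates_at_def node_den_def node_num_def pick_entry_def)
next
  case False
  then show ?thesis
    using singular_node_sequence[OF w, of "x i" "\<xi> i"] i \<xi>
    by (simp add: interpolates_at_def node_den_def node_num_def pick_entry_def)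
qed

lemma hermitian_nevanlinna_kernel: "hermitian n (\<lambda>i j. nevanlinna_kernel w (z j) (z i))"
  unfolding hermitian_def
proof (intro allI impI)
  fix i j
  have "cnj (nevanlinna_kernel w (z j) (z i)) = (cnj (w (z j)) - w (z i)) / (cnj (z j) - z i)"
    by (simp add: nevanlinna_kernel_def)
  also have "\<dots> = nevanlinna_kernel w (z i) (z j)"
    unfolding nevanlinna_kernel_def by (metis minus_diff_eq minus_divide_divide)
  finally show "nevanlinna_kernel w (z i) (z j) = cnj (nevanlinna_kernel w (z j) (z i))" ..
qed

lemma neg_index_scaled:
  assumes A: "hermitian n A"
  shows "hermitian n (\<lambda>i j. s j * cnj (s i) * A i j)"
    and "neg_index n (\<lambda>i j. s j * cnj (s i) * A i j) \<le> neg_index n A"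
proof -
  let ?B = "\<lambda>i j. s j * cnj (s i) * A i j"
  show B: "hermitian n ?B"
    unfolding hermitian_def
  proof (intro allI impI)
    fix i j assume "i < n" "j < n"
    then have "A j i = cnj (A i j)" using A unfolding hermitian_def by blast
    then show "?B j i = cnj (?B i j)" by simp
  qed
  show "neg_index n ?B \<le> neg_index n A"
  proof (rule neg_index_mono[where T = "\<lambda>j i. if i = j then s j else 0", OF B A])
    fix v :: "nat \<Rightarrow> complex"
    have *: "(\<Sum>i<n. (if i = j then s j else 0) * v i) = s j * v j" if "j < n" for j
    proof -
      have "(\<Sum>i<n. (if i = j then s j else 0) * v i) = (\<Sum>i<n. if i = j then s j * v j else 0)"
        by (intro sum.cong) auto
      then show ?thesis using that by simp
    qed
    have "qform n A (\<lambda>j. \<Sum>i<n. (if i = j then s j else 0) * v i) = qform n A (\<lambda>j. s j * v j)"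
      using * by (simp add: qform_def inner_prod_def mat_app_def)
    also have "\<dots> = qform n ?B v"
      by (simp add: qform_def inner_prod_def mat_app_def sum_distrib_left mult_ac)
    finally show "qform n A (\<lambda>j. \<Sum>i<n. (if i = j then s j else 0) * v i) \<le> qform n ?B v" by simp
  qed
qed

lemma neg_index_restr_empty: "neg_index n (restr {} A) = 0"
proof -
  have "neg_index n (restr {} A) \<le> 0"
    by (rule neg_index_leI) (auto simp: hermitian_def restr_def qform_def inner_prod_def mat_app_def)
  then show ?thesis by simp
qed

text \<open>The kernel matrices at points approaching the nodes, scaled at the singular nodes, converge to
  a matrix that differs from the Pick matrix by a nonnegative diagonal.\<close>

lemma interpolation_neg_index_le:
  assumes w: "w nicely_meromorphic_on upper_half_plane"
    and bound: "\<And>m z. m \<ge> 1 \<Longrightarrow> (\<And>i. i < m \<Longrightarrow> z i \<in> analyticity_domain w) \<Longrightarrow>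
      sq_neg (kernel_matrix w m z) \<le> \<kappa>"
    and data: "interpolation_data n l x \<xi>" and S: "S \<subseteq> {..<n}"
    and int: "\<And>i. i \<in> S \<Longrightarrow> interpolates_at l x a g \<xi> w i"
  shows "neg_index n (restr S (pick_kernel l x a g \<xi>)) \<le> \<kappa>"
proof (cases "S = {}")
  case True
  then show ?thesis by (simp add: neg_index_restr_empty)
next
  case False
  then obtain i0 where i0: "i0 \<in> S" by blast
  let ?P = "pick_kernel l x a g \<xi>"
  define Q where "Q i z s p \<longleftrightarrow> (\<forall>k. z k \<in> analyticity_domain w) \<and> z \<longlonglongrightarrow> of_real (x i) \<and>
    s \<longlonglongrightarrow> of_real (node_den l i) \<and> (\<lambda>k. s k * w (z k)) \<longlonglongrightarrow> of_real (node_num l a \<xi> i) \<and>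
    (\<lambda>k. s k * cnj (s k) * nevanlinna_kernel w (z k) (z k)) \<longlonglongrightarrow> of_real p \<and>
    p \<le> pick_entry l x a g \<xi> i i" for i z s p
  have "\<exists>z s p. Q i z s p" if i: "i \<in> S" for i
    unfolding Q_def using i S data
    by (intro interpolates_at_node_sequence[OF w int]) (auto simp: interpolation_data_def)
  then obtain z s p where Q: "\<And>i. i \<in> S \<Longrightarrow> Q i (z i) (s i) (p i)"
    by metis
  note zsp = Q[unfolded Q_def]
  \<comment> \<open>Outside \<open>S\<close> the points of node \<open>i0\<close> are mere
    placeholders in the domain of analyticity; the factor \<open>\<sigma> = 0\<close> erases their
    rows and columns.\<close>
  define \<zeta> where "\<zeta> k i = (if i \<in> S then z i k else z i0 k)" for k i
  define \<sigma> where "\<sigma> k i = (if i \<in> S then s i k else 0)" for k i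
  define M where "M k = (\<lambda>i j. \<sigma> k j * cnj (\<sigma> k i) * nevanlinna_kernel w (\<zeta> k j) (\<zeta> k i))" for k
  \<comment> \<open>The slack in the inequality at node \<open>i\<close>, nonnegative by the choice
    of \<open>p\<close>.\<close>
  define D where "D i = (if i \<in> S then pick_entry l x a g \<xi> i i - p i else 0)" for i
  have n: "n \<ge> 1" using i0 S by auto
  have M\<kappa>: "neg_index n (M k) \<le> \<kappa>" for k
  proof -
    have "neg_index n (M k) \<le> neg_index n (\<lambda>i j. nevanlinna_kernel w (\<zeta> k j) (\<zeta> k i))"
      unfolding M_def by (rule neg_index_scaled(2)[OF hermitian_nevanlinna_kernel])
    also have "\<dots> = sq_neg (kernel_matrix w n (\<zeta> k))"
      by (simp add: neg_index_def kernel_matrix_def)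
    also have "\<dots> \<le> \<kappa>"
      using n zsp i0 by (intro bound) (auto simp: \<zeta>_def)
    finally show ?thesis .
  qed
  have "eventually (\<lambda>k. neg_index n (restr S (diag_sub ?P D)) \<le> neg_index n (M k)) sequentially"
  proof (rule neg_index_lower_semicontinuous)
    show "hermitian n (restr S (diag_sub ?P D))"
      by (intro hermitian_restr hermitian_diag_sub hermitian_pick_kernel)
    show "eventually (\<lambda>k. hermitian n (M k)) sequentially"
      unfolding M_def by (intro always_eventually allI neg_index_scaled(1)[OF hermitian_nevanlinna_kernel])
    fix i j assume ij: "i < n" "j < n"
    show "(\<lambda>k. M k i j) \<longlonglongrightarrow> restr S (diag_sub ?P D) i j"
    proof (cases "i \<in> S \<and> j \<in> S")
      case False
      then have "(\<lambda>k. M k i j) = (\<lambda>_. 0)" "restr S (diag_sub ?P D) i j = 0"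
        by (auto simp: M_def \<sigma>_def restr_def)
      then show ?thesis by simp
    next
      case True
      show ?thesis
      proof (cases "i = j")
        case eq: True
        have "restr S (diag_sub ?P D) i j = of_real (p i)"
          using True eq by (simp add: restr_def diag_sub_def D_def)
        moreover have "(\<lambda>k. M k i j) = (\<lambda>k. s i k * cnj (s i k) * nevanlinna_kernel w (z i k) (z i k))"
          using True eq by (simp add: M_def \<sigma>_def \<zeta>_def)
        ultimately show ?thesis using zsp True by simp
      next
        case neq: False
        have xne: "x j \<noteq> x i"
          using data ij neq by (auto simp: interpolation_data_def inj_on_def)
        \<comment> \<open>The scalings are distributed so that \<open>w\<close> occurs only in
          products \<open>s * w\<close>: at a singular node \<open>w\<close> itself need not
          converge.\<close>
        have "(\<lambda>k. (s j k * w (z j k) * cnj (s i k) - s j k * cnj (s i k * w (z i k))) / (z j k - cnj (z i k)))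
          \<longlonglongrightarrow> (of_real (node_num l a \<xi> j) * cnj (of_real (node_den l i)) -
            of_real (node_den l j) * cnj (of_real (node_num l a \<xi> i))) / (of_real (x j) - cnj (of_real (x i)))"
          using zsp[of i] zsp[of j] True xne by (intro tendsto_intros) auto
        moreover have "(\<lambda>k. (s j k * w (z j k) * cnj (s i k) - s j k * cnj (s i k * w (z i k))) / (z j k - cnj (z i k)))
          = (\<lambda>k. M k i j)"
          using True by (auto simp: M_def \<sigma>_def \<zeta>_def nevanlinna_kernel_def fun_eq_iff algebra_simps)
        moreover have "(of_real (node_num l a \<xi> j) * cnj (of_real (node_den l i)) -
            of_real (node_den l j) * cnj (of_real (node_num l a \<xi> i))) / (of_real (x j) - cnj (of_real (x i)))
          = restr S (diag_sub ?P D) i j"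
          using True neq by (simp add: restr_def diag_sub_def pick_entry_off_diagonal)
        ultimately show ?thesis by simp
      qed
    qed
  qed
  then obtain k where "neg_index n (restr S (diag_sub ?P D)) \<le> neg_index n (M k)"
    using eventually_happens' sequentially_bot by blast
  then have "neg_index n (restr S (diag_sub ?P D)) \<le> \<kappa>" using M\<kappa>[of k] by simp
  moreover have "neg_index n (restr S ?P) \<le> neg_index n (restr S (diag_sub ?P D))"
  proof (intro neg_index_antimono_qform hermitian_restr hermitian_diag_sub hermitian_pick_kernel)
    fix v
    have "0 \<le> (\<Sum>j<n. D j * (cmod (if j \<in> S then v j else 0))\<^sup>2)"
      using zsp by (intro sum_nonneg mult_nonneg_nonneg) (auto simp: D_def)
    then show "qform n (restr S (diag_sub ?P D)) v \<le> qform n (restr S ?P) v"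
      unfolding qform_restr qform_diag_sub by linarith
  qed
  ultimately show ?thesis by simp
qed

lemma gen_nevanlinna_unique:
  assumes "w \<in> gen_nevanlinna \<kappa>" "w \<in> gen_nevanlinna \<kappa>'"
  shows "\<kappa> = \<kappa>'"
proof -
  have "\<kappa>1 \<le> \<kappa>2" if "w \<in> gen_nevanlinna \<kappa>1" "w \<in> gen_nevanlinna \<kappa>2" for \<kappa>1 \<kappa>2
    using that unfolding gen_nevanlinna_def by blast
  then show ?thesis using assms by (intro antisym)
qed

section \<open>Functions with a factorizing kernel\<close>

lemma tendsto_nevanlinna_kernel:
  assumes "z0 \<in> analyticity_domain w" "\<zeta>0 \<in> analyticity_domain w"
    and "(z \<longlongrightarrow> z0) F" "(\<zeta> \<longlongrightarrow> \<zeta>0) F"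
  shows "((\<lambda>t. nevanlinna_kernel w (z t) (\<zeta> t)) \<longlongrightarrow> nevanlinna_kernel w z0 \<zeta>0) F"
proof -
  have "isCont w z0" "isCont w \<zeta>0"
    using assms(1,2) by (auto simp: analyticity_domain_def intro: analytic_at_imp_isCont)
  moreover have "z0 - cnj \<zeta>0 \<noteq> 0"
    using assms(1,2) by (auto simp: analyticity_domain_def upper_half_plane_def complex_eq_iff)
  ultimately show ?thesis
    unfolding nevanlinna_kernel_def
    by (intro tendsto_intros isCont_tendsto_compose[of _ w] assms)
qed

text \<open>Where the factorization holds, the kernel matrix is the congruence transform of
  \<open>Q\<close> by the values of \<open>F\<close>. Exceptional points, such as zeros of a
  denominator, are avoided by a small horizontal shift \<open>t\<close>, and lower semicontinuity
  brings the bound back to t = 0.\<close>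

lemma kernel_matrix_factorization_bound:
  assumes Q: "hermitian n Q"
    and G: "\<And>z. z \<in> upper_half_plane \<Longrightarrow> eventually G (at z)"
    and K: "\<And>z \<zeta>. G z \<Longrightarrow> G \<zeta> \<Longrightarrow>
      nevanlinna_kernel w z \<zeta> = (\<Sum>i<n. \<Sum>j<n. F z i * Q j i * cnj (F \<zeta> j))"
    and z: "\<And>i. i < m \<Longrightarrow> z i \<in> analyticity_domain w"
  shows "sq_neg (kernel_matrix w m z) \<le> neg_index n Q"
proof -
  define \<zeta> where "\<zeta> t i = z i + of_real t" for t :: real and i
  define M where "M t = (\<lambda>i j. nevanlinna_kernel w (\<zeta> t j) (\<zeta> t i))" for t
  have \<zeta>_lim: "((\<lambda>t. \<zeta> t i) \<longlongrightarrow> z i) (at_right 0)" for i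
  proof -
    have "((\<lambda>t. \<zeta> t i) \<longlongrightarrow> z i + of_real 0) (at_right 0)"
      unfolding \<zeta>_def by (intro tendsto_intros)
    then show ?thesis by simp
  qed
  have "eventually (\<lambda>t. neg_index m (\<lambda>i j. nevanlinna_kernel w (z j) (z i)) \<le> neg_index m (M t)) (at_right 0)"
    by (rule neg_index_lower_semicontinuous)
       (auto simp: M_def hermitian_nevanlinna_kernel intro!: tendsto_nevanlinna_kernel z \<zeta>_lim)
  moreover have "eventually (\<lambda>t. \<forall>i\<in>{..<m}. G (\<zeta> t i)) (at_right 0)"
  proof (intro eventually_ball_finite ballI)
    fix i assume "i \<in> {..<m}"
    then have "z i \<in> upper_half_plane" using z by (auto simp: analyticity_domain_def)
    moreover have "filterlim (\<lambda>t. \<zeta> t i) (at (z i)) (at_right 0)"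
      unfolding filterlim_at using \<zeta>_lim
      by (auto simp: \<zeta>_def eventually_at_filter)
    ultimately show "eventually (\<lambda>t. G (\<zeta> t i)) (at_right 0)"
      by (rule eventually_compose_filterlim[OF G])
  qed simp
  ultimately obtain t where t: "neg_index m (\<lambda>i j. nevanlinna_kernel w (z j) (z i)) \<le> neg_index m (M t)"
      "\<forall>i\<in>{..<m}. G (\<zeta> t i)"
    using eventually_happens'[OF trivial_limit_at_right_real eventually_conj] by blast
  have "neg_index m (M t) \<le> neg_index n Q"
  proof (rule neg_index_mono[where T = "\<lambda>j i. F (\<zeta> t i) j", OF _ Q])
    show "hermitian m (M t)" unfolding M_def by (rule hermitian_nevanlinna_kernel)
    fix v :: "nat \<Rightarrow> complex"
    have swap: "(\<Sum>j<m. \<Sum>a<n. \<Sum>b<n. g j a b) = (\<Sum>b<n. \<Sum>a<n. \<Sum>j<m. g j a b)"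
      for g :: "nat \<Rightarrow> nat \<Rightarrow> nat \<Rightarrow> complex"
    proof -
      have "(\<Sum>j<m. \<Sum>a<n. \<Sum>b<n. g j a b) = (\<Sum>j<m. \<Sum>b<n. \<Sum>a<n. g j a b)"
        by (intro sum.cong refl sum.swap)
      also have "\<dots> = (\<Sum>b<n. \<Sum>j<m. \<Sum>a<n. g j a b)"
        by (rule sum.swap)
      also have "\<dots> = (\<Sum>b<n. \<Sum>a<n. \<Sum>j<m. g j a b)"
        by (intro sum.cong refl sum.swap)
      finally show ?thesis .
    qed
    have "inner_prod m v (mat_app m (M t) v) =
        (\<Sum>i<m. \<Sum>j<m. cnj (v i) * ((\<Sum>a<n. \<Sum>b<n. F (\<zeta> t j) a * Q b a * cnj (F (\<zeta> t i) b)) * v j))"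
      unfolding inner_prod_def mat_app_def sum_distrib_left
      by (intro sum.cong refl) (use t(2) in \<open>simp add: M_def K\<close>)
    also have "\<dots> = (\<Sum>i<m. \<Sum>j<m. \<Sum>a<n. \<Sum>b<n. cnj (v i) * cnj (F (\<zeta> t i) b) * (Q b a * (F (\<zeta> t j) a * v j)))"
      by (simp add: sum_distrib_left sum_distrib_right mult_ac)
    also have "\<dots> = (\<Sum>i<m. \<Sum>b<n. \<Sum>a<n. \<Sum>j<m. cnj (v i) * cnj (F (\<zeta> t i) b) * (Q b a * (F (\<zeta> t j) a * v j)))"
      by (intro sum.cong refl swap)
    also have "\<dots> = (\<Sum>b<n. \<Sum>i<m. \<Sum>a<n. \<Sum>j<m. cnj (v i) * cnj (F (\<zeta> t i) b) * (Q b a * (F (\<zeta> t j) a * v j)))"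
      by (rule sum.swap)
    also have "\<dots> = inner_prod n (\<lambda>j. \<Sum>i<m. F (\<zeta> t i) j * v i) (mat_app n Q (\<lambda>j. \<Sum>i<m. F (\<zeta> t i) j * v i))"
      unfolding inner_prod_def mat_app_def cnj_sum complex_cnj_mult sum_product
      by (simp add: sum_distrib_left mult_ac)
    finally show "qform n Q (\<lambda>j. \<Sum>i<m. F (\<zeta> t i) j * v i) \<le> qform m (M t) v"
      by (simp add: qform_def)
  qed
  then show ?thesis
    using t(1) by (simp add: neg_index_def kernel_matrix_def)
qed

text \<open>The value \<kappa> must be attained: otherwise every kernel matrix would obey the bound
  \<kappa> - 1, and the limit argument would force the same bound on the Pick matrix restricted to
  \<open>S\<close>.\<close>

lemma gen_nevanlinnaI:
  assumes w: "w nicely_meromorphic_on upper_half_plane"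
    and bound: "\<And>m z. m \<ge> 1 \<Longrightarrow> (\<And>i. i < m \<Longrightarrow> z i \<in> analyticity_domain w) \<Longrightarrow>
      sq_neg (kernel_matrix w m z) \<le> \<kappa>"
    and data: "interpolation_data n l x \<xi>" and S: "S \<subseteq> {..<n}"
    and int: "\<And>i. i \<in> S \<Longrightarrow> interpolates_at l x a g \<xi> w i"
    and \<kappa>: "neg_index n (restr S (pick_kernel l x a g \<xi>)) = \<kappa>"
  shows "w \<in> gen_nevanlinna \<kappa>"
proof -
  have "\<exists>m\<ge>1. \<exists>z. (\<forall>i<m. z i \<in> analyticity_domain w) \<and> sq_neg (kernel_matrix w m z) = \<kappa>"
  proof (rule ccontr)
    assume no: "\<not> ?thesis"
    have less: "sq_neg (kernel_matrix w m z) < \<kappa>"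
      if "m \<ge> 1" "\<And>i. i < m \<Longrightarrow> z i \<in> analyticity_domain w" for m :: nat and z
      using bound[of m z] no that by (metis le_neq_implies_less)
    \<comment> \<open>A single evaluation point gives \<kappa> > 0, so that the truncated \<kappa> -
      1 is really smaller.\<close>
    obtain e where "Complex 0 e \<in> analyticity_domain w"
      using exists_vertical_analytic[of w 1 0] w by (auto simp: nicely_meromorphic_on_def)
    then have "\<kappa> > 0" using less[of 1 "\<lambda>_. Complex 0 e"] by simp
    moreover have "neg_index n (restr S (pick_kernel l x a g \<xi>)) \<le> \<kappa> - 1"
    proof (rule interpolation_neg_index_le[OF w _ data S int])
      fix m :: nat and z assume "1 \<le> m" "\<And>i. i < m \<Longrightarrow> z i \<in> analyticity_domain w"
      then have "sq_neg (kernel_matrix w m z) < \<kappa>" by (rule less)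
      then show "sq_neg (kernel_matrix w m z) \<le> \<kappa> - 1" by simp
    qed
    ultimately show False using \<kappa> by simp
  qed
  then show ?thesis
    unfolding gen_nevanlinna_def using w bound by blast
qed

section \<open>Sums of simple poles at real points\<close>

lemma nontangential_le_at: "nontangential w x \<le> at (of_real x)"
  unfolding nontangential_def by (intro SUP_least at_le) simp

definition pole_sum :: "nat \<Rightarrow> (nat \<Rightarrow> real) \<Rightarrow> (nat \<Rightarrow> real) \<Rightarrow> complex \<Rightarrow> complex" where
  "pole_sum n x q z = (\<Sum>j<n. of_real (q j) / (of_real (x j) - z))"

lemma pole_sum_analytic:
  assumes "\<And>j. j < n \<Longrightarrow> q j \<noteq> 0 \<Longrightarrow> of_real (x j) \<noteq> z"
  shows "pole_sum n x q analytic_on {z}"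
  unfolding pole_sum_def[abs_def]
proof (intro analytic_on_sum)
  fix j assume "j \<in> {..<n}"
  then show "(\<lambda>z. complex_of_real (q j) / (of_real (x j) - z)) analytic_on {z}"
    using assms[of j] by (cases "q j = 0") (auto intro!: analytic_intros)
qed

lemma pole_sum_meromorphic: "pole_sum n x q meromorphic_on A"
  unfolding pole_sum_def[abs_def] by (intro meromorphic_intros)

lemma pole_sum_split:
  assumes "i < n" "z \<noteq> of_real (x i)"
  shows "(of_real (x i) - z) * pole_sum n x q z =
    of_real (q i) + (of_real (x i) - z) * pole_sum n x (q(i := 0)) z"
proof -
  have "pole_sum n x q z = of_real (q i) / (of_real (x i) - z) + pole_sum n x (q(i := 0)) z"
    unfolding pole_sum_def using assms(1)
    by (subst (1 2) sum.remove[of _ i]) auto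
  then show ?thesis using assms(2) by (simp add: distrib_left)
qed

text \<open>Near \<open>x i\<close> the pole dominates, so the sum is nonzero somewhere, and the
  identity theorem on the connected complement of the poles does the rest. Only nodes with nonzero
  coefficient count as poles; the point \<open>z\<close> may be one of the other nodes.\<close>

lemma pole_sum_eventually_nonzero:
  assumes inj: "inj_on x {..<n}" and i: "i < n" "q i \<noteq> 0"
    and z: "\<And>j. j < n \<Longrightarrow> q j \<noteq> 0 \<Longrightarrow> of_real (x j) \<noteq> z"
  shows "eventually (\<lambda>z. pole_sum n x q z \<noteq> 0) (at z)"
proof -
  define X where "X = (\<lambda>j. complex_of_real (x j)) ` {j. j < n \<and> q j \<noteq> 0}"
  have fin: "finite X" by (simp add: X_def)
  define p where "p = complex_of_real (x i)"
  have "pole_sum n x (q(i := 0)) analytic_on {p}"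
    using inj i by (intro pole_sum_analytic) (auto simp: p_def inj_on_def split: if_splits)
  then have "isCont (pole_sum n x (q(i := 0))) p"
    by (rule analytic_at_imp_isCont)
  then have "((\<lambda>z. of_real (q i) + (p - z) * pole_sum n x (q(i := 0)) z) \<longlongrightarrow>
      of_real (q i) + (p - p) * pole_sum n x (q(i := 0)) p) (at p)"
    by (intro tendsto_intros) (simp add: isCont_def)
  then have "eventually (\<lambda>z. of_real (q i) + (p - z) * pole_sum n x (q(i := 0)) z \<noteq> 0) (at p)"
    using i by (intro tendsto_imp_eventually_ne) auto
  moreover have "eventually (\<lambda>z. z \<in> - (X - {p}) - {p}) (at p)"
    using fin by (intro eventually_at_in_open open_Compl finite_imp_closed) auto
  ultimately have "eventually (\<lambda>z. pole_sum n x q z \<noteq> 0 \<and> z \<notin> X) (at p)"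
  proof eventually_elim
    case (elim z)
    then have "(p - z) * pole_sum n x q z \<noteq> 0"
      using pole_sum_split[of i n z x q] i by (auto simp: p_def)
    then show ?case using elim by auto
  qed
  then obtain \<beta> where \<beta>: "pole_sum n x q \<beta> \<noteq> 0" "\<beta> \<notin> X"
    using eventually_happens by fastforce
  have "pole_sum n x q holomorphic_on - X"
    unfolding pole_sum_def[abs_def]
  proof (intro holomorphic_on_sum)
    fix j assume "j \<in> {..<n}"
    then show "(\<lambda>z. complex_of_real (q j) / (of_real (x j) - z)) holomorphic_on - X"
      by (cases "q j = 0") (auto intro!: holomorphic_intros simp: X_def)
  qed
  moreover have "connected (- X)"
    using connected_open_delete_finite[of UNIV X] fin by (simp add: Compl_eq_Diff_UNIV connected_UNIV)
  moreover have "open (- X)" using fin by (intro open_Compl finite_imp_closed)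
  moreover have "z \<in> - X" using z by (auto simp: X_def)
  ultimately show ?thesis
    using non_zero_neighbour_alt[of "pole_sum n x q" "- X" z \<beta>] \<beta>
    by (auto elim: eventually_mono)
qed

lemma cnj_pole_sum: "cnj (pole_sum n x q z) = pole_sum n x q (cnj z)"
  by (simp add: pole_sum_def)

section \<open>Quotients of sums of simple poles\<close>

text \<open>Put y = cnj \<zeta> and split x i - x j = (x i - z) - (x j - y) + (z - y). The first two
  parts cancel a pole each and sum to 0 because \<open>u\<close> is a null vector of
  \<open>R\<close>; the third supplies the factor z - y of the kernel's denominator. The factor
  \<open>u i * u j\<close> in \<open>disp\<close> confines the identity to active nodes.\<close>

lemma pole_quotient_kernel:
  fixes n :: nat and x u c e :: "nat \<Rightarrow> real" and R :: "nat \<Rightarrow> nat \<Rightarrow> real"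
  defines "A \<equiv> pole_sum n x (\<lambda>j. u j * c j)" and "B \<equiv> pole_sum n x (\<lambda>j. u j * e j)"
  assumes sym: "\<And>i j. R i j = R j i" and ker: "\<And>i. i < n \<Longrightarrow> (\<Sum>j<n. R i j * u j) = 0"
    and disp: "\<And>i j. i < n \<Longrightarrow> j < n \<Longrightarrow>
      u i * u j * (c i * e j - e i * c j) = u i * u j * ((x i - x j) * R i j)"
    and z: "z \<in> upper_half_plane" "\<zeta> \<in> upper_half_plane" and B0: "B z \<noteq> 0" "B \<zeta> \<noteq> 0"
  shows "nevanlinna_kernel (\<lambda>z. A z / B z) z \<zeta> =
    (\<Sum>i<n. \<Sum>j<n. of_real (u i) / ((of_real (x i) - z) * B z) * of_real (R j i) *
      cnj (of_real (u j) / ((of_real (x j) - \<zeta>) * B \<zeta>)))"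
proof -
  define y where "y = cnj \<zeta>"
  define \<alpha> \<beta> where "\<alpha> i = of_real (u i) / (of_real (x i) - z)" and "\<beta> i = of_real (u i) / (of_real (x i) - y)" for i
  have ne: "of_real (x i) - z \<noteq> 0" "of_real (x i) - y \<noteq> 0" "z - y \<noteq> 0" for i
    using z by (auto simp: upper_half_plane_def y_def complex_eq_iff)
  have B0': "B y \<noteq> 0"
    using B0(2) cnj_pole_sum[of n x "\<lambda>j. u j * e j" \<zeta>] unfolding B_def y_def
    by (metis complex_cnj_zero_iff)
  have A: "A z = (\<Sum>i<n. of_real (c i) * \<alpha> i)" "A y = (\<Sum>i<n. of_real (c i) * \<beta> i)"
    and B: "B z = (\<Sum>i<n. of_real (e i) * \<alpha> i)" "B y = (\<Sum>i<n. of_real (e i) * \<beta> i)"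
    by (simp_all add: A_def B_def pole_sum_def \<alpha>_def \<beta>_def mult.commute)
  have "A z * B y - B z * A y = (\<Sum>i<n. \<Sum>j<n. \<alpha> i * \<beta> j * of_real (c i * e j - e i * c j))"
    unfolding A B sum_product sum_subtractf[symmetric]
    by (intro sum.cong refl) (simp add: algebra_simps)
  also have "\<dots> = (\<Sum>i<n. \<Sum>j<n. of_real (R i j) * (of_real (u i) * \<beta> j)
      - of_real (R i j) * (\<alpha> i * of_real (u j)) + (z - y) * (of_real (R i j) * (\<alpha> i * \<beta> j)))"
  proof (intro sum.cong refl)
    fix i j assume ij: "i \<in> {..<n}" "j \<in> {..<n}"
    have "\<alpha> i * \<beta> j * of_real (c i * e j - e i * c j) =
        of_real (u i * u j * (c i * e j - e i * c j)) / ((of_real (x i) - z) * (of_real (x j) - y))"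
      by (simp add: \<alpha>_def \<beta>_def)
    also have "u i * u j * (c i * e j - e i * c j) = u i * u j * ((x i - x j) * R i j)"
      using ij by (intro disp) auto
    also have "of_real (u i * u j * ((x i - x j) * R i j)) / ((of_real (x i) - z) * (of_real (x j) - y)) =
        \<alpha> i * \<beta> j * (of_real (x i) - of_real (x j)) * of_real (R i j)"
      by (simp add: \<alpha>_def \<beta>_def)
    also have "\<alpha> i * \<beta> j * (of_real (x i) - of_real (x j)) =
        ((of_real (x i) - z) * \<alpha> i) * \<beta> j - \<alpha> i * ((of_real (x j) - y) * \<beta> j) + (z - y) * (\<alpha> i * \<beta> j)"
      by (simp add: algebra_simps)
    also have "(of_real (x i) - z) * \<alpha> i = of_real (u i)"
      using ne by (simp add: \<alpha>_def)
    also have "(of_real (x j) - y) * \<beta> j = of_real (u j)"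
      using ne by (simp add: \<beta>_def)
    finally show "\<alpha> i * \<beta> j * of_real (c i * e j - e i * c j) = of_real (R i j) * (of_real (u i) * \<beta> j)
      - of_real (R i j) * (\<alpha> i * of_real (u j)) + (z - y) * (of_real (R i j) * (\<alpha> i * \<beta> j))"
      by (simp add: algebra_simps)
  qed
  also have "\<dots> = (\<Sum>j<n. of_real (\<Sum>i<n. R j i * u i) * \<beta> j) - (\<Sum>i<n. of_real (\<Sum>j<n. R i j * u j) * \<alpha> i)
      + (z - y) * (\<Sum>i<n. \<Sum>j<n. of_real (R i j) * (\<alpha> i * \<beta> j))"
  proof -
    have "(\<Sum>i<n. \<Sum>j<n. of_real (R i j) * (of_real (u i) * \<beta> j)) = (\<Sum>j<n. of_real (\<Sum>i<n. R j i * u i) * \<beta> j)"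
      by (subst sum.swap) (simp add: sum_distrib_right sum_distrib_left sym mult_ac)
    moreover have "(\<Sum>i<n. \<Sum>j<n. of_real (R i j) * (\<alpha> i * of_real (u j))) = (\<Sum>i<n. of_real (\<Sum>j<n. R i j * u j) * \<alpha> i)"
      by (simp add: sum_distrib_right sum_distrib_left mult_ac)
    ultimately show ?thesis
      by (simp add: sum.distrib sum_subtractf sum_distrib_left)
  qed
  also have "\<dots> = (z - y) * (\<Sum>i<n. \<Sum>j<n. of_real (R i j) * (\<alpha> i * \<beta> j))"
    using ker by simp
  finally have num: "A z * B y - B z * A y = (z - y) * (\<Sum>i<n. \<Sum>j<n. of_real (R i j) * (\<alpha> i * \<beta> j))" .
  have cA: "cnj (A \<zeta>) = A y" and cB: "cnj (B \<zeta>) = B y"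
    unfolding A_def B_def y_def by (rule cnj_pole_sum)+
  have "nevanlinna_kernel (\<lambda>z. A z / B z) z \<zeta> = (A z / B z - A y / B y) / (z - y)"
    by (simp add: nevanlinna_kernel_def cA cB y_def[symmetric])
  also have "A z / B z - A y / B y = (A z * B y - B z * A y) / (B z * B y)"
    using B0(1) B0' by (simp add: field_simps)
  also have "\<dots> / (z - y) = (\<Sum>i<n. \<Sum>j<n. of_real (R i j) * (\<alpha> i * \<beta> j)) / (B z * B y)"
    unfolding num using ne(3) by simp
  also have "\<dots> = (\<Sum>i<n. \<Sum>j<n. of_real (u i) / ((of_real (x i) - z) * B z) * of_real (R j i) *
      cnj (of_real (u j) / ((of_real (x j) - \<zeta>) * B \<zeta>)))"
    unfolding sum_divide_distrib
    by (intro sum.cong refl) (simp add: \<alpha>_def \<beta>_def cB y_def[symmetric] sym mult_ac)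
  finally show ?thesis .
qed

text \<open>Multiplying numerator and denominator by x i - z removes the pole from both; the
  quotient \<open>h\<close> is analytic at the node with value \<open>c i\<close>. The condition
  \<open>row\<close>, the i-th equation of the null vector with its diagonal term moved across, then
  evaluates the derivative as \<open>r\<close>.\<close>

lemma pole_quotient_at_regular_node:
  fixes n :: nat and x u c e :: "nat \<Rightarrow> real"
  defines "A \<equiv> pole_sum n x (\<lambda>j. u j * c j)" and "B \<equiv> pole_sum n x (\<lambda>j. u j * e j)"
    and "A' \<equiv> \<lambda>i. pole_sum n x ((\<lambda>j. u j * c j)(i := 0))" and "B' \<equiv> \<lambda>i. pole_sum n x ((\<lambda>j. u j * e j)(i := 0))"
  assumes inj: "inj_on x {..<n}" and i: "i < n" "u i \<noteq> 0" "e i = 1"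
    and row: "of_real (c i) * B' i (of_real (x i)) - A' i (of_real (x i)) = of_real (r * u i)"
  shows "(remove_sings (\<lambda>z. A z / B z) \<longlongrightarrow> of_real (c i)) (at (of_real (x i)))"
    and "(deriv (remove_sings (\<lambda>z. A z / B z)) \<longlongrightarrow> of_real r) (at (of_real (x i)))"
proof -
  define p where "p = complex_of_real (x i)"
  define U where "U = complex_of_real (u i)"
  define C where "C = complex_of_real (c i)"
  define w where "w = remove_sings (\<lambda>z. A z / B z)"
  define h where "h z = (U * C + (p - z) * A' i z) / (U + (p - z) * B' i z)" for z
  have U: "U \<noteq> 0" using i by (simp add: U_def)
  have an: "A' i analytic_on {p}" "B' i analytic_on {p}"
    unfolding A'_def B'_def using inj i
    by (intro pole_sum_analytic; auto simp: p_def inj_on_def split: if_splits)+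
  have h_an: "h analytic_on {p}"
    unfolding h_def using U by (intro analytic_intros an) auto
  have AB: "A z / B z = h z" if "z \<noteq> p" for z
  proof -
    have "A z / B z = ((p - z) * A z) / ((p - z) * B z)" using that by simp
    also have "\<dots> = h z"
      using pole_sum_split[OF i(1), of z x "\<lambda>j. u j * c j"] pole_sum_split[OF i(1), of z x "\<lambda>j. u j * e j"] that i(3)
      by (simp add: h_def A_def B_def A'_def B'_def p_def U_def C_def)
    finally show ?thesis .
  qed
  have "w z = remove_sings h z" for z
    unfolding w_def
  proof (rule remove_sings_cong[OF _ refl])
    show "eventually (\<lambda>z. A z / B z = h z) (at z)"
    proof (cases "z = p")
      case True
      then show ?thesis using AB by (auto simp: eventually_at_filter)
    next
      case False
      then have "eventually (\<lambda>y. y \<in> - {p}) (at z)"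
        by (intro eventually_at_in_open') auto
      then show ?thesis by eventually_elim (auto simp: AB)
    qed
  qed
  then have "w = remove_sings h" by auto
  then have wh: "eventually (\<lambda>z. w z = h z) (nhds p)"
    using eventually_remove_sings_eq_nhds[OF h_an] by simp
  have w_an: "w analytic_on {p}"
    using h_an analytic_at_cong[OF wh refl] by simp
  have "w p = h p" using wh by (rule eventually_nhds_x_imp_x)
  then have "w p = C" using U by (simp add: h_def)
  then have "(w \<longlongrightarrow> C) (at p)"
    using analytic_at_imp_isCont[OF w_an] by (simp add: isCont_def)
  then show "(remove_sings (\<lambda>z. A z / B z) \<longlongrightarrow> of_real (c i)) (at (of_real (x i)))"
    by (simp add: w_def p_def C_def)
  have dA: "(A' i has_field_derivative deriv (A' i) p) (at p)" and dB: "(B' i has_field_derivative deriv (B' i) p) (at p)"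
    using an by (auto intro: analytic_derivI)
  have "(h has_field_derivative ((- A' i p * U - U * C * (- B' i p)) / (U * U))) (at p)"
    unfolding h_def[abs_def] using U by (auto intro!: derivative_eq_intros dA dB)
  then have "deriv h p = (- A' i p * U - U * C * (- B' i p)) / (U * U)"
    by (rule DERIV_imp_deriv)
  also have "\<dots> = (C * B' i p - A' i p) / U"
    using U by (simp add: field_simps)
  also have "\<dots> = of_real r"
    using row U by (simp add: C_def p_def U_def)
  finally have "deriv w p = of_real r"
    using deriv_cong_ev[OF wh refl] by simp
  moreover have "isCont (deriv w) p"
    using w_an by (intro analytic_at_imp_isCont analytic_deriv)
  ultimately have "(deriv w \<longlongrightarrow> of_real r) (at p)" by (simp add: isCont_def)
  then show "(deriv (remove_sings (\<lambda>z. A z / B z)) \<longlongrightarrow> of_real r) (at (of_real (x i)))"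
    by (simp add: w_def p_def)
qed

text \<open>Since \<open>e i = 0\<close>, only \<open>A\<close> has a pole at the node: (z - x i) A
  tends to -u i c i, while \<open>row\<close> gives B(x i) = r u i / c i. For r = 0 the quotient
  tends to infinity, because node \<open>k\<close> keeps \<open>B\<close> from vanishing
  identically.\<close>

lemma pole_quotient_at_singular_node:
  fixes n :: nat and x u c e :: "nat \<Rightarrow> real"
  defines "A \<equiv> pole_sum n x (\<lambda>j. u j * c j)" and "B \<equiv> pole_sum n x (\<lambda>j. u j * e j)"
    and "A' \<equiv> \<lambda>i. pole_sum n x ((\<lambda>j. u j * c j)(i := 0))"
  assumes inj: "inj_on x {..<n}" and i: "i < n" "u i \<noteq> 0" "e i = 0" "c i \<noteq> 0"
    and k: "k < n" "u k \<noteq> 0" "e k \<noteq> 0"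
    and row: "of_real (c i) * B (of_real (x i)) = of_real (r * u i)"
  shows "if r = 0
    then filterlim (\<lambda>z. (z - of_real (x i)) * remove_sings (\<lambda>z. A z / B z) z) at_infinity (at (of_real (x i)))
    else ((\<lambda>z. (z - of_real (x i)) * remove_sings (\<lambda>z. A z / B z) z) \<longlongrightarrow> of_real (- ((c i)\<^sup>2) / r)) (at (of_real (x i)))"
proof -
  define p where "p = complex_of_real (x i)"
  define w where "w = remove_sings (\<lambda>z. A z / B z)"
  define N where "N z = - (of_real (u i * c i) + (p - z) * A' i z)" for z
  have A'_an: "A' i analytic_on {p}"
    unfolding A'_def using inj i by (intro pole_sum_analytic) (auto simp: p_def inj_on_def split: if_splits)
  have B_an: "B analytic_on {p}"
    unfolding B_def using inj i by (intro pole_sum_analytic) (auto simp: p_def inj_on_def)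
  have "eventually (\<lambda>z. w z = A z / B z) (at p)"
  proof -
    have "(\<lambda>z. A z / B z) meromorphic_on {p}"
      unfolding A_def B_def by (intro meromorphic_intros pole_sum_meromorphic)
    then show ?thesis
      unfolding w_def by (intro eventually_remove_sings_eq_at) (auto simp: meromorphic_on_altdef)
  qed
  moreover have "eventually (\<lambda>z. z \<noteq> p) (at p)" by (simp add: eventually_at_filter)
  ultimately have ev: "eventually (\<lambda>z. N z / B z = (z - p) * w z) (at p)"
  proof eventually_elim
    case (elim z)
    have "(p - z) * A z = of_real (u i * c i) + (p - z) * A' i z"
      using pole_sum_split[OF i(1), of z x "\<lambda>j. u j * c j"] elim by (simp add: A_def A'_def p_def)
    then have "N z = (z - p) * A z" by (simp add: N_def algebra_simps)
    then show ?case using elim by simp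
  qed
  have "(N \<longlongrightarrow> - (of_real (u i * c i) + (p - p) * A' i p)) (at p)"
    unfolding N_def[abs_def] using analytic_at_imp_isCont[OF A'_an]
    by (intro tendsto_intros) (simp add: isCont_def)
  then have N: "(N \<longlongrightarrow> of_real (- (u i * c i))) (at p)" by simp
  have Bp: "(B \<longlongrightarrow> B p) (at p)"
    using analytic_at_imp_isCont[OF B_an] by (simp add: isCont_def)
  have BP: "B p = of_real (r * u i / c i)"
    using row i(4) by (simp add: p_def field_simps)
  show ?thesis
  proof (cases "r = 0")
    case True
    have "eventually (\<lambda>z. B z \<noteq> 0) (at p)"
      unfolding B_def using inj k i
      by (intro pole_sum_eventually_nonzero[where i = k]) (auto simp: p_def inj_on_def)
    then have "filterlim B (at 0) (at p)"
      using Bp BP True by (simp add: filterlim_at)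
    then have "filterlim (\<lambda>z. N z / B z) at_infinity (at p)"
      using i by (intro filterlim_divide_at_infinity[OF N]) auto
    then have "filterlim (\<lambda>z. (z - p) * w z) at_infinity (at p)"
      using filterlim_cong[OF refl refl ev] by simp
    then show ?thesis using True by (simp add: p_def w_def)
  next
    case False
    have "((\<lambda>z. N z / B z) \<longlongrightarrow> of_real (- (u i * c i)) / B p) (at p)"
      using False i by (intro tendsto_divide N Bp) (simp add: BP)
    also have "of_real (- (u i * c i)) / B p = of_real (- ((c i)\<^sup>2) / r)"
      using False i unfolding BP of_real_divide[symmetric] by (simp add: power2_eq_square field_simps)
    finally have "((\<lambda>z. (z - p) * w z) \<longlongrightarrow> of_real (- ((c i)\<^sup>2) / r)) (at p)"
      by (rule Lim_transform_eventually[OF _ ev])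
    then show ?thesis using False by (simp add: p_def w_def)
  qed
qed

lemma regular_conditionI:
  assumes "(w \<longlongrightarrow> of_real a) (at (of_real x))" "(deriv w \<longlongrightarrow> of_real d) (at (of_real x))" "d \<le> g"
  shows "regular_condition w x a g"
  unfolding regular_condition_def using assms tendsto_mono[OF nontangential_le_at] by blast

lemma pole_sum_fun_upd_of_real:
  assumes "i < n" "z = of_real y"
  shows "pole_sum n x (q(i := 0)) z = of_real (\<Sum>j\<in>{..<n} - {i}. q j / (x j - y))"
  unfolding pole_sum_def assms(2) using assms(1)
  by (subst sum.remove[of _ i]) auto

text \<open>The kernel of this sum is diagonal in the functions 1 / (x i - z) with coefficients
  -\<xi> i \<ge> 0, so its matrices have no negative eigenvalues. That \<kappa> is then 0 is left to
  \<open>gen_nevanlinnaI\<close>.\<close>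

lemma negative_poles_in_gen_nevanlinna:
  assumes data: "interpolation_data n l x \<xi>" and S: "S \<subseteq> {..<n}"
    and \<kappa>: "neg_index n (restr S (pick_kernel l x a g \<xi>)) = \<kappa>"
    and sing: "\<And>i. i \<in> S \<Longrightarrow> l \<le> i \<and> \<xi> i < 0"
  shows "\<exists>w\<in>gen_nevanlinna \<kappa>. \<forall>i\<in>S. interpolates_at l x a g \<xi> w i"
proof -
  define q where "q j = (if j \<in> S then - \<xi> j else 0)" for j
  define w where "w = pole_sum n x q"
  have q0: "q j \<ge> 0" for j using sing by (auto simp: q_def less_imp_le)
  have inj: "inj_on x {..<n}" using data by (simp add: interpolation_data_def)
  have an: "w analytic_on {z}" if "z \<in> upper_half_plane" for z
    unfolding w_def using that by (intro pole_sum_analytic) (auto simp: upper_half_plane_def)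
  have nm: "w nicely_meromorphic_on upper_half_plane"
    by (rule analytic_on_imp_nicely_meromorphic_on) (subst analytic_on_analytic_at, use an in blast)
  define Q where "Q = diag_sub (\<lambda>_ _. 0) (\<lambda>j. - q j)"
  have Q: "hermitian n Q"
    unfolding Q_def by (intro hermitian_diag_sub) (simp add: hermitian_def)
  have "neg_index n Q \<le> 0"
  proof (rule neg_index_leI[OF Q])
    fix v
    have "0 \<le> (\<Sum>j<n. q j * (cmod (v j))\<^sup>2)"
      using q0 by (intro sum_nonneg mult_nonneg_nonneg) auto
    then show "0 \<le> qform n Q v"
      unfolding Q_def qform_diag_sub by (simp add: qform_def inner_prod_def mat_app_def sum_negf)
  qed
  moreover have "sq_neg (kernel_matrix w m z) \<le> neg_index n Q"
    if z: "\<And>i. i < m \<Longrightarrow> z i \<in> analyticity_domain w" for m z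
  proof (rule kernel_matrix_factorization_bound[where F = "\<lambda>z i. 1 / (of_real (x i) - z)" and
      G = "\<lambda>z. z \<in> upper_half_plane", OF Q _ _ z])
    show "eventually (\<lambda>z. z \<in> upper_half_plane) (at z)" if "z \<in> upper_half_plane" for z
      using that unfolding upper_half_plane_def
      by (intro eventually_at_in_open' open_Collect_less continuous_intros) auto
    fix z \<zeta> assume z\<zeta>: "z \<in> upper_half_plane" "\<zeta> \<in> upper_half_plane"
    have ne: "of_real (x i) - z \<noteq> 0" "of_real (x i) - cnj \<zeta> \<noteq> 0" "z - cnj \<zeta> \<noteq> 0" for i
      using z\<zeta> by (auto simp: upper_half_plane_def complex_eq_iff)
    have "w z - cnj (w \<zeta>) = (\<Sum>j<n. of_real (q j) / (of_real (x j) - z) - of_real (q j) / (of_real (x j) - cnj \<zeta>))"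
      unfolding w_def cnj_pole_sum by (simp add: pole_sum_def sum_subtractf)
    also have "\<dots> = (\<Sum>j<n. (z - cnj \<zeta>) * (of_real (q j) / ((of_real (x j) - z) * (of_real (x j) - cnj \<zeta>))))"
      using ne by (intro sum.cong refl) (simp add: divide_simps, simp add: algebra_simps)
    also have "\<dots> = (z - cnj \<zeta>) * (\<Sum>j<n. of_real (q j) / ((of_real (x j) - z) * (of_real (x j) - cnj \<zeta>)))"
      by (rule sum_distrib_left[symmetric])
    finally have "nevanlinna_kernel w z \<zeta> = (\<Sum>j<n. of_real (q j) / ((of_real (x j) - z) * (of_real (x j) - cnj \<zeta>)))"
      unfolding nevanlinna_kernel_def using ne(3) by simp
    also have "\<dots> = (\<Sum>i<n. \<Sum>j<n. if i = j then of_real (q i) / ((of_real (x i) - z) * (of_real (x j) - cnj \<zeta>)) else 0)"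
      by simp
    also have "\<dots> = (\<Sum>i<n. \<Sum>j<n. 1 / (of_real (x i) - z) * Q j i * cnj (1 / (of_real (x j) - \<zeta>)))"
      by (intro sum.cong refl) (auto simp: Q_def diag_sub_def)
    finally show "nevanlinna_kernel w z \<zeta> =
        (\<Sum>i<n. \<Sum>j<n. 1 / (of_real (x i) - z) * Q j i * cnj (1 / (of_real (x j) - \<zeta>)))" .
  qed
  ultimately have bound: "sq_neg (kernel_matrix w m z) \<le> \<kappa>"
    if "\<And>i. i < m \<Longrightarrow> z i \<in> analyticity_domain w" for m z
    using that by (meson le_0_eq le_trans zero_le)
  have int: "interpolates_at l x a g \<xi> w i" if i: "i \<in> S" for i
  proof -
    define p where "p = complex_of_real (x i)"
    have i': "i < n" "l \<le> i" "\<xi> i < 0" using i S sing by auto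
    have "pole_sum n x (q(i := 0)) analytic_on {p}"
      using inj i' by (intro pole_sum_analytic) (auto simp: p_def inj_on_def split: if_splits)
    then have "isCont (pole_sum n x (q(i := 0))) p" by (rule analytic_at_imp_isCont)
    then have "((\<lambda>z. - (of_real (q i) + (p - z) * pole_sum n x (q(i := 0)) z)) \<longlongrightarrow>
        - (of_real (q i) + (p - p) * pole_sum n x (q(i := 0)) p)) (at p)"
      by (intro tendsto_intros) (simp add: isCont_def)
    then have "((\<lambda>z. - (of_real (q i) + (p - z) * pole_sum n x (q(i := 0)) z)) \<longlongrightarrow> of_real (\<xi> i)) (at p)"
      using i by (simp add: q_def)
    moreover have "eventually (\<lambda>z. - (of_real (q i) + (p - z) * pole_sum n x (q(i := 0)) z) = (z - p) * w z) (at p)"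
      unfolding eventually_at_filter
    proof (intro always_eventually allI impI)
      fix z assume "z \<noteq> p"
      then have "(p - z) * w z = of_real (q i) + (p - z) * pole_sum n x (q(i := 0)) z"
        using pole_sum_split[OF i'(1), of z x q] by (simp add: p_def w_def)
      then show "- (of_real (q i) + (p - z) * pole_sum n x (q(i := 0)) z) = (z - p) * w z"
        by (metis minus_diff_eq mult_minus_left)
    qed
    ultimately have "((\<lambda>z. (z - p) * w z) \<longlongrightarrow> of_real (\<xi> i)) (at p)"
      by (rule Lim_transform_eventually)
    then have "((\<lambda>z. (z - p) * w z) \<longlongrightarrow> of_real (\<xi> i)) (nontangential w (x i))"
      unfolding p_def by (rule tendsto_mono[OF nontangential_le_at])
    then show ?thesis
      using i' unfolding interpolates_at_def singular_condition_def p_def by auto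
  qed
  show ?thesis
    using gen_nevanlinnaI[OF nm _ data S int \<kappa>] bound int by blast
qed

text \<open>The hypothesis on deleting one more node is what maximality of the removed set supplies;
  it bounds the lowering of the diagonal. The slack \<open>D\<close> in the diagonal becomes the
  slack in the interpolation inequalities.\<close>

lemma exists_interpolant:
  assumes data: "interpolation_data n l x \<xi>" and S: "S \<subseteq> {..<n}"
    and \<kappa>: "neg_index n (restr S (pick_kernel l x a g \<xi>)) = \<kappa>"
    and rem: "\<And>i. i \<in> S \<Longrightarrow> \<kappa> \<le> neg_index n (restr (S - {i}) (pick_kernel l x a g \<xi>))"
  shows "\<exists>w\<in>gen_nevanlinna \<kappa>. \<forall>i\<in>S. interpolates_at l x a g \<xi> w i"
proof -
  let ?P = "pick_kernel l x a g \<xi>"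
  have inj: "inj_on x {..<n}" using data by (simp add: interpolation_data_def)
  have fin: "finite S" using S finite_subset by blast
  have "\<kappa> \<le> neg_index n (restr (- {i}) (restr S ?P))" if "i \<in> S" for i
    using rem[OF that] by (simp add: restr_restr Int_commute Diff_eq)
  then have "\<exists>D. (\<forall>i. D i \<ge> 0) \<and> (\<forall>i. i \<notin> S \<longrightarrow> D i = 0) \<and> neg_index n (diag_sub (restr S ?P) D) = \<kappa> \<and>
    (\<forall>i\<in>S. \<exists>u. (\<forall>j<n. mat_app n (diag_sub (restr S ?P) D) u j = 0) \<and> u i \<noteq> 0)"
    by (intro exists_diag_sub_full_kernel hermitian_restr hermitian_pick_kernel S \<kappa>)
  then obtain D where D: "\<And>i. D i \<ge> 0" "\<And>i. i \<notin> S \<Longrightarrow> D i = 0" "neg_index n (diag_sub (restr S ?P) D) = \<kappa>"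
    "\<And>i. i \<in> S \<Longrightarrow> \<exists>u. (\<forall>j<n. mat_app n (diag_sub (restr S ?P) D) u j = 0) \<and> u i \<noteq> 0"
    by blast
  define R where "R i j = (if i \<in> S \<and> j \<in> S then pick_entry l x a g \<xi> i j else 0) - (if i = j then D i else 0)"
    for i j
  have RD: "diag_sub (restr S ?P) D = (\<lambda>i j. of_real (R i j))"
    by (auto simp: R_def diag_sub_def restr_def fun_eq_iff)
  have R_sym: "R i j = R j i" for i j
    using pick_entry_commute[of l x a g \<xi> i j] by (auto simp: R_def)
  have R_diag: "R i i \<le> pick_entry l x a g \<xi> i i" if "i \<in> S" for i
    using that D(1)[of i] by (simp add: R_def)
  obtain u0 where u0: "\<And>j. j < n \<Longrightarrow> (\<Sum>l<n. R j l * u0 l) = 0" "\<And>i. i \<in> S \<Longrightarrow> u0 i \<noteq> 0"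
    using exists_real_kernel_vector[OF fin, of n R] D(4) unfolding RD by blast
  \<comment> \<open>\<open>R\<close> is zero outside \<open>S\<close>, so cutting \<open>u0\<close>
    to \<open>S\<close> keeps it a null vector and removes the other nodes from the pole
    sums.\<close>
  define u where "u j = (if j \<in> S then u0 j else 0)" for j
  have u0': "u i \<noteq> 0" if "i \<in> S" for i using u0(2) that by (simp add: u_def)
  have ker: "(\<Sum>j<n. R i j * u j) = 0" if "i < n" for i
  proof -
    have "(\<Sum>j<n. R i j * u j) = (\<Sum>j<n. R i j * u0 j)"
      by (intro sum.cong refl) (auto simp: R_def u_def D(2))
    then show ?thesis using u0(1)[OF that] by simp
  qed
  define c e where "c = node_num l a \<xi>" and "e = node_den l"
  have disp: "u i * u j * (c i * e j - e i * c j) = u i * u j * ((x i - x j) * R i j)"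
    if "i < n" "j < n" for i j
  proof (cases "i \<in> S \<and> j \<in> S \<and> i \<noteq> j")
    case True
    then have "x j - x i \<noteq> 0" using inj that by (auto simp: inj_on_def)
    moreover have "R i j = (c j * e i - e j * c i) / (x j - x i)"
      using True by (simp add: R_def pick_entry_off_diagonal c_def e_def)
    ultimately have "(x j - x i) * R i j = c j * e i - e j * c i" by simp
    then have "(x i - x j) * R i j = c i * e j - e i * c j" by (simp add: algebra_simps)
    then show ?thesis by simp
  qed (auto simp: u_def)
  show ?thesis
  proof (cases "\<exists>k\<in>S. k < l")
    case False
    \<comment> \<open>Without regular nodes \<open>R\<close> is diagonal, so a null vector with no
      zero entry on \<open>S\<close> forces \<open>R i i = 0\<close>, that is D i = -\<xi> i \<ge>
      0.\<close>
    have "l \<le> i \<and> \<xi> i < 0" if i: "i \<in> S" for i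
    proof
      have li: "l \<le> j" if "j \<in> S" for j using False that by (meson not_le)
      then show "l \<le> i" using i by simp
      have "(\<Sum>j<n. R i j * u j) = (\<Sum>j<n. if j = i then R i i * u i else 0)"
      proof (intro sum.cong refl)
        fix j
        show "R i j * u j = (if j = i then R i i * u i else 0)"
          using li[of i] li[of j] i by (auto simp: R_def u_def pick_entry_def)
      qed
      then have "R i i * u i = 0" using ker[of i] i S by auto
      then have "R i i = 0" using u0'[OF i] by simp
      then have "D i = - \<xi> i" using i \<open>l \<le> i\<close> by (simp add: R_def pick_entry_def)
      then have "\<xi> i \<le> 0" using D(1)[of i] by simp
      moreover have "\<xi> i \<noteq> 0" using data i S \<open>l \<le> i\<close> by (auto simp: interpolation_data_def)
      ultimately show "\<xi> i < 0" by simp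
    qed
    then show ?thesis by (rule negative_poles_in_gen_nevanlinna[OF data S \<kappa>])
  next
    case True
    then obtain k where k: "k \<in> S" "k < l" by blast
    have k': "k < n" "u k \<noteq> 0" "e k \<noteq> 0" using k S u0' by (auto simp: e_def node_den_def)
    define A B where "A = pole_sum n x (\<lambda>j. u j * c j)" and "B = pole_sum n x (\<lambda>j. u j * e j)"
    define w where "w = remove_sings (\<lambda>z. A z / B z)"
    have mero: "(\<lambda>z. A z / B z) meromorphic_on upper_half_plane"
      unfolding A_def B_def by (intro meromorphic_intros pole_sum_meromorphic)
    have nm: "w nicely_meromorphic_on upper_half_plane"
      unfolding w_def by (rule remove_sings_nicely_meromorphic[OF mero])
    have bound: "sq_neg (kernel_matrix w m z) \<le> \<kappa>"
      if z: "\<And>i. i < m \<Longrightarrow> z i \<in> analyticity_domain w" for m z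
    proof -
      have "sq_neg (kernel_matrix w m z) \<le> neg_index n (\<lambda>i j. of_real (R i j))"
      proof (rule kernel_matrix_factorization_bound[where
          F = "\<lambda>z i. of_real (u i) / ((of_real (x i) - z) * B z)" and
          G = "\<lambda>z. z \<in> upper_half_plane \<and> B z \<noteq> 0 \<and> w z = A z / B z", OF _ _ _ z])
        show "hermitian n (\<lambda>i j. complex_of_real (R i j))"
          by (rule hermitian_of_real) (rule R_sym)
        show "eventually (\<lambda>z. z \<in> upper_half_plane \<and> B z \<noteq> 0 \<and> w z = A z / B z) (at z)"
          if z: "z \<in> upper_half_plane" for z
        proof (intro eventually_conj)
          show "eventually (\<lambda>z. z \<in> upper_half_plane) (at z)"
            using that unfolding upper_half_plane_def
            by (intro eventually_at_in_open' open_Collect_less continuous_intros) auto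
          show "eventually (\<lambda>z. B z \<noteq> 0) (at z)"
            unfolding B_def using k' z
            by (intro pole_sum_eventually_nonzero[OF inj, where i = k]) (auto simp: upper_half_plane_def)
          show "eventually (\<lambda>z. w z = A z / B z) (at z)"
            unfolding w_def using mero z
            by (intro eventually_remove_sings_eq_at) (auto simp: meromorphic_on_altdef)
        qed
        fix z \<zeta>
        assume z: "z \<in> upper_half_plane \<and> B z \<noteq> 0 \<and> w z = A z / B z"
          and \<zeta>: "\<zeta> \<in> upper_half_plane \<and> B \<zeta> \<noteq> 0 \<and> w \<zeta> = A \<zeta> / B \<zeta>"
        have "nevanlinna_kernel w z \<zeta> = nevanlinna_kernel (\<lambda>z. A z / B z) z \<zeta>"
          using z \<zeta> by (simp add: nevanlinna_kernel_def)
        also have "\<dots> = (\<Sum>i<n. \<Sum>j<n. of_real (u i) / ((of_real (x i) - z) * B z) * of_real (R j i) *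
            cnj (of_real (u j) / ((of_real (x j) - \<zeta>) * B \<zeta>)))"
          unfolding A_def B_def
          by (rule pole_quotient_kernel[OF R_sym])
             (use ker disp z \<zeta> in \<open>simp_all add: B_def\<close>)
        finally show "nevanlinna_kernel w z \<zeta> =
          (\<Sum>i<n. \<Sum>j<n. of_real (u i) / ((of_real (x i) - z) * B z) * of_real (R j i) *
            cnj (of_real (u j) / ((of_real (x j) - \<zeta>) * B \<zeta>)))" .
      qed
      then show ?thesis using D(3) by (simp add: RD)
    qed
    \<comment> \<open>The i-th equation of R u = 0. Its off-diagonal entries are expressed through
      \<open>disp\<close>, from which the nonzero \<open>u i\<close> cancels.\<close>
    have row: "of_real (c i) * pole_sum n x ((\<lambda>j. u j * e j)(i := 0)) (of_real (x i)) -
        of_real (e i) * pole_sum n x ((\<lambda>j. u j * c j)(i := 0)) (of_real (x i)) = complex_of_real (R i i * u i)"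
      if i: "i \<in> S" for i
    proof -
      have i': "i < n" using i S by auto
      have "c i * (\<Sum>j\<in>{..<n} - {i}. u j * e j / (x j - x i)) - e i * (\<Sum>j\<in>{..<n} - {i}. u j * c j / (x j - x i))
          = (\<Sum>j\<in>{..<n} - {i}. - (R i j * u j))"
        unfolding sum_distrib_left sum_subtractf[symmetric]
      proof (intro sum.cong refl)
        fix j assume j: "j \<in> {..<n} - {i}"
        have ne: "x j - x i \<noteq> 0" using inj i' j by (auto simp: inj_on_def)
        have "u i * (u j * (c i * e j - e i * c j)) = u i * (u j * ((x i - x j) * R i j))"
          using disp[of i j] i' j by (simp add: mult.assoc)
        then have "u j * (c i * e j - e i * c j) = u j * ((x i - x j) * R i j)"
          using u0'[OF i] by simp
        then have "u j * (c i * e j - e i * c j) / (x j - x i) = - (R i j * u j)"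
          using ne by (simp add: divide_eq_eq algebra_simps)
        then show "c i * (u j * e j / (x j - x i)) - e i * (u j * c j / (x j - x i)) = - (R i j * u j)"
          by (simp add: algebra_simps diff_divide_distrib)
      qed
      also have "\<dots> = R i i * u i - (\<Sum>j<n. R i j * u j)"
        using i' by (simp add: sum_negf sum.remove[of "{..<n}" i])
      also have "\<dots> = R i i * u i" using ker[OF i'] by simp
      finally show ?thesis
        unfolding pole_sum_fun_upd_of_real[OF i' refl]
        by (simp only: of_real_mult[symmetric] of_real_diff[symmetric])
    qed
    have int: "interpolates_at l x a g \<xi> w i" if i: "i \<in> S" for i
    proof (cases "i < l")
      case True
      have i': "i < n" "u i \<noteq> 0" "e i = 1" "c i = a i"
        using i S u0'[OF i] True by (auto simp: e_def c_def node_den_def node_num_def)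
      have row': "of_real (c i) * pole_sum n x ((\<lambda>j. u j * e j)(i := 0)) (of_real (x i)) -
          pole_sum n x ((\<lambda>j. u j * c j)(i := 0)) (of_real (x i)) = complex_of_real (R i i * u i)"
        using row[OF i] i'(3) by simp
      note lim = pole_quotient_at_regular_node[OF inj i'(1-3) row', folded A_def B_def w_def]
      show ?thesis
        using regular_conditionI[OF lim, of "g i"] R_diag[OF i] i' True
        by (simp add: interpolates_at_def pick_entry_def)
    next
      case False
      have i': "i < n" "u i \<noteq> 0" "e i = 0" "c i = \<xi> i" "\<xi> i \<noteq> 0"
        using i S u0'[OF i] False data
        by (auto simp: e_def c_def node_den_def node_num_def interpolation_data_def)
      have upd: "(\<lambda>j. u j * e j)(i := 0) = (\<lambda>j. u j * e j)"
        using i'(3) by auto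
      have row': "of_real (c i) * B (of_real (x i)) = of_real (R i i * u i)"
        using row[OF i] i'(3) unfolding upd B_def by simp
      have lim: "if R i i = 0
          then filterlim (\<lambda>z. (z - of_real (x i)) * w z) at_infinity (at (of_real (x i)))
          else ((\<lambda>z. (z - of_real (x i)) * w z) \<longlongrightarrow> of_real (- ((c i)\<^sup>2) / R i i)) (at (of_real (x i)))"
        unfolding w_def A_def B_def
        by (rule pole_quotient_at_singular_node[OF inj i'(1-3) _ k'])
           (use i' row' in \<open>simp_all add: B_def\<close>)
      have le: "R i i \<le> - \<xi> i" using R_diag[OF i] False by (simp add: pick_entry_def)
      have "singular_condition w (x i) (\<xi> i)"
      proof (cases "R i i = 0")
        case True
        then have "filterlim (\<lambda>z. (z - of_real (x i)) * w z) at_infinity (nontangential w (x i))"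
          using lim filterlim_mono[OF _ order_refl nontangential_le_at] by simp
        moreover have "0 \<le> - 1 / \<xi> i" using le True by (simp add: divide_nonneg_neg)
        ultimately show ?thesis by (simp add: singular_condition_def)
      next
        case R: False
        then have "((\<lambda>z. (z - of_real (x i)) * w z) \<longlongrightarrow> of_real (- ((c i)\<^sup>2) / R i i)) (nontangential w (x i))"
          using lim tendsto_mono[OF nontangential_le_at] by simp
        moreover have "- ((c i)\<^sup>2) / R i i \<noteq> 0" using R i' by simp
        \<comment> \<open>The left side equals R i i / (\<xi> i)^2, so the condition is R i i \<le>
          -\<xi> i divided by (\<xi> i)^2.\<close>
        moreover have "- 1 / (- ((c i)\<^sup>2) / R i i) \<le> - 1 / \<xi> i"
        proof -
          have "- 1 / (- ((c i)\<^sup>2) / R i i) = R i i / (\<xi> i)\<^sup>2" using i' by simp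
          also have "\<dots> \<le> - \<xi> i / (\<xi> i)\<^sup>2" using le by (intro divide_right_mono) auto
          also have "\<dots> = - 1 / \<xi> i" using i' by (simp add: power2_eq_square)
          finally show ?thesis .
        qed
        ultimately show ?thesis unfolding singular_condition_def by blast
      qed
      then show ?thesis using False by (simp add: interpolates_at_def)
    qed
    show ?thesis
      using gen_nevanlinnaI[OF nm _ data S int \<kappa>] bound int by blast
  qed
qed

section \<open>The equivalence of the two problems\<close>

lemma the_mat_inverse:
  fixes A :: "'a :: field mat"
  assumes A: "A \<in> carrier_mat n n" and inv: "invertible_mat A"
  shows "the (mat_inverse A) \<in> carrier_mat n n" "A * the (mat_inverse A) = 1\<^sub>m n"
proof -
  obtain B where B: "A * B = 1\<^sub>m n" "B * A = 1\<^sub>m (dim_row B)"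
    using inv A by (auto simp: invertible_mat_def inverts_mat_def)
  have "dim_col (A * B) = n" by (simp add: B(1))
  moreover have "dim_col (B * A) = dim_row B" by (simp add: B(2))
  ultimately have "B \<in> carrier_mat n n" using A by auto
  then have "A \<in> Units (ring_mat TYPE('a) n ())"
    using A B by (auto simp: Units_def ring_mat_def)
  then have "mat_inverse A \<noteq> None"
    using mat_inverse(1)[OF A, where b = "()"] by blast
  then obtain C where "mat_inverse A = Some C" by blast
  then show "the (mat_inverse A) \<in> carrier_mat n n" "A * the (mat_inverse A) = 1\<^sub>m n"
    using mat_inverse(2)[OF A] by auto
qed

lemma pick_inverse_column:
  assumes inv: "invertible_mat (pick_matrix n l x a g \<xi>)" and e: "e < n" and i: "i < n"
  shows "mat_app n (pick_kernel l x a g \<xi>)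
    (\<lambda>j. of_real (the (mat_inverse (pick_matrix n l x a g \<xi>)) $$ (j, e))) i = unit_fun e i"
proof -
  define P where "P = pick_matrix n l x a g \<xi>"
  define B where "B = the (mat_inverse P)"
  have P: "P \<in> carrier_mat n n" by (simp add: P_def pick_matrix_eq)
  note B = the_mat_inverse[OF P inv[folded P_def], folded B_def]
  have "mat_app n (pick_kernel l x a g \<xi>) (\<lambda>j. of_real (B $$ (j, e))) i =
      of_real (\<Sum>j<n. pick_entry l x a g \<xi> i j * B $$ (j, e))"
    by (simp add: mat_app_def)
  also have "(\<Sum>j<n. pick_entry l x a g \<xi> i j * B $$ (j, e)) = (P * B) $$ (i, e)"
    using P B(1) e i by (simp add: scalar_prod_def atLeast0LessThan P_def pick_matrix_eq)
  also have "\<dots> = (if i = e then 1 else 0)" using e i by (simp add: B(2))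
  finally show ?thesis by (auto simp: unit_fun_def B_def P_def)
qed

lemma interpolation_neg_index_le_gen_nevanlinna:
  assumes "w \<in> gen_nevanlinna \<kappa>" "interpolation_data n l x \<xi>" "S \<subseteq> {..<n}"
    and "\<And>i. i \<in> S \<Longrightarrow> interpolates_at l x a g \<xi> w i"
  shows "neg_index n (restr S (pick_kernel l x a g \<xi>)) \<le> \<kappa>"
  using assms(1) by (intro interpolation_neg_index_le[OF _ _ assms(2-4)]) (auto simp: gen_nevanlinna_def)

theorem corollary2p12:
  fixes n l :: nat and x a g \<xi> :: "nat \<Rightarrow> real"
  assumes "interpolation_data n l x \<xi>"
    and "invertible_mat (pick_matrix n l x a g \<xi>)"
  shows "boundary_solutions n l x a g \<xi> = master_solutions n l x a g \<xi> \<longleftrightarrow>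
    (\<forall>i<n. the (mat_inverse (pick_matrix n l x a g \<xi>)) $$ (i, i) > 0)"
proof
  let ?P = "pick_kernel l x a g \<xi>"
  define \<kappa> where "\<kappa> = neg_index n ?P"
  define v where "v e = (\<lambda>j. complex_of_real (the (mat_inverse (pick_matrix n l x a g \<xi>)) $$ (j, e)))" for e
  have P: "hermitian n ?P" by (rule hermitian_pick_kernel)
  have v: "mat_app n ?P (v e) i = unit_fun e i" if "e < n" "i < n" for e i
    unfolding v_def using pick_inverse_column[OF assms(2) that] .
  have lower: "\<kappa> \<le> neg_index n (restr (- E) ?P) + card E" if "E \<subseteq> {..<n}" for E
    using neg_index_restr_remove[OF P finite_subset[OF that] that, of UNIV]
    by (simp add: \<kappa>_def Compl_eq_Diff_UNIV)
  have restr_Compl: "neg_index n (restr ({..<n} - E) ?P) = neg_index n (restr (- E) ?P)" for E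
    unfolding neg_index_def by (intro arg_cong[where f = sq_neg] eq_matI) (auto simp: restr_def)
  show "\<forall>i<n. the (mat_inverse (pick_matrix n l x a g \<xi>)) $$ (i, i) > 0"
    if eq: "boundary_solutions n l x a g \<xi> = master_solutions n l x a g \<xi>"
  proof (rule ccontr)
    assume "\<not> ?thesis"
    then obtain e where e: "e < n" "Re (v e e) \<le> 0"
      by (auto simp: v_def not_less)
    \<comment> \<open>In view of \<open>lower\<close> these are the sets whose removal loses exactly
      one negative eigenvalue per node.\<close>
    define \<E> where "\<E> = {E. E \<subseteq> {..<n} \<and> neg_index n (restr (- E) ?P) + card E \<le> \<kappa>}"
    have "finite \<E>" by (rule finite_subset[of _ "Pow {..<n}"]) (auto simp: \<E>_def)
    have e\<E>: "{e} \<in> \<E>"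
      using neg_index_restr_remove_less[OF P e(1) v[OF e(1)] e(2)] e(1) by (simp add: \<E>_def \<kappa>_def)
    then have "Max (card ` \<E>) \<in> card ` \<E>"
      using \<open>finite \<E>\<close> by (intro Max_in) auto
    then obtain E where E: "E \<in> \<E>" "card E = Max (card ` \<E>)" by auto
    have max: "card F \<le> card E" if "F \<in> \<E>" for F
      unfolding E(2) using \<open>finite \<E>\<close> that by (intro Max_ge) auto
    have "card E \<ge> 1" using max[OF e\<E>] by simp
    have En: "E \<subseteq> {..<n}" using E(1) by (simp add: \<E>_def)
    have finE: "finite E" using En finite_subset by blast
    define \<kappa>' where "\<kappa>' = neg_index n (restr (- E) ?P)"
    have \<kappa>': "\<kappa>' + card E = \<kappa>"
      using lower[OF En] E(1) by (simp add: \<E>_def \<kappa>'_def)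
    have "\<exists>w\<in>gen_nevanlinna \<kappa>'. \<forall>i\<in>{..<n} - E. interpolates_at l x a g \<xi> w i"
    proof (rule exists_interpolant[OF assms(1)])
      show "neg_index n (restr ({..<n} - E) ?P) = \<kappa>'"
        by (simp add: restr_Compl \<kappa>'_def)
      fix i assume i: "i \<in> {..<n} - E"
      have set: "{..<n} - E - {i} = {..<n} - insert i E" by auto
      have "insert i E \<notin> \<E>" using max[of "insert i E"] i finE by auto
      \<comment> \<open>Maximality in the form needed for the interpolant: deleting one more node
        loses nothing.\<close>
      then have "\<kappa> < neg_index n (restr (- insert i E) ?P) + card (insert i E)"
        using En i by (auto simp: \<E>_def)
      then show "\<kappa>' \<le> neg_index n (restr ({..<n} - E - {i}) ?P)"
        using \<kappa>' i finE unfolding set restr_Compl by simp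
    qed auto
    then obtain w where w: "w \<in> gen_nevanlinna \<kappa>'" "\<And>i. i \<in> {..<n} - E \<Longrightarrow> interpolates_at l x a g \<xi> w i"
      by blast
    have "w \<in> master_solutions n l x a g \<xi>"
      unfolding master_solutions_def pick_negative_squares_eq \<kappa>_def[symmetric]
      using w \<kappa>' En by (auto intro!: exI[of _ \<kappa>'] exI[of _ E])
    then have "w \<in> gen_nevanlinna \<kappa>"
      unfolding eq[symmetric] boundary_solutions_def pick_negative_squares_eq \<kappa>_def by blast
    then have "\<kappa> = \<kappa>'" using w(1) by (rule gen_nevanlinna_unique)
    then show False using \<kappa>' \<open>card E \<ge> 1\<close> by simp
  qed
  show "boundary_solutions n l x a g \<xi> = master_solutions n l x a g \<xi>"
    if pos: "\<forall>i<n. the (mat_inverse (pick_matrix n l x a g \<xi>)) $$ (i, i) > 0"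
  proof
    show "boundary_solutions n l x a g \<xi> \<subseteq> master_solutions n l x a g \<xi>"
      unfolding boundary_solutions_def master_solutions_def
      by (auto intro!: exI[of _ "pick_negative_squares n l x a g \<xi>"] exI[of _ "{}"])
    show "master_solutions n l x a g \<xi> \<subseteq> boundary_solutions n l x a g \<xi>"
    proof
      fix w assume "w \<in> master_solutions n l x a g \<xi>"
      then obtain \<kappa>' E where w: "\<kappa>' \<le> \<kappa>" "w \<in> gen_nevanlinna \<kappa>'" and E: "E \<subseteq> {..<n}" "card E = \<kappa> - \<kappa>'"
        and int: "\<And>i. i \<in> {..<n} - E \<Longrightarrow> interpolates_at l x a g \<xi> w i"
        unfolding master_solutions_def pick_negative_squares_eq \<kappa>_def by blast
      have finE: "finite E" using E finite_subset by blast
      have "E = {}"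
      proof (rule ccontr)
        assume "E \<noteq> {}"
        then obtain e where e: "e \<in> E" by blast
        then have "e < n" using E by auto
        have "Re (v e e) > 0" using pos \<open>e < n\<close> by (simp add: v_def)
        \<comment> \<open>The node \<open>e\<close> is removed at no cost and each other node of
          \<open>E\<close> costs at most one, which leaves more than \<kappa> - card E = \<kappa>'
          negative eigenvalues.\<close>
        have "\<kappa> \<le> neg_index n (restr (- {e}) ?P)"
          unfolding \<kappa>_def
          by (rule neg_index_le_restr_remove[OF P \<open>e < n\<close>, where v = "v e"]) (fact v[OF \<open>e < n\<close>], fact)
        also have "\<dots> \<le> neg_index n (restr (- {e} - (E - {e})) ?P) + card (E - {e})"
          using E finE by (intro neg_index_restr_remove[OF P]) auto
        also have "- {e} - (E - {e}) = - E" using e by auto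
        also have "neg_index n (restr (- E) ?P) \<le> \<kappa>'"
          unfolding restr_Compl[symmetric]
          by (rule interpolation_neg_index_le_gen_nevanlinna[OF w(2) assms(1) _ int]) auto
        finally have "\<kappa> \<le> \<kappa>' + card (E - {e})" by simp
        moreover have "card (E - {e}) < card E" using e finE by (rule card_Diff1_less[rotated])
        ultimately show False using E(2) w(1) by simp
      qed
      then have "\<kappa>' = \<kappa>" using E(2) w(1) by simp
      then show "w \<in> boundary_solutions n l x a g \<xi>"
        using w(2) int \<open>E = {}\<close> unfolding boundary_solutions_def pick_negative_squares_eq \<kappa>_def by simp
    qed
  qed
qed

end
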